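(* Let $X$ be a p.c.f. self-similar set with self-similar energy $\mathcal{E}$, self-similar measure $\mu$ and associated Laplacian $\Delta$, as in the context. Let $\lambda\in\mathbb{C}$ be such that none of the numbers $r_w\mu_w\lambda$, $w\in W_*$ (including the empty word), is a Dirichlet eigenvalue of $\Delta$. Let $\psi^{(\lambda)}_p$ ($p\in V_1\setminus V_0$) be the solution of $(\lambda\,\mathrm{id}-\Delta)\psi^{(\lambda)}_p=0$ on each $K_j=F_j(X)$ with $\psi^{(\lambda)}_p(q)=\delta_{pq}$ for $q\in V_1$. Let $G^{(\lambda)}_{pq}$ be the entries of the inverse of the matrix $B^{(\lambda)}$, indexed by $V_1\setminus V_0$, with entries $B^{(\lambda)}_{pq}:=\sum_{K_j\ni q}\partial_n^{K_j}\psi^{(\lambda)}_p(q)$, the sum being over all 1-cells containing $q$. Put $$\Psi^{(\lambda)}(x,y):=\sum_{p,q\in V_1\setminus V_0}G^{(\lambda)}_{pq}\,\psi^{(\lambda)}_p(x)\,\psi^{(\lambda)}_q(y),\qquad G^{(\lambda)}(x,y):=\sum_{w\in W_*}r_w\,\Psi^{(r_w\mu_w\lambda)}(F_w^{-1}x,F_w^{-1}y),$$ where $\Psi^{(r_w\mu_w\lambda)}(F_w^{-1}x,F_w^{-1}y)$ is taken to be $0$ unless $x,y\in F_w(X)$. Then $G^{(\lambda)}(x,y)$ is symmetric and continuous in $x$ and $y$; as a function of $y$ it belongs to $\mathrm{dom}_{\mathcal M}\Delta_y$, with $$(\lambda\,\mathrm{id}-\Delta_y)G^{(\lambda)}(x,y)=\delta_x(y),$$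 where $\delta_x$ is the Dirac mass at $x$ and $\Delta_y$ denotes $\Delta$ applied in the variable $y$. As it vanishes on $V_0$, it is the Dirichlet resolvent kernel of the Laplacian, i.e. $\int_XG^{(\lambda)}(x,y)f(y)\,d\mu(y)=(\lambda\,\mathrm{id}-\Delta)^{-1}f(x)$ for $f\in L^2(X,\mu)$, where $\Delta$ is taken with Dirichlet boundary conditions.
   Context: Self-similar set. $F_1,\dots,F_J$ are injective contractions of $\mathbb{R}^d$ (Lipschitz constants in $(0,1)$) and $X$ is the unique nonempty compact set with $X=\bigcup_j F_j(X)$. For a word $w=w_1\cdots w_m$ on $\{1,\dots,J\}$, $|w|=m$, $F_w=F_{w_1}\circ\cdots\circ F_{w_m}$, and $K_w=F_w(X)$ is an $m$-cell; $W_*=\bigcup_{m\ge0}\{1,\dots,J\}^m$ (the empty word has $F_\emptyset=\mathrm{id}$). $X$ is post-critically finite (p.c.f.): its boundary $V_0$ is a finite set of fixed points of the maps $F_j$ such that $F_w(X)\cap F_{w'}(X)\subseteq F_w(V_0)\cap F_{w'}(V_0)$ for distinct words $w,w'$ of equal length. $V_m=\bigcup_{|w|=m}F_w(V_0)$. $\sum_{K_j\ni q}$ means the sum over $\{j: q\in F_j(X)\}$. Energy. It is assumed that there is a self-similar energy: conductances $c_{xy}=c_{yx}$ on $V_0$ and factors $r_1,\dots,r_J\in(0,1)$ such that, with $\mathcal{E}_0(u,v)=\frac12\sum_{x,y\in V_0}c_{xy}(u(x)-u(y))(v(x)-v(y))$ and $\mathcal{E}_m(u,v)=\sum_{|w|=m}r_w^{-1}\mathcal{E}_0(u\circ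 F_w,v\circ F_w)$, $\mathcal{E}_0(u)$ is the minimum of $\mathcal{E}_1$ over extensions of $u$ from $V_0$ to $V_1$; $\mathcal{E}=\lim_m\mathcal{E}_m$ is a Dirichlet form with $\mathcal{E}(u)=\sum_j r_j^{-1}\mathcal{E}(u\circ F_j)$, vanishing only on constants, $\mathrm{dom}\,\mathcal{E}=\{u:\mathcal{E}(u)<\infty\}$, and $\mathrm{dom}_0\,\mathcal{E}$ is the set of $u\in\mathrm{dom}\,\mathcal{E}$ vanishing on $V_0$. Here $r_w=r_{w_1}\cdots r_{w_m}$, $r_\emptyset=1$. Measure. $\mu$ is the self-similar probability measure with weights $\mu_j\in(0,1)$, $\sum_j\mu_j=1$: $\mu(A)=\sum_j\mu_j\mu(F_j^{-1}A)$; $\mu_w=\mu_{w_1}\cdots\mu_{w_m}$, $\mu_\emptyset=1$. Laplacian. For $u\in\mathrm{dom}\,\mathcal{E}$ and $f$ continuous (resp. $f\in L^2(\mu)$), $u\in\mathrm{dom}\,\Delta$ (resp. $\mathrm{dom}_{L^2}\Delta$) with $\Delta u=f$ iff $\mathcal{E}(u,v)=-\int_X fv\,d\mu$ for all $v\in\mathrm{dom}_0\,\mathcal{E}$. More generally $u\in\mathrm{dom}_{\mathcal M}\Delta$ with $\Delta u=\nu$, $\nu$ a finite signed (or complex) Borel measure, iff $\mathcal{E}(u,v)=-\int_X v\,d\nu$ for all $v\in\mathrm{dom}_0\,\mathcal{E}$ (so $\nu$ matters only on $X\setminus V_0$); functions $f$ are identified with measures $f\mu$. An equation $\Delta u=f$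 "on the cell $K_w$" means $\Delta(u\circ F_w)=r_w\mu_w\, f\circ F_w$ on $X$. Functions may be complex-valued, with $\mathcal{E}$ extended bilinearly. Normal derivatives. For $q\in V_0$ the fixed point of $F_i$, $\partial_nu(q)=\lim_{m\to\infty}r_i^{-m}\sum_{q'\in V_0}c_{qq'}\big(u(q)-u(F_i^mq')\big)$. At $x=F_wq$, $q\in V_0$, the normal derivative with respect to the cell $K_w$ is $\partial_n^{K_w}u(x)=r_w^{-1}\,\partial_n(u\circ F_w)(q)$. A Dirichlet eigenvalue of $\Delta$ is a $\lambda$ for which there is a nonzero $u\in\mathrm{dom}\,\Delta$ with $\Delta u=\lambda u$ and $u|_{V_0}=0$. $(\lambda\,\mathrm{id}-\Delta)^{-1}f$ (Dirichlet) is the unique $u\in\mathrm{dom}_{L^2}\Delta$ with $(\lambda\,\mathrm{id}-\Delta)u=f$ and $u|_{V_0}=0$.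
   Formalization: Post-critical finiteness also includes Kigami's condition that the post-critical set is finite, so each point of V_0 lies in exactly one 1-cell; under the listed boundary conditions alone the normal derivative can miss flux, making the matrix B, and hence the claim, wrong. *)

theory Defs
  imports "HOL-Probability.Probability_Measure"
begin

section \<open>Self-similar sets, words and cells\<close>

text \<open>
  The data of a self-similar set with energy and measure.  The maps, the resistance factors and the
  measure weights are indexed by \<open>{1..nmaps}\<close>; values at other indices are irrelevant.
  Functions on the attractor are total functions on the ambient space of which only the values on
  the attractor matter.
\<close>

record 'a pcf =
  nmaps :: nat
  smap :: "nat \<Rightarrow> 'a \<Rightarrow> 'a"
  attr :: "'a set"
  bdry :: "'a set"
  conduct :: "'a \<Rightarrow> 'a \<Rightarrow> real"
  rfac :: "nat \<Rightarrow> real"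
  mwt :: "nat \<Rightarrow> real"
  meas :: "'a measure"

definition self_similar_set :: "'a::euclidean_space pcf \<Rightarrow> bool" where
  "self_similar_set S \<longleftrightarrow>
     (\<forall>j\<in>{1..nmaps S}. inj (smap S j) \<and> (\<exists>L. 0 < L \<and> L < 1 \<and> L-lipschitz_on UNIV (smap S j))) \<and>
     attr S \<noteq> {} \<and> compact (attr S) \<and> attr S = (\<Union>j\<in>{1..nmaps S}. smap S j ` attr S)"

definition words :: "'a pcf \<Rightarrow> nat list set" where
  "words S = {w. set w \<subseteq> {1..nmaps S}}"

definition words_of_length :: "'a pcf \<Rightarrow> nat \<Rightarrow> nat list set" where
  "words_of_length S m = {w \<in> words S. length w = m}"

primrec word_map :: "'a pcf \<Rightarrow> nat list \<Rightarrow> 'a \<Rightarrow> 'a" where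
  "word_map S [] = id"
| "word_map S (j # w) = smap S j \<circ> word_map S w"

definition cell :: "'a pcf \<Rightarrow> nat list \<Rightarrow> 'a set" where
  "cell S w = word_map S w ` attr S"

definition word_r :: "'a pcf \<Rightarrow> nat list \<Rightarrow> real" where
  "word_r S w = prod_list (map (rfac S) w)"

definition word_mu :: "'a pcf \<Rightarrow> nat list \<Rightarrow> real" where
  "word_mu S w = prod_list (map (mwt S) w)"

definition level_vertices :: "'a pcf \<Rightarrow> nat \<Rightarrow> 'a set" where
  "level_vertices S m = (\<Union>w\<in>words_of_length S m. word_map S w ` bdry S)"

definition all_vertices :: "'a pcf \<Rightarrow> 'a set" where
  "all_vertices S = (\<Union>m. level_vertices S m)"

text \<open>
  Kigami's post-critical set: the critical set consists of all addresses of points that lie in two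
  different 1-cells, and the post-critical set of all its proper shifts.
\<close>

definition is_address :: "'a pcf \<Rightarrow> (nat \<Rightarrow> nat) \<Rightarrow> 'a \<Rightarrow> bool" where
  "is_address S a x \<longleftrightarrow> range a \<subseteq> {1..nmaps S} \<and> (\<forall>m. x \<in> cell S (map a [0..<m]))"

definition critical_set :: "'a pcf \<Rightarrow> (nat \<Rightarrow> nat) set" where
  "critical_set S = {a. \<exists>x. is_address S a x \<and>
     (\<exists>i\<in>{1..nmaps S}. \<exists>j\<in>{1..nmaps S}. i \<noteq> j \<and> x \<in> cell S [i] \<inter> cell S [j])}"

definition post_critical_set :: "'a pcf \<Rightarrow> (nat \<Rightarrow> nat) set" where
  "post_critical_set S = (\<Union>n\<in>{1..}. (\<lambda>a k. a (k + n)) ` critical_set S)"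

text \<open>
  Finiteness of the post-critical set makes every boundary point the fixed point of exactly one of
  the maps and a member of exactly one 1-cell.  This does not follow from the conditions on the
  boundary alone, and the normal derivatives below depend on it.
\<close>

definition post_critically_finite :: "'a pcf \<Rightarrow> bool" where
  "post_critically_finite S \<longleftrightarrow>
     finite (post_critical_set S) \<and>
     finite (bdry S) \<and>
     (\<forall>q\<in>bdry S. \<exists>j\<in>{1..nmaps S}. smap S j q = q) \<and>
     (\<forall>w\<in>words S. \<forall>w'\<in>words S. length w = length w' \<longrightarrow> w \<noteq> w' \<longrightarrow>
        cell S w \<inter> cell S w' \<subseteq> word_map S w ` bdry S \<inter> word_map S w' ` bdry S)"


section \<open>Measure\<close>

definition self_similar_measure :: "'a::euclidean_space pcf \<Rightarrow> bool" where
  "self_similar_measure S \<longleftrightarrow>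
     (\<forall>j\<in>{1..nmaps S}. 0 < mwt S j \<and> mwt S j < 1) \<and>
     (\<Sum>j\<in>{1..nmaps S}. mwt S j) = 1 \<and>
     prob_space (meas S) \<and>
     sets (meas S) = sets (restrict_space borel (attr S)) \<and>
     (\<forall>A\<in>sets (meas S). measure (meas S) A =
        (\<Sum>j\<in>{1..nmaps S}. mwt S j * measure (meas S) (smap S j -` A \<inter> attr S)))"

definition L2_functions :: "'a pcf \<Rightarrow> ('a \<Rightarrow> 'b::real_normed_vector) set" where
  "L2_functions S = {f. f \<in> borel_measurable (meas S) \<and> integrable (meas S) (\<lambda>x. (norm (f x))\<^sup>2)}"


section \<open>Energy\<close>

text \<open>
  The energies are bilinear (not sesquilinear) for complex-valued functions, hence they are defined
  uniformly for real and complex values.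
\<close>

definition energy0 ::
    "'a pcf \<Rightarrow> ('a \<Rightarrow> 'b::real_normed_field) \<Rightarrow> ('a \<Rightarrow> 'b) \<Rightarrow> 'b" where
  "energy0 S u v =
     (\<Sum>x\<in>bdry S. \<Sum>y\<in>bdry S. of_real (conduct S x y) * (u x - u y) * (v x - v y)) / 2"

definition energy_level ::
    "'a pcf \<Rightarrow> nat \<Rightarrow> ('a \<Rightarrow> 'b::real_normed_field) \<Rightarrow> ('a \<Rightarrow> 'b) \<Rightarrow> 'b" where
  "energy_level S m u v =
     (\<Sum>w\<in>words_of_length S m.
        of_real (inverse (word_r S w)) * energy0 S (u \<circ> word_map S w) (v \<circ> word_map S w))"

definition energy ::
    "'a pcf \<Rightarrow> ('a \<Rightarrow> 'b::real_normed_field) \<Rightarrow> ('a \<Rightarrow> 'b) \<Rightarrow> 'b" where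
  "energy S u v = lim (\<lambda>m. energy_level S m u v)"

text \<open>
  Under the renormalization condition below \<open>energy_level S m u u\<close> increases with \<open>m\<close>, so finiteness
  of the energy is convergence of this sequence.  The energy only sees the values on the vertices,
  where finite energy forces uniform continuity; its domain is identified, as usual, with the
  continuous functions on the attractor that have finite energy.
\<close>

definition dom_energy_real :: "'a::euclidean_space pcf \<Rightarrow> ('a \<Rightarrow> real) set" where
  "dom_energy_real S = {u. continuous_on (attr S) u \<and> convergent (\<lambda>m. energy_level S m u u)}"

definition dom_energy :: "'a::euclidean_space pcf \<Rightarrow> ('a \<Rightarrow> complex) set" where
  "dom_energy S =
     {u. (\<lambda>x. Re (u x)) \<in> dom_energy_real S \<and> (\<lambda>x. Im (u x)) \<in> dom_energy_real S}"

definition dom0_energy :: "'a::euclidean_space pcf \<Rightarrow> ('a \<Rightarrow> complex) set" where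
  "dom0_energy S = {u \<in> dom_energy S. \<forall>q\<in>bdry S. u q = 0}"

text \<open>
  A Dirichlet form on \<open>L\<^sup>2(\<mu>)\<close>, given on a domain \<open>D\<close> of representatives: densely defined, symmetric,
  bilinear, nonnegative, closed and Markovian.
\<close>

definition dirichlet_form ::
    "'a pcf \<Rightarrow> ('a \<Rightarrow> real) set \<Rightarrow> (('a \<Rightarrow> real) \<Rightarrow> ('a \<Rightarrow> real) \<Rightarrow> real) \<Rightarrow> bool" where
  "dirichlet_form S D E \<longleftrightarrow>
     D \<subseteq> L2_functions S \<and>
     (\<lambda>x. 0) \<in> D \<and>
     (\<forall>u\<in>D. \<forall>v\<in>D. (\<lambda>x. u x + v x) \<in> D) \<and>
     (\<forall>a. \<forall>u\<in>D. (\<lambda>x. a * u x) \<in> D) \<and>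
     (\<forall>f\<in>L2_functions S. \<forall>e>0. \<exists>u\<in>D. (\<integral>x. (f x - u x)\<^sup>2 \<partial>meas S) < e) \<and>
     (\<forall>u\<in>D. \<forall>v\<in>D. E u v = E v u) \<and>
     (\<forall>u\<in>D. \<forall>v\<in>D. \<forall>g\<in>D. E (\<lambda>x. u x + v x) g = E u g + E v g) \<and>
     (\<forall>a. \<forall>u\<in>D. \<forall>v\<in>D. E (\<lambda>x. a * u x) v = a * E u v) \<and>
     (\<forall>u\<in>D. 0 \<le> E u u) \<and>
     (\<forall>U. (\<forall>n. U n \<in> D) \<longrightarrow>
        (\<forall>e>0. \<exists>N::nat. \<forall>m\<ge>N. \<forall>n\<ge>N.
           E (\<lambda>x. U m x - U n x) (\<lambda>x. U m x - U n x) + (\<integral>x. (U m x - U n x)\<^sup>2 \<partial>meas S) < e) \<longrightarrow>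
        (\<exists>u\<in>D. (\<lambda>n. E (\<lambda>x. U n x - u x) (\<lambda>x. U n x - u x)
                     + (\<integral>x. (U n x - u x)\<^sup>2 \<partial>meas S)) \<longlonglongrightarrow> 0)) \<and>
     (\<forall>u\<in>D. (\<lambda>x. min (max (u x) 0) 1) \<in> D \<and>
        E (\<lambda>x. min (max (u x) 0) 1) (\<lambda>x. min (max (u x) 0) 1) \<le> E u u)"

text \<open>
  In the last condition \<open>u\<close> need not be continuous: a function on the vertices with vanishing limit
  energy is constant there.  This contains the irreducibility of the conductance network on the
  boundary.
\<close>

definition self_similar_energy :: "'a::euclidean_space pcf \<Rightarrow> bool" where
  "self_similar_energy S \<longleftrightarrow>
     (\<forall>x\<in>bdry S. \<forall>y\<in>bdry S. 0 \<le> conduct S x y \<and> conduct S x y = conduct S y x) \<and>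
     (\<forall>j\<in>{1..nmaps S}. 0 < rfac S j \<and> rfac S j < 1) \<and>
     (\<forall>u :: 'a \<Rightarrow> real.
        (\<forall>v. (\<forall>q\<in>bdry S. v q = u q) \<longrightarrow> energy0 S u u \<le> energy_level S 1 v v) \<and>
        (\<exists>v. (\<forall>q\<in>bdry S. v q = u q) \<and> energy_level S 1 v v = energy0 S u u)) \<and>
     dirichlet_form S (dom_energy_real S) (energy S) \<and>
     (\<forall>u\<in>dom_energy_real S. energy S u u =
        (\<Sum>j\<in>{1..nmaps S}. inverse (rfac S j) * energy S (u \<circ> smap S j) (u \<circ> smap S j))) \<and>
     (\<forall>u :: 'a \<Rightarrow> real. (\<lambda>m. energy_level S m u u) \<longlonglongrightarrow> 0 \<longrightarrow>
        (\<exists>k. \<forall>x\<in>all_vertices S. u x = k))"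


section \<open>Laplacian\<close>

definition weak_laplacian ::
    "'a::euclidean_space pcf \<Rightarrow> ('a \<Rightarrow> complex) \<Rightarrow> ('a \<Rightarrow> complex) \<Rightarrow> bool" where
  "weak_laplacian S u f \<longleftrightarrow>
     u \<in> dom_energy S \<and> (\<forall>v\<in>dom0_energy S. energy S u v = - (\<integral>x. f x * v x \<partial>meas S))"

text \<open>\<open>u \<in> dom \<Delta>\<close> and \<open>\<Delta>u = f\<close>\<close>

definition has_laplacian ::
    "'a::euclidean_space pcf \<Rightarrow> ('a \<Rightarrow> complex) \<Rightarrow> ('a \<Rightarrow> complex) \<Rightarrow> bool" where
  "has_laplacian S u f \<longleftrightarrow> continuous_on (attr S) f \<and> weak_laplacian S u f"

text \<open>\<open>u \<in> dom\<^bsub>L\<^sup>2\<^esub> \<Delta>\<close> and \<open>\<Delta>u = f\<close>\<close>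

definition has_L2_laplacian ::
    "'a::euclidean_space pcf \<Rightarrow> ('a \<Rightarrow> complex) \<Rightarrow> ('a \<Rightarrow> complex) \<Rightarrow> bool" where
  "has_L2_laplacian S u f \<longleftrightarrow> f \<in> L2_functions S \<and> weak_laplacian S u f"

text \<open>
  A finite complex (in particular: signed) measure on the \<open>\<sigma>\<close>-algebra of \<open>M\<close> is a countably additive
  set function.  Integrals against it are defined by writing it as a linear combination of finite
  positive measures, which is possible by the Jordan decomposition; the value does not depend on
  the choice if the integrand is bounded and measurable.
\<close>

definition complex_measure :: "'a measure \<Rightarrow> ('a set \<Rightarrow> complex) \<Rightarrow> bool" where
  "complex_measure M \<nu> \<longleftrightarrow>
     (\<forall>A::nat \<Rightarrow> 'a set. range A \<subseteq> sets M \<longrightarrow> disjoint_family A \<longrightarrow>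
        (\<lambda>i. \<nu> (A i)) sums \<nu> (\<Union>i. A i))"

definition complex_measure_integral ::
    "'a measure \<Rightarrow> ('a set \<Rightarrow> complex) \<Rightarrow> ('a \<Rightarrow> complex) \<Rightarrow> complex" where
  "complex_measure_integral M \<nu> v =
     (THE I. \<exists>(n::nat) a N.
        (\<forall>k<n. finite_measure (N k) \<and> sets (N k) = sets M) \<and>
        (\<forall>A\<in>sets M. \<nu> A = (\<Sum>k<n. a k * of_real (measure (N k) A))) \<and>
        I = (\<Sum>k<n. a k * (\<integral>x. v x \<partial>N k)))"

text \<open>\<open>u \<in> dom\<^bsub>M\<^esub> \<Delta>\<close> and \<open>\<Delta>u = \<nu>\<close>\<close>

definition has_measure_laplacian ::
    "'a::euclidean_space pcf \<Rightarrow> ('a \<Rightarrow> complex) \<Rightarrow> ('a set \<Rightarrow> complex) \<Rightarrow> bool" where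
  "has_measure_laplacian S u \<nu> \<longleftrightarrow>
     complex_measure (meas S) \<nu> \<and> u \<in> dom_energy S \<and>
     (\<forall>v\<in>dom0_energy S. energy S u v = - complex_measure_integral (meas S) \<nu> v)"

text \<open>The identification of a function \<open>f\<close> with the measure \<open>f\<mu>\<close>\<close>

definition function_measure :: "'a pcf \<Rightarrow> ('a \<Rightarrow> complex) \<Rightarrow> 'a set \<Rightarrow> complex" where
  "function_measure S f A = (LINT x:A|meas S. f x)"

definition dirac_measure :: "'a \<Rightarrow> 'a set \<Rightarrow> complex" where
  "dirac_measure x A = (if x \<in> A then 1 else 0)"

definition has_laplacian_on_cell ::
    "'a::euclidean_space pcf \<Rightarrow> nat list \<Rightarrow> ('a \<Rightarrow> complex) \<Rightarrow> ('a \<Rightarrow> complex) \<Rightarrow> bool" where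
  "has_laplacian_on_cell S w u f \<longleftrightarrow>
     has_laplacian S (u \<circ> word_map S w)
       (\<lambda>x. of_real (word_r S w * word_mu S w) * f (word_map S w x))"

definition dirichlet_eigenvalue :: "'a::euclidean_space pcf \<Rightarrow> complex \<Rightarrow> bool" where
  "dirichlet_eigenvalue S \<kappa> \<longleftrightarrow>
     (\<exists>u. (\<exists>x\<in>attr S. u x \<noteq> 0) \<and> (\<forall>q\<in>bdry S. u q = 0) \<and> has_laplacian S u (\<lambda>x. \<kappa> * u x))"

text \<open>\<open>u\<close> solves \<open>(\<lambda> id - \<Delta>)u = f\<close> in \<open>dom\<^bsub>L\<^sup>2\<^esub> \<Delta>\<close> with Dirichlet boundary conditions\<close>

definition dirichlet_resolvent_solution ::
    "'a::euclidean_space pcf \<Rightarrow> complex \<Rightarrow> ('a \<Rightarrow> complex) \<Rightarrow> ('a \<Rightarrow> complex) \<Rightarrow> bool" where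
  "dirichlet_resolvent_solution S lam f u \<longleftrightarrow>
     has_L2_laplacian S u (\<lambda>x. lam * u x - f x) \<and> (\<forall>q\<in>bdry S. u q = 0)"

text \<open>\<open>u = (\<lambda> id - \<Delta>)\<^sup>-\<^sup>1 f\<close> on the attractor\<close>

definition is_dirichlet_resolvent ::
    "'a::euclidean_space pcf \<Rightarrow> complex \<Rightarrow> ('a \<Rightarrow> complex) \<Rightarrow> ('a \<Rightarrow> complex) \<Rightarrow> bool" where
  "is_dirichlet_resolvent S lam f u \<longleftrightarrow>
     dirichlet_resolvent_solution S lam f u \<and>
     (\<forall>u'. dirichlet_resolvent_solution S lam f u' \<longrightarrow> (\<forall>x\<in>attr S. u' x = u x))"


section \<open>Normal derivatives\<close>

definition normal_derivative :: "'a pcf \<Rightarrow> ('a \<Rightarrow> complex) \<Rightarrow> 'a \<Rightarrow> complex" where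
  "normal_derivative S u q =
     (let i = (THE i. i \<in> {1..nmaps S} \<and> smap S i q = q) in
      lim (\<lambda>m. of_real (inverse (rfac S i ^ m)) *
             (\<Sum>q'\<in>bdry S. of_real (conduct S q q') * (u q - u ((smap S i ^^ m) q')))))"

definition cell_normal_derivative ::
    "'a pcf \<Rightarrow> nat list \<Rightarrow> ('a \<Rightarrow> complex) \<Rightarrow> 'a \<Rightarrow> complex" where
  "cell_normal_derivative S w u x =
     of_real (inverse (word_r S w)) *
       normal_derivative S (u \<circ> word_map S w) (inv (word_map S w) x)"


section \<open>The resolvent kernel\<close>

definition inner_vertices :: "'a pcf \<Rightarrow> 'a set" where
  "inner_vertices S = level_vertices S 1 - bdry S"

text \<open>The value 0 off the attractor is a convention that makes the solution unique as a total function.\<close>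

definition psi :: "'a::euclidean_space pcf \<Rightarrow> complex \<Rightarrow> 'a \<Rightarrow> 'a \<Rightarrow> complex" where
  "psi S lam p =
     (THE u. (\<forall>j\<in>{1..nmaps S}. has_laplacian_on_cell S [j] u (\<lambda>x. lam * u x)) \<and>
             (\<forall>q\<in>level_vertices S 1. u q = (if q = p then 1 else 0)) \<and>
             (\<forall>x. x \<notin> attr S \<longrightarrow> u x = 0))"

definition B_matrix :: "'a::euclidean_space pcf \<Rightarrow> complex \<Rightarrow> 'a \<Rightarrow> 'a \<Rightarrow> complex" where
  "B_matrix S lam p q =
     (\<Sum>j\<in>{j \<in> {1..nmaps S}. q \<in> cell S [j]}. cell_normal_derivative S [j] (psi S lam p) q)"

definition is_inverse_matrix_on ::
    "'a set \<Rightarrow> ('a \<Rightarrow> 'a \<Rightarrow> complex) \<Rightarrow> ('a \<Rightarrow> 'a \<Rightarrow> complex) \<Rightarrow> bool" where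
  "is_inverse_matrix_on I B C \<longleftrightarrow>
     (\<forall>p\<in>I. \<forall>q\<in>I. (\<Sum>s\<in>I. B p s * C s q) = (if p = q then 1 else 0) \<and>
                   (\<Sum>s\<in>I. C p s * B s q) = (if p = q then 1 else 0))"

definition G_matrix :: "'a::euclidean_space pcf \<Rightarrow> complex \<Rightarrow> 'a \<Rightarrow> 'a \<Rightarrow> complex" where
  "G_matrix S lam = (SOME C. is_inverse_matrix_on (inner_vertices S) (B_matrix S lam) C)"

definition Psi :: "'a::euclidean_space pcf \<Rightarrow> complex \<Rightarrow> 'a \<Rightarrow> 'a \<Rightarrow> complex" where
  "Psi S lam x y =
     (\<Sum>p\<in>inner_vertices S. \<Sum>q\<in>inner_vertices S. G_matrix S lam p q * psi S lam p x * psi S lam q y)"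

definition kernel_term ::
    "'a::euclidean_space pcf \<Rightarrow> complex \<Rightarrow> 'a \<Rightarrow> 'a \<Rightarrow> nat list \<Rightarrow> complex" where
  "kernel_term S lam x y w =
     (if x \<in> cell S w \<and> y \<in> cell S w
      then of_real (word_r S w) *
             Psi S (of_real (word_r S w * word_mu S w) * lam)
               (inv (word_map S w) x) (inv (word_map S w) y)
      else 0)"

definition resolvent_kernel :: "'a::euclidean_space pcf \<Rightarrow> complex \<Rightarrow> 'a \<Rightarrow> 'a \<Rightarrow> complex" where
  "resolvent_kernel S lam x y = (\<Sum>\<^sub>\<infinity>w\<in>words S. kernel_term S lam x y w)"

end

theory Submission
  imports Defs
begin

text \<open>
  The heart of the matter is a Green function \<open>g\<^sub>\<kappa>\<close> for every \<open>\<kappa>\<close> that is not a Dirichlet eigenvalue: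
  \<open>E(g\<^sub>\<kappa>(x,\<cdot>), v) + \<kappa> \<integral> g\<^sub>\<kappa>(x,\<cdot>) v d\<mu> = v(x)\<close> for all \<open>v\<close> of finite energy vanishing on the boundary.  It is
  obtained without spectral theory.  A function vanishing on \<open>V\<^sub>m\<close> satisfies \<open>sup |u|\<^sup>2 \<le> C \<rho>\<^sup>m E(u)\<close> with
  \<open>\<rho> < 1\<close>, so on such functions the term with \<open>\<kappa>\<close> is a small perturbation of the energy, and what
  remains is a finite linear system, which is injective exactly because \<open>\<kappa>\<close> is not an eigenvalue.

  The Gauss--Green formula reads \<open>(\<kappa> - \<Delta>) \<psi>\<^sub>p = \<Sum>\<^sub>q B\<^sub>p\<^sub>q \<delta>\<^sub>q\<close>, hence \<open>\<psi>\<^sub>p = \<Sum>\<^sub>q B\<^sub>p\<^sub>q g\<^sub>\<kappa>(q,\<cdot>)\<close>, and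
  evaluation at the inner vertices shows that \<open>g\<^sub>\<kappa>\<close> itself is the inverse of \<open>B\<close> there.  Comparing
  boundary values on the 1-cells gives
  \<open>g\<^sub>\<kappa>(x,y) = \<Psi>\<^sub>\<kappa>(x,y) + \<Sum>\<^sub>j r\<^sub>j g\<^bsub>\<kappa>(j)\<^esub>(F\<^sub>j\<^sup>-\<^sup>1x, F\<^sub>j\<^sup>-\<^sup>1y)\<close> with \<open>\<kappa>(j) = r\<^sub>j \<mu>\<^sub>j \<kappa>\<close>, and iterating
  this identity makes the defining series telescope to \<open>g\<^sub>\<lambda>\<close>, the remainder being bounded by a
  constant times \<open>\<rho>\<^sup>m\<close>.
\<close>


section \<open>Finite linear systems\<close>

text \<open>For complex \<kappa> the form of the equation is symmetric and bilinear, but neither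
  Hermitian nor coercive, which rules out Riesz' theorem on the whole space. The energy is a limit
  of vertex sums and by itself says nothing about points between vertices; one constant
  \<open>res\<close> with \<open>(u x - u y)\<^sup>2 \<le> res * E(u)\<close> carries all passages
  from vertices to the attractor. Two kinds of uniformity make the remainder of the series small.
  The parameters \<open>r\<^sub>w \<mu>\<^sub>w \<lambda>\<close> tend to 0, and below a threshold
  the equation is a small perturbation without any finite system, which bounds the Green function by
  \<open>2 * res\<close> whatever the word is. The number of words of length m grows exponentially,
  yet at a given pair of points at most one of them contributes, because Green functions vanish on
  the boundary. The existence of the normal derivatives is not among the assumptions; it comes out
  of the proof of the Gauss--Green formula, by testing with functions that keep their boundary
  values while their supports shrink to a point.\<close>

lemma underdetermined_system_nontrivial:
  fixes M :: "'b \<Rightarrow> 'c \<Rightarrow> 'k::field"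
  assumes "finite J" "finite I" "card J < card I"
  shows "\<exists>a. (\<exists>p\<in>I. a p \<noteq> 0) \<and> (\<forall>q\<in>J. (\<Sum>p\<in>I. a p * M p q) = 0)"
  using assms
proof (induction J arbitrary: I M rule: finite_induct)
  case empty
  then show ?case by (intro exI[of _ "\<lambda>_. 1"]) (auto simp: card_gt_0_iff)
next
  case (insert q J)
  show ?case
  proof (cases "\<forall>p\<in>I. M p q = 0")
    case True
    have "card J < card I" using insert by simp
    from insert.IH[OF insert.prems(1) this, of M] obtain a where
      a: "\<exists>p\<in>I. a p \<noteq> 0" "\<forall>q\<in>J. (\<Sum>p\<in>I. a p * M p q) = 0" by blast
    then show ?thesis using True by (intro exI[of _ a]) auto
  next
    case False
    then obtain p0 where p0: "p0 \<in> I" "M p0 q \<noteq> 0" by blast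
    define I' where "I' = I - {p0}"
    have I: "I = insert p0 I'" "p0 \<notin> I'" "finite I'" using p0 insert.prems by (auto simp: I'_def)
    have "card J < card I'" using insert I by auto
    \<comment> \<open>Gaussian elimination: the pivot row \<open>p0\<close> clears column
      \<open>q\<close> from the other rows, and the coefficient of \<open>p0\<close> is fixed
      afterwards by the equation for \<open>q\<close>.\<close>
    from insert.IH[OF I(3) this, of "\<lambda>p s. M p s - M p q / M p0 q * M p0 s"]
    obtain a where a: "\<exists>p\<in>I'. a p \<noteq> 0"
      "\<And>s. s \<in> J \<Longrightarrow> (\<Sum>p\<in>I'. a p * (M p s - M p q / M p0 q * M p0 s)) = 0" by blast
    define a' where "a' = a(p0 := - (\<Sum>p\<in>I'. a p * M p q) / M p0 q)"
    have sp: "(\<Sum>p\<in>I. a' p * M p s) = a' p0 * M p0 s + (\<Sum>p\<in>I'. a p * M p s)" for s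
    proof -
      have "(\<Sum>p\<in>I'. a' p * M p s) = (\<Sum>p\<in>I'. a p * M p s)"
        using I by (intro sum.cong) (auto simp: a'_def)
      then show ?thesis unfolding I(1) using I by simp
    qed
    have "(\<Sum>p\<in>I. a' p * M p s) = 0" if "s \<in> insert q J" for s
    proof (cases "s = q")
      case True
      then show ?thesis using p0 unfolding sp by (simp add: a'_def)
    next
      case False
      then have "s \<in> J" using that by simp
      from a(2)[OF this] have "(\<Sum>p\<in>I'. a p * M p s) = (\<Sum>p\<in>I'. a p * M p q) / M p0 q * M p0 s"
        by (simp add: right_diff_distrib sum_subtractf sum_divide_distrib sum_distrib_right mult.assoc)
      then show ?thesis unfolding sp by (simp add: a'_def)
    qed
    moreover have "\<exists>p\<in>I. a' p \<noteq> 0" using a(1) I by (auto simp: a'_def)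
    ultimately show ?thesis by blast
  qed
qed

text \<open>The rows of \<open>M\<close> and the unit vector of index \<open>p\<close> are
  \<open>card I + 1\<close> vectors with \<open>card I\<close> entries, hence linearly dependent. By
  injectivity the unit vector has a nonzero coefficient in the relation, and dividing by it gives
  row \<open>p\<close> of the inverse. In the proof \<open>None\<close> indexes the unit
  vector.\<close>

lemma injective_matrix_left_inverse:
  fixes M :: "'b \<Rightarrow> 'b \<Rightarrow> 'k::field"
  assumes fin: "finite I"
    and inj: "\<And>a. (\<And>q. q \<in> I \<Longrightarrow> (\<Sum>p\<in>I. a p * M p q) = 0) \<Longrightarrow> (\<forall>p\<in>I. a p = 0)"
  shows "\<exists>C. \<forall>p\<in>I. \<forall>q\<in>I. (\<Sum>s\<in>I. C p s * M s q) = (if p = q then 1 else 0)"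
proof -
  have "\<exists>c. \<forall>q\<in>I. (\<Sum>s\<in>I. c s * M s q) = (if p = q then 1 else 0)" for p
  proof -
    define M' where "M' = (\<lambda>s q. case s of Some s \<Rightarrow> M s q | None \<Rightarrow> (if p = q then 1 else 0))"
    have fin': "finite (insert None (Some ` I))" "card I < card (insert None (Some ` I))"
      using fin by (simp_all add: card_image)
    have sp: "(\<Sum>s\<in>insert None (Some ` I). a s * M' s q) =
        a None * (if p = q then 1 else 0) + (\<Sum>s\<in>I. a (Some s) * M s q)" for a q
      using fin by (subst sum.insert) (auto simp: M'_def sum.reindex)
    from underdetermined_system_nontrivial[OF fin fin', of M'] obtain a where
      a: "\<exists>p\<in>insert None (Some ` I). a p \<noteq> 0"
      "\<And>q. q \<in> I \<Longrightarrow> a None * (if p = q then 1 else 0) + (\<Sum>s\<in>I. a (Some s) * M s q) = 0"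
      unfolding sp by blast
    have nz: "a None \<noteq> 0"
    proof
      assume z: "a None = 0"
      have "\<forall>s\<in>I. a (Some s) = 0" by (rule inj) (use a(2) z in simp)
      then show False using a(1) z by auto
    qed
    have "(\<Sum>s\<in>I. (- a (Some s) / a None) * M s q) = (if p = q then 1 else 0)" if "q \<in> I" for q
    proof -
      have "(\<Sum>s\<in>I. (- a (Some s) / a None) * M s q) = - (\<Sum>s\<in>I. a (Some s) * M s q) / a None"
        by (simp add: sum_divide_distrib sum_negf)
      also have "(\<Sum>s\<in>I. a (Some s) * M s q) = - (a None * (if p = q then 1 else 0))"
        using a(2)[OF that] by (simp add: eq_neg_iff_add_eq_0 add.commute)
      finally show ?thesis using nz by simp
    qed
    then show ?thesis by (intro exI[of _ "\<lambda>s. - a (Some s) / a None"]) blast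
  qed
  then obtain C where "\<And>p. \<forall>q\<in>I. (\<Sum>s\<in>I. C p s * M s q) = (if p = q then 1 else 0)" by metis
  then show ?thesis by blast
qed

section \<open>Hilbert spaces of functions\<close>

text \<open>\<open>E\<close> is bilinear like the energies, so the inner product of \<open>u\<close>
  and \<open>v\<close> is \<open>E u (cnj v)\<close>. It gives only a seminorm: functions that
  differ off the attractor are different elements of \<open>H\<close> at distance 0. Hence limits
  and solutions are determined only up to seminorm 0.\<close>

locale function_hilbert =
  fixes H :: "('a \<Rightarrow> complex) set" and E :: "('a \<Rightarrow> complex) \<Rightarrow> ('a \<Rightarrow> complex) \<Rightarrow> complex"
  assumes zero: "(\<lambda>x. 0) \<in> H"
    and add: "u \<in> H \<Longrightarrow> v \<in> H \<Longrightarrow> (\<lambda>x. u x + v x) \<in> H"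
    and scale: "u \<in> H \<Longrightarrow> (\<lambda>x. c * u x) \<in> H"
    and cnj_closed: "u \<in> H \<Longrightarrow> (\<lambda>x. cnj (u x)) \<in> H"
    and E_sym: "u \<in> H \<Longrightarrow> v \<in> H \<Longrightarrow> E u v = E v u"
    and E_add: "u \<in> H \<Longrightarrow> v \<in> H \<Longrightarrow> w \<in> H \<Longrightarrow> E (\<lambda>x. u x + v x) w = E u w + E v w"
    and E_scale: "u \<in> H \<Longrightarrow> w \<in> H \<Longrightarrow> E (\<lambda>x. c * u x) w = c * E u w"
    and E_cnj: "u \<in> H \<Longrightarrow> v \<in> H \<Longrightarrow> E (\<lambda>x. cnj (u x)) (\<lambda>x. cnj (v x)) = cnj (E u v)"
    and E_nonneg: "u \<in> H \<Longrightarrow> 0 \<le> Re (E u (\<lambda>x. cnj (u x)))"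
    and complete: "(\<And>n. U n \<in> H) \<Longrightarrow>
      (\<And>e. e > 0 \<Longrightarrow> \<exists>N::nat. \<forall>m\<ge>N. \<forall>n\<ge>N.
          Re (E (\<lambda>x. U m x - U n x) (\<lambda>x. cnj (U m x - U n x))) < e) \<Longrightarrow>
      \<exists>u\<in>H. (\<lambda>n. Re (E (\<lambda>x. U n x - u x) (\<lambda>x. cnj (U n x - u x)))) \<longlonglongrightarrow> 0"
begin

definition nrm2 :: "('a \<Rightarrow> complex) \<Rightarrow> real" where "nrm2 u = Re (E u (\<lambda>x. cnj (u x)))"
definition nrm :: "('a \<Rightarrow> complex) \<Rightarrow> real" where "nrm u = sqrt (nrm2 u)"

lemma diff: "u \<in> H \<Longrightarrow> v \<in> H \<Longrightarrow> (\<lambda>x. u x - v x) \<in> H"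
  using add[OF _ scale[of v "-1"], of u] by simp

lemma E_diff: "u \<in> H \<Longrightarrow> v \<in> H \<Longrightarrow> w \<in> H \<Longrightarrow> E (\<lambda>x. u x - v x) w = E u w - E v w"
  using E_add[OF _ scale[of v "-1"], of u w] E_scale[of v w "-1"] by simp

lemma E_add_right: "u \<in> H \<Longrightarrow> v \<in> H \<Longrightarrow> w \<in> H \<Longrightarrow> E w (\<lambda>x. u x + v x) = E w u + E w v"
  using E_add[of u v w] E_sym[of w] add by simp

lemma E_scale_right: "u \<in> H \<Longrightarrow> w \<in> H \<Longrightarrow> E w (\<lambda>x. c * u x) = c * E w u"
  using E_scale[of u w c] E_sym[of w] scale by simp

lemma E_self: "u \<in> H \<Longrightarrow> E u (\<lambda>x. cnj (u x)) = of_real (nrm2 u)"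
proof -
  assume u: "u \<in> H"
  have "cnj (E u (\<lambda>x. cnj (u x))) = E u (\<lambda>x. cnj (u x))"
    unfolding E_cnj[OF u cnj_closed[OF u], symmetric] complex_cnj_cnj
    by (rule E_sym[OF cnj_closed[OF u] u])
  then show ?thesis unfolding nrm2_def by (simp add: complex_eq_iff)
qed

lemma nrm2_nonneg: "u \<in> H \<Longrightarrow> 0 \<le> nrm2 u"
  using E_nonneg by (simp add: nrm2_def)

lemma nrm_nonneg: "u \<in> H \<Longrightarrow> 0 \<le> nrm u"
  by (simp add: nrm_def nrm2_nonneg)

lemma nrm_power2: "u \<in> H \<Longrightarrow> (nrm u)\<^sup>2 = nrm2 u"
  by (simp add: nrm_def nrm2_nonneg)

lemma nrm2_cnj: "u \<in> H \<Longrightarrow> nrm2 (\<lambda>x. cnj (u x)) = nrm2 u"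
  unfolding nrm2_def using E_sym[of u "\<lambda>x. cnj (u x)"] cnj_closed by simp

lemma nrm_cnj: "u \<in> H \<Longrightarrow> nrm (\<lambda>x. cnj (u x)) = nrm u"
  by (simp add: nrm_def nrm2_cnj)

lemma nrm2_add_scale:
  assumes u: "u \<in> H" and v: "v \<in> H"
  shows "nrm2 (\<lambda>x. u x + c * v x) =
    nrm2 u + 2 * Re (cnj c * E u (\<lambda>x. cnj (v x))) + (cmod c)\<^sup>2 * nrm2 v"
proof -
  note cl = u v cnj_closed[OF u] cnj_closed[OF v] scale[OF v, of c] scale[OF cnj_closed[OF v], of "cnj c"]
  have vu: "E v (\<lambda>x. cnj (u x)) = cnj (E u (\<lambda>x. cnj (v x)))"
    using E_cnj[OF u cnj_closed[OF v]] E_sym[OF cl(2) cl(3)] by simp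
  have "E (\<lambda>x. u x + c * v x) (\<lambda>x. cnj (u x + c * v x)) =
      E u (\<lambda>x. cnj (u x)) + cnj c * E u (\<lambda>x. cnj (v x)) + c * E v (\<lambda>x. cnj (u x))
      + c * cnj c * E v (\<lambda>x. cnj (v x))"
    using cl by (simp add: E_add E_add_right E_scale E_scale_right add algebra_simps)
  also have "Re \<dots> = nrm2 u + 2 * Re (cnj c * E u (\<lambda>x. cnj (v x))) + (cmod c)\<^sup>2 * nrm2 v"
    unfolding vu E_self[OF u] E_self[OF v] complex_norm_square[symmetric]
    by (simp flip: of_real_power of_real_mult)
  finally show ?thesis by (simp add: nrm2_def)
qed

lemma Cauchy_Schwarz:
  assumes u: "u \<in> H" and v: "v \<in> H"
  shows "cmod (E u v) \<le> nrm u * nrm v"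
proof -
  define e where "e = E u v"
  \<comment> \<open>The expression is the squared norm of \<open>u - t e cnj v\<close>. If
    \<open>v\<close> has norm 0, it is affine in \<open>t\<close> and would become negative at
    \<open>t = (nrm2 u + 1) / |e|\<^sup>2\<close>; otherwise \<open>t = 1 / nrm2 v\<close> gives the
    inequality.\<close>
  have pos: "0 \<le> nrm2 u - 2 * t * (cmod e)\<^sup>2 + t\<^sup>2 * (cmod e)\<^sup>2 * nrm2 v" for t :: real
  proof -
    define c where "c = - of_real t * e"
    have "0 \<le> nrm2 (\<lambda>x. u x + c * cnj (v x))"
      using u v by (intro nrm2_nonneg add scale cnj_closed)
    also have "\<dots> = nrm2 u + 2 * Re (cnj c * e) + (cmod c)\<^sup>2 * nrm2 v"
      using nrm2_add_scale[OF u cnj_closed[OF v], of c] nrm2_cnj[OF v] by (simp add: e_def)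
    also have "Re (cnj c * e) = - t * (cmod e)\<^sup>2"
      unfolding c_def cmod_power2 by (simp add: power2_eq_square algebra_simps)
    finally show ?thesis by (simp add: c_def norm_mult power_mult_distrib algebra_simps)
  qed
  have "(cmod e)\<^sup>2 \<le> nrm2 u * nrm2 v"
  proof (cases "nrm2 v = 0")
    case True
    have "cmod e = 0"
    proof (rule ccontr)
      assume "cmod e \<noteq> 0"
      then have "(nrm2 u + 1) / (cmod e)\<^sup>2 * (cmod e)\<^sup>2 = nrm2 u + 1" by simp
      with pos[of "(nrm2 u + 1) / (cmod e)\<^sup>2"] nrm2_nonneg[OF u] \<open>cmod e \<noteq> 0\<close> show False
        unfolding True by (auto simp: mult.assoc)
    qed
    then show ?thesis using True by simp
  next
    case False
    then have "nrm2 v > 0" using nrm2_nonneg[OF v] by simp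
    then show ?thesis using pos[of "1 / nrm2 v"] by (simp add: field_simps power2_eq_square)
  qed
  then show ?thesis unfolding nrm_def e_def real_sqrt_mult[symmetric] by (simp add: real_le_rsqrt)
qed

lemma nrm_triangle:
  assumes u: "u \<in> H" and v: "v \<in> H"
  shows "nrm (\<lambda>x. u x + v x) \<le> nrm u + nrm v"
proof -
  have "nrm2 (\<lambda>x. u x + v x) = nrm2 u + 2 * Re (E u (\<lambda>x. cnj (v x))) + nrm2 v"
    using nrm2_add_scale[OF u v, of 1] by simp
  also have "\<dots> \<le> nrm2 u + 2 * (nrm u * nrm v) + nrm2 v"
    using Cauchy_Schwarz[OF u cnj_closed[OF v]] complex_Re_le_cmod[of "E u (\<lambda>x. cnj (v x))"]
    unfolding nrm_cnj[OF v] by simp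
  also have "\<dots> = (nrm u + nrm v)\<^sup>2"
    by (simp add: nrm_power2[OF u, symmetric] nrm_power2[OF v, symmetric] power2_eq_square algebra_simps)
  finally show ?thesis unfolding nrm_def[of "\<lambda>x. u x + v x"]
    using nrm_nonneg[OF u] nrm_nonneg[OF v] by (simp add: real_le_lsqrt)
qed

lemma nrm_scale: "u \<in> H \<Longrightarrow> nrm (\<lambda>x. c * u x) = cmod c * nrm u"
proof -
  assume u: "u \<in> H"
  have "nrm2 (\<lambda>x. c * u x) = (cmod c)\<^sup>2 * nrm2 u"
    using nrm2_add_scale[OF zero u, of c] E_scale[OF zero cnj_closed[OF u], of 0]
      E_scale[OF zero zero, of 0] by (simp add: nrm2_def)
  then show ?thesis by (simp add: nrm_def real_sqrt_mult)
qed

lemma nrm_diff_commute: "u \<in> H \<Longrightarrow> v \<in> H \<Longrightarrow> nrm (\<lambda>x. u x - v x) = nrm (\<lambda>x. v x - u x)"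
  using nrm_scale[OF diff[of v u], of "-1"] by simp

lemma nrm_triangle_diff:
  assumes "u \<in> H" "v \<in> H" "w \<in> H"
  shows "nrm (\<lambda>x. u x - w x) \<le> nrm (\<lambda>x. u x - v x) + nrm (\<lambda>x. v x - w x)"
  using nrm_triangle[OF diff[OF assms(1,2)] diff[OF assms(2,3)]] by simp

lemma nrm_triangle_sum:
  assumes "finite I" "\<And>i. i \<in> I \<Longrightarrow> u i \<in> H"
  shows "(\<lambda>x. \<Sum>i\<in>I. u i x) \<in> H \<and> nrm (\<lambda>x. \<Sum>i\<in>I. u i x) \<le> (\<Sum>i\<in>I. nrm (u i))"
  using assms
proof (induction I rule: finite_induct)
  case empty
  have "nrm (\<lambda>x. 0) = 0" using nrm_scale[OF zero, of 0] by simp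
  then show ?case using zero by simp
next
  case (insert i I)
  then have "u i \<in> H" "(\<lambda>x. \<Sum>i\<in>I. u i x) \<in> H" by auto
  from add[OF this] nrm_triangle[OF this] insert show ?case by auto
qed

lemma nrm_Cauchy_complete:
  assumes U: "\<And>n. U n \<in> H"
    and C: "\<And>e. e > 0 \<Longrightarrow> \<exists>N::nat. \<forall>m\<ge>N. \<forall>n\<ge>N. nrm (\<lambda>x. U m x - U n x) < e"
  obtains u where "u \<in> H" "(\<lambda>n. nrm (\<lambda>x. U n x - u x)) \<longlonglongrightarrow> 0"
proof -
  have "\<exists>N::nat. \<forall>m\<ge>N. \<forall>n\<ge>N. nrm2 (\<lambda>x. U m x - U n x) < e" if "e > 0" for e
  proof -
    from C[of "sqrt e"] that obtain N where N: "\<And>m n. m \<ge> N \<Longrightarrow> n \<ge> N \<Longrightarrow> nrm (\<lambda>x. U m x - U n x) < sqrt e"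
      by auto
    show ?thesis
    proof (intro exI allI impI)
      fix m n assume "m \<ge> N" "n \<ge> N"
      from N[OF this] show "nrm2 (\<lambda>x. U m x - U n x) < e" by (simp add: nrm_def)
    qed
  qed
  from complete[of U, OF U, unfolded nrm2_def[symmetric], OF this] obtain u where
    "u \<in> H" "(\<lambda>n. nrm2 (\<lambda>x. U n x - u x)) \<longlonglongrightarrow> 0" by blast
  moreover from tendsto_real_sqrt[OF this(2)] have "(\<lambda>n. nrm (\<lambda>x. U n x - u x)) \<longlonglongrightarrow> 0"
    by (simp add: nrm_def)
  ultimately show thesis using that by blast
qed

text \<open>The bound is a parameter rather than hidden behind an existential quantifier, since
  solutions have to be bounded by it uniformly over families of functionals such as all point
  evaluations.\<close>

definition functional :: "(('a \<Rightarrow> complex) \<Rightarrow> complex) \<Rightarrow> real \<Rightarrow> bool" where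
  "functional l C \<longleftrightarrow> (\<forall>u\<in>H. \<forall>v\<in>H. l (\<lambda>x. u x + v x) = l u + l v) \<and>
     (\<forall>c. \<forall>u\<in>H. l (\<lambda>x. c * u x) = c * l u) \<and> (\<forall>u\<in>H. cmod (l u) \<le> C * nrm u)"

lemma functional_tendsto:
  assumes l: "functional l C" and U: "\<And>n. U n \<in> H" "u \<in> H"
    and lim: "(\<lambda>n. nrm (\<lambda>x. U n x - u x)) \<longlonglongrightarrow> 0"
  shows "(\<lambda>n. l (U n)) \<longlonglongrightarrow> l u"
proof (rule LIM_zero_cancel, rule Lim_null_comparison)
  have "l (U n) - l u = l (\<lambda>x. U n x - u x)" for n
  proof -
    have "l (\<lambda>x. U n x - u x) = l (\<lambda>x. U n x + (-1) * u x)" by simp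
    also have "\<dots> = l (U n) + (-1) * l u"
      using l U scale[OF U(2), of "-1"] unfolding functional_def by metis
    finally show ?thesis by simp
  qed
  then have "cmod (l (U n) - l u) \<le> C * nrm (\<lambda>x. U n x - u x)" for n
    using l diff[OF U(1)[of n] U(2)] unfolding functional_def by metis
  then show "\<forall>\<^sub>F n in sequentially. norm (l (U n) - l u) \<le> C * nrm (\<lambda>x. U n x - u x)"
    by (intro always_eventually) auto
  show "(\<lambda>n. C * nrm (\<lambda>x. U n x - u x)) \<longlonglongrightarrow> 0" using tendsto_mult_right_zero[OF lim] by simp
qed

lemma functional_E: "u \<in> H \<Longrightarrow> functional (E u) (nrm u)"
  unfolding functional_def using Cauchy_Schwarz E_add_right E_scale_right by simp

lemma nrm_tendsto:
  assumes U: "\<And>n. U n \<in> H" "u \<in> H"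
    and lim: "(\<lambda>n. nrm (\<lambda>x. U n x - u x)) \<longlonglongrightarrow> 0"
  shows "(\<lambda>n. nrm (U n)) \<longlonglongrightarrow> nrm u"
proof (rule LIM_zero_cancel, rule Lim_null_comparison[OF _ lim])
  have "\<bar>nrm (U n) - nrm u\<bar> \<le> nrm (\<lambda>x. U n x - u x)" for n
    using nrm_triangle[OF diff[OF U(1)[of n] U(2)] U(2)]
      nrm_triangle[OF diff[OF U(2) U(1)[of n]] U(1)[of n]] nrm_diff_commute[OF U(1)[of n] U(2)]
    by simp
  then show "\<forall>\<^sub>F n in sequentially. norm (nrm (U n) - nrm u) \<le> nrm (\<lambda>x. U n x - u x)"
    by (intro always_eventually) auto
qed

text \<open>Minimizes \<open>\<parallel>v\<parallel>\<^sup>2 - 2 Re l(cnj v)\<close>: by the parallelogram law every minimizing sequence is Cauchy.\<close>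

theorem Riesz:
  assumes l: "functional l C"
  obtains u where "u \<in> H" "\<And>v. v \<in> H \<Longrightarrow> E u v = l v"
proof -
  have ladd: "l (\<lambda>x. u x + v x) = l u + l v" if "u \<in> H" "v \<in> H" for u v
    using l that unfolding functional_def by blast
  have lscale: "l (\<lambda>x. c * u x) = c * l u" if "u \<in> H" for u c
    using l that unfolding functional_def by blast
  have lb: "cmod (l u) \<le> C * nrm u" if "u \<in> H" for u
    using l that unfolding functional_def by blast
  define J where "J v = nrm2 v - 2 * Re (l (\<lambda>x. cnj (v x)))" for v
  have lower: "- C\<^sup>2 \<le> J v" if v: "v \<in> H" for v
  proof -
    have "Re (l (\<lambda>x. cnj (v x))) \<le> C * nrm v"
      using lb[OF cnj_closed[OF v]] complex_Re_le_cmod[of "l (\<lambda>x. cnj (v x))"] nrm_cnj[OF v] by simp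
    moreover have "0 \<le> (nrm v - C)\<^sup>2" by simp
    ultimately show ?thesis unfolding J_def nrm_power2[OF v, symmetric]
      by (simp add: power2_eq_square algebra_simps)
  qed
  have J_add: "J (\<lambda>x. u x + c * w x) =
      J u + 2 * Re (cnj c * (E u (\<lambda>x. cnj (w x)) - l (\<lambda>x. cnj (w x)))) + (cmod c)\<^sup>2 * nrm2 w"
    if u: "u \<in> H" and w: "w \<in> H" for u w c
  proof -
    have "l (\<lambda>x. cnj (u x + c * w x)) = l (\<lambda>x. cnj (u x)) + cnj c * l (\<lambda>x. cnj (w x))"
      using ladd[OF cnj_closed[OF u] scale[OF cnj_closed[OF w], of "cnj c"]]
        lscale[OF cnj_closed[OF w], of "cnj c"] by simp
    then show ?thesis unfolding J_def nrm2_add_scale[OF u w] by (simp add: algebra_simps)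
  qed
  define m where "m = (INF v\<in>H. J v)"
  have bdd: "bdd_below (J ` H)" using lower by (intro bdd_belowI2)
  have m_le: "m \<le> J v" if "v \<in> H" for v unfolding m_def using bdd that by (rule cINF_lower)
  have "\<exists>v\<in>H. J v < m + 1 / real (Suc n)" for n
  proof -
    have ne: "H \<noteq> {}" using zero by blast
    have "m < m + 1 / real (Suc n)" by simp
    from this[unfolded m_def cINF_less_iff[OF ne bdd], folded m_def] show ?thesis .
  qed
  then obtain U where U: "\<And>n. U n \<in> H" and JU: "\<And>n. J (U n) < m + 1 / real (Suc n)" by metis
  \<comment> \<open>At the midpoint \<open>J\<close> equals \<open>J u + t + nrm2 w / 4\<close>, at
    \<open>v\<close> it equals \<open>J u + 2 * t + nrm2 w\<close>; eliminating \<open>t\<close>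
    leaves the distance alone.\<close>
  have par: "nrm2 (\<lambda>x. u x - v x) \<le> 2 * (J u - m) + 2 * (J v - m)" if u: "u \<in> H" and v: "v \<in> H" for u v
  proof -
    define w where "w = (\<lambda>x. v x - u x)"
    have w: "w \<in> H" unfolding w_def using v u by (rule diff)
    define t where "t = Re (E u (\<lambda>x. cnj (w x)) - l (\<lambda>x. cnj (w x)))"
    have Jv: "J v = J u + 2 * t + nrm2 w"
      using J_add[OF u w, of 1] by (simp add: t_def w_def)
    have "m \<le> J (\<lambda>x. u x + (1/2) * w x)" by (intro m_le add scale u w)
    also have "\<dots> = J u + t + nrm2 w / 4"
      using J_add[OF u w, of "1/2"] by (simp add: t_def power2_eq_square)
    finally have "nrm2 w \<le> 2 * (J u - m) + 2 * (J v - m)" using Jv by simp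
    moreover have "nrm w = nrm (\<lambda>x. u x - v x)" unfolding w_def using u v by (intro nrm_diff_commute)
    ultimately show ?thesis
      using nrm_power2[OF w] nrm_power2[OF diff[OF u v]] by simp
  qed
  have "\<exists>N::nat. \<forall>i\<ge>N. \<forall>j\<ge>N. nrm (\<lambda>x. U i x - U j x) < e" if "e > 0" for e
  proof -
    have "0 < e\<^sup>2 / 4" using that by simp
    then obtain N where N: "1 / real (Suc N) < e\<^sup>2 / 4" by (rule nat_approx_posE)
    show ?thesis
    proof (intro exI allI impI)
      fix i j assume "N \<le> i" "N \<le> j"
      then have "1 / real (Suc i) \<le> 1 / real (Suc N)" "1 / real (Suc j) \<le> 1 / real (Suc N)"
        by (auto simp: field_simps)
      then have "nrm2 (\<lambda>x. U i x - U j x) < e\<^sup>2"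
      proof -
        have "x < q" if "a \<le> c" "b \<le> c" "x \<le> 2 * (ji - m) + 2 * (jj - m)" "ji < m + a" "jj < m + b" "c < q / 4"
          for a b c ji jj q x :: real
          using that by argo
        from this[OF \<open>1 / real (Suc i) \<le> 1 / real (Suc N)\<close> \<open>1 / real (Suc j) \<le> 1 / real (Suc N)\<close>
          par[OF U[of i] U[of j]] JU[of i] JU[of j] N] show ?thesis .
      qed
      then show "nrm (\<lambda>x. U i x - U j x) < e"
        unfolding nrm_def using that by (simp add: real_less_lsqrt)
    qed
  qed
  then obtain u where u: "u \<in> H" and lim: "(\<lambda>n. nrm (\<lambda>x. U n x - u x)) \<longlonglongrightarrow> 0"
    using nrm_Cauchy_complete[of U] U by blast
  have limc: "(\<lambda>n. nrm (\<lambda>x. cnj (U n x) - cnj (u x))) \<longlonglongrightarrow> 0"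
    using lim nrm_cnj[OF diff[OF U u]] by simp
  have "(\<lambda>n. J (U n)) \<longlonglongrightarrow> J u"
    unfolding J_def
    using nrm_tendsto[of U, OF U u lim]
      functional_tendsto[OF l, of "\<lambda>n x. cnj (U n x)" "\<lambda>x. cnj (u x)", OF cnj_closed[OF U] cnj_closed[OF u] limc]
    unfolding nrm_power2[OF U, symmetric] nrm_power2[OF u, symmetric]
    by (intro tendsto_intros)
  moreover have "(\<lambda>n. m + 1 / real (Suc n)) \<longlonglongrightarrow> m + 0"
    by (intro tendsto_intros LIMSEQ_Suc lim_1_over_n)
  ultimately have Ju: "J u \<le> m"
    using JU by (intro LIMSEQ_le[of "\<lambda>n. J (U n)"]) (auto intro: less_imp_le)
  \<comment> \<open>First variation at the minimizer: \<open>2 s t + s\<^sup>2 n\<close> is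
    nonnegative for every real \<open>s\<close>, but at \<open>s = - t / (n + 1)\<close> it equals
    \<open>- s\<^sup>2 (n + 2)\<close>, so \<open>t = 0\<close>.\<close>
  have re: "Re (cnj c * (E u (\<lambda>x. cnj (w x)) - l (\<lambda>x. cnj (w x)))) = 0" if w: "w \<in> H" for w c
  proof (rule ccontr)
    define t where "t = Re (cnj c * (E u (\<lambda>x. cnj (w x)) - l (\<lambda>x. cnj (w x))))"
    define n where "n = (cmod c)\<^sup>2 * nrm2 w"
    assume "Re (cnj c * (E u (\<lambda>x. cnj (w x)) - l (\<lambda>x. cnj (w x)))) \<noteq> 0"
    then have t: "t \<noteq> 0" by (simp add: t_def)
    have n: "n \<ge> 0" using nrm2_nonneg[OF w] by (simp add: n_def)
    have q: "0 \<le> 2 * s * t + s\<^sup>2 * n" for s :: real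
    proof -
      have "J u \<le> J (\<lambda>x. u x + (of_real s * c) * w x)"
        using Ju m_le[OF add[OF u scale[OF w, of "of_real s * c"]]] by simp
      then show ?thesis unfolding J_add[OF u w]
        by (simp add: t_def n_def norm_mult power_mult_distrib algebra_simps)
    qed
    define s where "s = - t / (n + 1)"
    have t_eq: "t = - s * (n + 1)" using n by (simp add: s_def)
    have "0 \<le> 2 * s * t + s\<^sup>2 * n" by (rule q)
    also have "\<dots> = - (s\<^sup>2 * (n + 2))" unfolding t_eq by (simp add: power2_eq_square algebra_simps)
    also have "\<dots> < 0" using n t t_eq by (auto intro!: mult_pos_pos)
    finally show False by simp
  qed
  \<comment> \<open>\<open>c = 1\<close> yields the real part of the equation,
    \<open>c = -\<i>\<close> the imaginary part.\<close>
  have "E u v = l v" if v: "v \<in> H" for v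
    using re[OF cnj_closed[OF v], of 1] re[OF cnj_closed[OF v], of "-\<i>"]
    by (simp add: complex_eq_iff)
  then show thesis using that u by blast
qed

text \<open>Let \<open>T u\<close> be a Riesz representative of \<open>l - b u\<close>. The factor
  1/2 in the bound of \<open>b\<close> makes \<open>T\<close> halve distances, so its iterates from
  0 converge to a solution. Testing the equation with \<open>cnj u\<close> gives
  \<open>nrm2 u \<le> C * nrm u + nrm2 u / 2\<close>, whence the bound \<open>2 * C\<close>.\<close>

theorem perturbed_Riesz:
  assumes C: "0 \<le> C" and l: "functional l C"
    and b: "\<And>u. u \<in> H \<Longrightarrow> functional (b u) (nrm u / 2)"
      "\<And>u v w. u \<in> H \<Longrightarrow> v \<in> H \<Longrightarrow> w \<in> H \<Longrightarrow> b (\<lambda>x. u x - v x) w = b u w - b v w"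
  obtains u where "u \<in> H" "nrm u \<le> 2 * C" "\<And>v. v \<in> H \<Longrightarrow> E u v + b u v = l v"
proof -
  have bb: "cmod (b u v) \<le> nrm u / 2 * nrm v" if "u \<in> H" "v \<in> H" for u v
    using b(1)[OF that(1)] that unfolding functional_def by blast
  have lb: "cmod (l v) \<le> C * nrm v" if "v \<in> H" for v
    using l that unfolding functional_def by blast
  have "\<exists>w. w \<in> H \<and> (\<forall>v\<in>H. E w v = l v - b u v)" if u: "u \<in> H" for u
  proof -
    have "functional (\<lambda>v. l v - b u v) (C + nrm u / 2)"
      using l b(1)[OF u] unfolding functional_def
      by (auto simp: algebra_simps intro!: order_trans[OF norm_triangle_ineq4] add_mono)
    then show ?thesis by (rule Riesz) blast
  qed
  \<comment> \<open>Representatives are determined only up to norm 0, so \<open>T\<close> is an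
    arbitrary choice; iterates are compared through the equations that they satisfy.\<close>
  then obtain T where T: "\<And>u. u \<in> H \<Longrightarrow> T u \<in> H"
    "\<And>u v. u \<in> H \<Longrightarrow> v \<in> H \<Longrightarrow> E (T u) v = l v - b u v" by metis
  define U where "U n = (T ^^ n) (\<lambda>x. 0)" for n
  have U: "U n \<in> H" for n by (induction n) (auto simp: U_def zero T)
  have US: "U (Suc n) = T (U n)" for n by (simp add: U_def)
  define d where "d n = (\<lambda>x. U (Suc n) x - U n x)" for n
  have d: "d n \<in> H" for n unfolding d_def by (intro diff U)
  have half: "nrm (d (Suc n)) \<le> nrm (d n) / 2" for n
  proof -
    have "E (d (Suc n)) v = - b (d n) v" if v: "v \<in> H" for v
      unfolding d_def E_diff[OF U U v] b(2)[OF U U v]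
      using T(2)[OF U v, of n] T(2)[OF U v, of "Suc n"] by (simp add: US)
    then have "nrm2 (d (Suc n)) = cmod (b (d n) (\<lambda>x. cnj (d (Suc n) x)))"
      using E_self[OF d[of "Suc n"]] nrm2_nonneg[OF d[of "Suc n"]] cnj_closed[OF d[of "Suc n"]]
      by (metis abs_of_nonneg norm_minus_cancel norm_of_real)
    also have "\<dots> \<le> nrm (d n) / 2 * nrm (d (Suc n))"
      using bb[OF d cnj_closed[OF d]] nrm_cnj[OF d] by metis
    finally have "nrm (d (Suc n)) * nrm (d (Suc n)) \<le> nrm (d n) / 2 * nrm (d (Suc n))"
      using nrm_power2[OF d[of "Suc n"]] by (simp add: power2_eq_square)
    then show ?thesis using nrm_nonneg[OF d, of n] nrm_nonneg[OF d, of "Suc n"]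
      by (cases "nrm (d (Suc n)) = 0") (auto simp: mult_le_cancel_right)
  qed
  have dn: "nrm (d n) \<le> nrm (d 0) * (1/2) ^ n" for n
  proof (induction n)
    case (Suc n)
    then show ?case using half[of n] by simp
  qed simp
  have tail: "nrm (\<lambda>x. U (n + k) x - U n x) \<le> 2 * nrm (d 0) * (1/2) ^ n * (1 - (1/2)^k)" for n k
  proof (induction k)
    case 0
    have "nrm (\<lambda>x. 0) = 0" using nrm_scale[OF zero, of 0] by simp
    then show ?case by simp
  next
    case (Suc k)
    have "nrm (\<lambda>x. U (n + Suc k) x - U n x) \<le> nrm (d (n + k)) + nrm (\<lambda>x. U (n + k) x - U n x)"
      using nrm_triangle_diff[OF U U U, of "n + Suc k" n "n + k"] by (simp add: d_def)
    also have "\<dots> \<le> nrm (d 0) * (1/2)^(n+k) + 2 * nrm (d 0) * (1/2) ^ n * (1 - (1/2)^k)"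
      using Suc dn by (intro add_mono)
    also have "\<dots> = 2 * nrm (d 0) * (1/2) ^ n * (1 - (1/2)^Suc k)"
      by (simp add: power_add algebra_simps)
    finally show ?case .
  qed
  have "\<exists>N::nat. \<forall>i\<ge>N. \<forall>j\<ge>N. nrm (\<lambda>x. U i x - U j x) < e" if e: "e > 0" for e
  proof -
    have "(\<lambda>n. 4 * nrm (d 0) * (1/2::real) ^ n) \<longlonglongrightarrow> 4 * nrm (d 0) * 0"
      by (intro tendsto_intros LIMSEQ_power_zero) auto
    then have "\<forall>\<^sub>F n in sequentially. 4 * nrm (d 0) * (1/2::real) ^ n < e"
      using e by (auto dest: order_tendstoD(2))
    then obtain N where N: "4 * nrm (d 0) * (1/2::real) ^ N < e" by (auto simp: eventually_sequentially)
    have near: "nrm (\<lambda>x. U i x - U N x) \<le> 2 * nrm (d 0) * (1/2) ^ N" if "N \<le> i" for i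
    proof -
      have "2 * nrm (d 0) * (1/2) ^ N * (1 - (1/2)^(i-N)) \<le> 2 * nrm (d 0) * (1/2) ^ N * 1"
        using nrm_nonneg[OF d] by (intro mult_left_mono) auto
      then show ?thesis using tail[of N "i - N"] that by simp
    qed
    show ?thesis
    proof (intro exI allI impI)
      fix i j assume "N \<le> i" "N \<le> j"
      then show "nrm (\<lambda>x. U i x - U j x) < e"
        using nrm_triangle_diff[OF U U U, of i j N] near[of i] near[of j] N
          nrm_diff_commute[OF U U, of N j] by linarith
    qed
  qed
  then obtain u where u: "u \<in> H" and lim: "(\<lambda>n. nrm (\<lambda>x. U n x - u x)) \<longlonglongrightarrow> 0"
    using nrm_Cauchy_complete[of U] U by blast
  have eq: "E u v + b u v = l v" if v: "v \<in> H" for v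
  proof -
    have 1: "(\<lambda>n. E (U n) v) \<longlonglongrightarrow> E u v"
      using functional_tendsto[OF functional_E[OF v], of U u, OF U u lim] E_sym[OF v U] E_sym[OF v u] by simp
    have 2: "(\<lambda>n. b (U n) v) \<longlonglongrightarrow> b u v"
    proof (rule LIM_zero_cancel, rule Lim_null_comparison)
      show "\<forall>\<^sub>F n in sequentially. norm (b (U n) v - b u v) \<le> nrm (\<lambda>x. U n x - u x) * (nrm v / 2)"
        using bb[OF diff[OF U u] v] b(2)[OF U u v] by (intro always_eventually) simp
      show "(\<lambda>n. nrm (\<lambda>x. U n x - u x) * (nrm v / 2)) \<longlonglongrightarrow> 0"
        using tendsto_mult_left_zero[OF lim] by simp
    qed
    have "(\<lambda>n. E (U (Suc n)) v) \<longlonglongrightarrow> l v - b u v"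
      unfolding US T(2)[OF U v] by (intro tendsto_intros 2)
    moreover have "(\<lambda>n. E (U (Suc n)) v) \<longlonglongrightarrow> E u v" using 1 by (rule LIMSEQ_Suc)
    ultimately show ?thesis using LIMSEQ_unique by fastforce
  qed
  have "nrm u * nrm u \<le> (C + nrm u / 2) * nrm u"
  proof -
    have c: "(\<lambda>x. cnj (u x)) \<in> H" using u by (rule cnj_closed)
    have "of_real (nrm2 u) = l (\<lambda>x. cnj (u x)) - b u (\<lambda>x. cnj (u x))"
      using eq[OF c] E_self[OF u] by (simp add: algebra_simps)
    then have "\<bar>nrm2 u\<bar> = cmod (l (\<lambda>x. cnj (u x)) - b u (\<lambda>x. cnj (u x)))"
      by (metis norm_of_real)
    also have "\<dots> \<le> C * nrm u + nrm u / 2 * nrm u"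
      using norm_triangle_ineq4 lb[OF c] bb[OF u c] nrm_cnj[OF u] by (smt (verit))
    finally show ?thesis using nrm_power2[OF u] nrm2_nonneg[OF u]
      by (simp add: power2_eq_square algebra_simps)
  qed
  then have "nrm u \<le> 2 * C"
    using C nrm_nonneg[OF u] by (cases "nrm u = 0") (auto simp: mult_le_cancel_right)
  then show thesis using that u eq by blast
qed

end


section \<open>Complex measures\<close>

text \<open>This makes \<open>complex_measure_integral\<close> independent of the representation,
  since the difference of two representations is such a combination. The coefficients are complex,
  so monotone convergence does not apply to the combination; each measure is taken to the limit
  separately by dominated convergence, and for this a bound accompanies the induction.\<close>

lemma measure_combination_integral_zero:
  fixes a :: "'i \<Rightarrow> complex" and v :: "'a \<Rightarrow> complex"
  assumes fin: "finite I"
    and N: "\<And>k. k \<in> I \<Longrightarrow> finite_measure (N k)" "\<And>k. k \<in> I \<Longrightarrow> sets (N k) = sets M"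
    and zero: "\<And>A. A \<in> sets M \<Longrightarrow> (\<Sum>k\<in>I. a k * of_real (measure (N k) A)) = 0"
    and v: "v \<in> borel_measurable M" "\<And>x. x \<in> space M \<Longrightarrow> cmod (v x) \<le> c"
  shows "(\<Sum>k\<in>I. a k * (\<integral>x. v x \<partial>N k)) = 0"
proof -
  have space: "space (N k) = space M" if "k \<in> I" for k
    using N(2)[OF that] by (rule sets_eq_imp_space_eq)
  have meas: "borel_measurable (N k) = borel_measurable M" if "k \<in> I" for k
    using N(2)[OF that] by (rule measurable_cong_sets) simp
  have bounded_integrable: "integrable (N k) f"
    if k: "k \<in> I" and f: "f \<in> borel_measurable M" "\<And>x. x \<in> space M \<Longrightarrow> norm (f x) \<le> b"
    for k b and f :: "'a \<Rightarrow> 'b::{banach, second_countable_topology}"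
    using N(1)[OF k] f unfolding meas[OF k, symmetric] space[OF k, symmetric]
    by (intro finite_measure.integrable_const_bound[of _ _ b]) auto
  \<comment> \<open>The bound is a premise inside the induction formula and \<open>b\<close> is
    arbitrary, because scaling changes it and summands inherit it from their sum.\<close>
  have nonneg: "(\<forall>x\<in>space M. u x \<le> b) \<Longrightarrow> (\<Sum>k\<in>I. a k * of_real (\<integral>x. u x \<partial>N k)) = 0"
    if u: "u \<in> borel_measurable M" "\<And>x. 0 \<le> u x" for u :: "'a \<Rightarrow> real" and b
    using u
  proof (induction arbitrary: b rule: borel_measurable_induct_real)
    case (set A)
    have "(\<Sum>k\<in>I. a k * of_real (\<integral>x. indicator A x \<partial>N k)) = (\<Sum>k\<in>I. a k * of_real (measure (N k) A))"
      using set N(2) by (intro sum.cong) (auto simp: sets.Int_space_eq2)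
    then show ?case using zero[OF set(1)] by simp
  next
    case (mult u d)
    show ?case
    proof (cases "d = 0")
      case False
      then have "\<forall>x\<in>space M. u x \<le> b / d" using mult by (auto simp: field_simps)
      from mult.IH[OF this] have "of_real d * (\<Sum>k\<in>I. a k * of_real (\<integral>x. u x \<partial>N k)) = 0" by simp
      then show ?thesis by (simp add: sum_distrib_left mult.left_commute)
    qed simp
  next
    case (add u w)
    have b: "\<forall>x\<in>space M. u x \<le> b" "\<forall>x\<in>space M. w x \<le> b"
    proof (safe)
      fix x assume "x \<in> space M"
      then show "u x \<le> b" "w x \<le> b"
        using add.hyps(2)[of x] add.hyps(4)[of x] bspec[OF add.prems, of x] by linarith+
    qed
    have "integrable (N k) u" "integrable (N k) w" if "k \<in> I" for k
      using b add.hyps by (auto intro!: bounded_integrable[OF that, of _ b])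
    then have "(\<Sum>k\<in>I. a k * of_real (\<integral>x. w x + u x \<partial>N k)) =
        (\<Sum>k\<in>I. a k * of_real (\<integral>x. w x \<partial>N k)) + (\<Sum>k\<in>I. a k * of_real (\<integral>x. u x \<partial>N k))"
      unfolding sum.distrib[symmetric] by (intro sum.cong) (auto simp: algebra_simps)
    then show ?case using add.IH(1)[OF b(1)] add.IH(2)[OF b(2)] by simp
  next
    case (seq U)
    have U: "U i x \<le> u x" if "x \<in> space M" for i x
      using seq(4)[OF that] seq(3) by (intro incseq_le) (auto simp: incseq_def le_fun_def)
    then have Ub: "\<forall>x\<in>space M. U i x \<le> b" for i using seq.prems by (auto intro: order_trans)
    have "(\<lambda>i. \<integral>x. U i x \<partial>N k) \<longlonglongrightarrow> (\<integral>x. u x \<partial>N k)" if k: "k \<in> I" for k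
    proof (rule integral_dominated_convergence[where w = "\<lambda>_. b"])
      show "u \<in> borel_measurable (N k)" "\<And>i. U i \<in> borel_measurable (N k)"
        using u seq(1) meas[OF k] by auto
      show "integrable (N k) (\<lambda>_. b)" using finite_measure.integrable_const[OF N(1)[OF k]] .
      show "AE x in N k. (\<lambda>i. U i x) \<longlonglongrightarrow> u x" using seq(4) space[OF k] by (auto intro!: AE_I2)
      show "\<And>i. AE x in N k. norm (U i x) \<le> b" using Ub seq(2) space[OF k] by (auto intro!: AE_I2)
    qed
    then have "(\<lambda>i. \<Sum>k\<in>I. a k * of_real (\<integral>x. U i x \<partial>N k)) \<longlonglongrightarrow> (\<Sum>k\<in>I. a k * of_real (\<integral>x. u x \<partial>N k))"
      by (intro tendsto_sum tendsto_mult tendsto_of_real) auto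
    then show ?case using seq.IH[OF Ub] LIMSEQ_unique[OF tendsto_const[of 0]] by (simp add: tendsto_const_iff)
  qed
  have real_zero: "(\<Sum>k\<in>I. a k * of_real (\<integral>x. f x \<partial>N k)) = 0"
    if f: "f \<in> borel_measurable M" "\<And>x. x \<in> space M \<Longrightarrow> \<bar>f x\<bar> \<le> c" for f :: "'a \<Rightarrow> real"
  proof -
    have int: "integrable (N k) f" if "k \<in> I" for k
      using f by (intro bounded_integrable[OF that, of f c]) auto
    \<comment> \<open>On \<open>space M\<close> the shifted function \<open>f + c\<close> has values
      in \<open>[0, 2 c]\<close>, so the maximum matters only off \<open>space M\<close>. The
      constant contributes \<open>c\<close> times the combination of the total masses, which
      vanishes.\<close>
    have "0 = (\<Sum>k\<in>I. a k * of_real (\<integral>x. max 0 (f x + c) \<partial>N k))"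
      using f(1) by (intro nonneg[symmetric, of _ "2 * c"]) (auto dest!: f(2))
    also have "\<dots> = (\<Sum>k\<in>I. a k * of_real ((\<integral>x. f x \<partial>N k) + c * measure (N k) (space M)))"
    proof (intro sum.cong refl)
      fix k assume k: "k \<in> I"
      have "(\<integral>x. max 0 (f x + c) \<partial>N k) = (\<integral>x. f x + c \<partial>N k)"
        using f(2) space[OF k] by (intro Bochner_Integration.integral_cong) (force simp: abs_le_iff)+
      also have "\<dots> = (\<integral>x. f x \<partial>N k) + c * measure (N k) (space M)"
        using int[OF k] finite_measure.integrable_const[OF N(1)[OF k], of c] space[OF k]
        by (simp add: Bochner_Integration.integral_add mult.commute)
      finally show "a k * of_real (\<integral>x. max 0 (f x + c) \<partial>N k) =
          a k * of_real ((\<integral>x. f x \<partial>N k) + c * measure (N k) (space M))" by simp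
    qed
    also have "\<dots> = (\<Sum>k\<in>I. a k * of_real (\<integral>x. f x \<partial>N k)) + of_real c * (\<Sum>k\<in>I. a k * of_real (measure (N k) (space M)))"
      by (simp add: sum.distrib sum_distrib_left algebra_simps)
    finally show ?thesis using zero[of "space M"] by simp
  qed
  have eq: "(\<integral>x. v x \<partial>N k) = of_real (\<integral>x. Re (v x) \<partial>N k) + \<i> * of_real (\<integral>x. Im (v x) \<partial>N k)" if k: "k \<in> I" for k
    using bounded_integrable[OF k v] by (simp add: complex_eq_iff)
  have "(\<Sum>k\<in>I. a k * of_real (\<integral>x. Re (v x) \<partial>N k)) = 0" "(\<Sum>k\<in>I. a k * of_real (\<integral>x. Im (v x) \<partial>N k)) = 0"
    using v abs_Re_le_cmod abs_Im_le_cmod by (auto intro!: real_zero intro: order_trans)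
  then have "(\<Sum>k\<in>I. a k * of_real (\<integral>x. Re (v x) \<partial>N k)) + \<i> * (\<Sum>k\<in>I. a k * of_real (\<integral>x. Im (v x) \<partial>N k)) = 0"
    by simp
  then show ?thesis unfolding sum_distrib_left sum.distrib[symmetric]
    by (subst sum.cong[OF refl]) (auto simp: eq algebra_simps)
qed

lemma
  fixes a :: "nat \<Rightarrow> complex" and v :: "'a \<Rightarrow> complex"
  assumes N: "\<And>k. k < n \<Longrightarrow> finite_measure (N k)" "\<And>k. k < n \<Longrightarrow> sets (N k) = sets M"
    and nu: "\<And>A. A \<in> sets M \<Longrightarrow> \<nu> A = (\<Sum>k<n. a k * of_real (measure (N k) A))"
  shows complex_measureI: "complex_measure M \<nu>"
    and complex_measure_integral_eq: "v \<in> borel_measurable M \<Longrightarrow> (\<And>x. x \<in> space M \<Longrightarrow> cmod (v x) \<le> c) \<Longrightarrow>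
      complex_measure_integral M \<nu> v = (\<Sum>k<n. a k * (\<integral>x. v x \<partial>N k))"
proof -
  show "complex_measure M \<nu>"
    unfolding complex_measure_def
  proof (intro allI impI)
    fix A :: "nat \<Rightarrow> 'a set" assume A: "range A \<subseteq> sets M" "disjoint_family A"
    have "(\<lambda>i. \<Sum>k<n. a k * of_real (measure (N k) (A i))) sums (\<Sum>k<n. a k * of_real (measure (N k) (\<Union>i. A i)))"
      using A N by (intro sums_sum sums_mult sums_of_real finite_measure.finite_measure_UNION) auto
    then show "(\<lambda>i. \<nu> (A i)) sums \<nu> (\<Union>i. A i)"
      using A by (subst (1 2) nu) auto
  qed
  assume v: "v \<in> borel_measurable M" "\<And>x. x \<in> space M \<Longrightarrow> cmod (v x) \<le> c"
  show "complex_measure_integral M \<nu> v = (\<Sum>k<n. a k * (\<integral>x. v x \<partial>N k))"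
    unfolding complex_measure_integral_def
  proof (rule the_equality)
    show "\<exists>(n'::nat) a' N'. (\<forall>k<n'. finite_measure (N' k) \<and> sets (N' k) = sets M) \<and>
        (\<forall>A\<in>sets M. \<nu> A = (\<Sum>k<n'. a' k * of_real (measure (N' k) A))) \<and>
        (\<Sum>k<n. a k * (\<integral>x. v x \<partial>N k)) = (\<Sum>k<n'. a' k * (\<integral>x. v x \<partial>N' k))"
      using N nu by blast
  next
    fix I
    assume "\<exists>(n'::nat) a' N'. (\<forall>k<n'. finite_measure (N' k) \<and> sets (N' k) = sets M) \<and>
        (\<forall>A\<in>sets M. \<nu> A = (\<Sum>k<n'. a' k * of_real (measure (N' k) A))) \<and>
        I = (\<Sum>k<n'. a' k * (\<integral>x. v x \<partial>N' k))"
    then obtain n' :: nat and a' N' where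
      N': "\<forall>k<n'. finite_measure (N' k) \<and> sets (N' k) = sets M"
        "\<forall>A\<in>sets M. \<nu> A = (\<Sum>k<n'. a' k * of_real (measure (N' k) A))"
        and I: "I = (\<Sum>k<n'. a' k * (\<integral>x. v x \<partial>N' k))" by blast
    \<comment> \<open>The two representations are subtracted on the disjoint sum of their index
      sets, the second with negated coefficients.\<close>
    define b where "b = case_sum a (\<lambda>k. - a' k)"
    define K where "K = case_sum N N'"
    have "(\<Sum>k\<in>{..<n} <+> {..<n'}. b k * (\<integral>x. v x \<partial>K k)) = 0"
    proof (rule measure_combination_integral_zero[OF _ _ _ _ v])
      show "\<And>A. A \<in> sets M \<Longrightarrow> (\<Sum>k\<in>{..<n} <+> {..<n'}. b k * of_real (measure (K k) A)) = 0"
        using N'(2) nu by (simp add: sum.Plus b_def K_def sum_negf)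
    qed (use N N'(1) in \<open>auto simp: K_def\<close>)
    then show "I = (\<Sum>k<n. a k * (\<integral>x. v x \<partial>N k))"
      by (simp add: I sum.Plus b_def K_def sum_negf)
  qed
qed

text \<open>The set function is a combination of four finite positive measures. With bounded
  nonnegative \<open>h 0\<close> and \<open>h 1\<close>,
  \<open>g = h 0 + \<i> h 1 - b (1 + \<i>)\<close> on the space, so the measures of density
  \<open>h 0\<close> and \<open>h 1\<close>, the measure \<open>M\<close> and the Dirac mass
  suffice. The latter is \<open>distr M M (\<lambda>_. x)\<close>, as \<open>M\<close> has total
  mass 1.\<close>

lemma
  fixes g v :: "'a \<Rightarrow> complex"
  assumes M: "prob_space M" and x: "x \<in> space M"
    and g: "g \<in> borel_measurable M" "\<And>y. y \<in> space M \<Longrightarrow> cmod (g y) \<le> b"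
  shows function_minus_dirac_complex_measure:
      "complex_measure M (\<lambda>A. c * (LINT y:A|M. g y) - dirac_measure x A)"
    and function_minus_dirac_integral:
      "v \<in> borel_measurable M \<Longrightarrow> (\<And>y. y \<in> space M \<Longrightarrow> cmod (v y) \<le> d) \<Longrightarrow>
       complex_measure_integral M (\<lambda>A. c * (LINT y:A|M. g y) - dirac_measure x A) v =
         c * (\<integral>y. g y * v y \<partial>M) - v x"
proof -
  interpret prob_space M by (rule M)
  have [measurable]: "(\<lambda>y. Re (g y)) \<in> borel_measurable M" "(\<lambda>y. Im (g y)) \<in> borel_measurable M"
    using g(1) by auto
  define h where "h = (\<lambda>k::nat. if k = 0 then (\<lambda>y. max 0 (Re (g y) + b)) else (\<lambda>y. max 0 (Im (g y) + b)))"
  have hm [measurable]: "h k \<in> borel_measurable M" for k by (cases "k = 0") (auto simp: h_def)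
  have h0: "0 \<le> h k y" for k y by (simp add: h_def)
  have hb: "h k y \<le> 2 * b" if y: "y \<in> space M" for k y
    using g(2)[OF y] abs_Re_le_cmod[of "g y"] abs_Im_le_cmod[of "g y"] norm_ge_zero[of "g y"]
    unfolding h_def by (auto simp: max_def)
  have gh: "g y = of_real (h 0 y) + \<i> * of_real (h 1 y) - of_real b * (1 + \<i>)" if y: "y \<in> space M" for y
    using g(2)[OF y] abs_Re_le_cmod[of "g y"] abs_Im_le_cmod[of "g y"]
    by (auto simp: h_def complex_eq_iff max_def)
  have int: "integrable M (\<lambda>y. h k y *\<^sub>R f y)"
    if "f \<in> borel_measurable M" "\<And>y. y \<in> space M \<Longrightarrow> norm (f y) \<le> B"
    for k and B and f :: "'a \<Rightarrow> 'c::{banach, second_countable_topology}"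
  proof (rule integrable_const_bound[of _ "2 * b * B"])
    show "AE y in M. norm (h k y *\<^sub>R f y) \<le> 2 * b * B"
    proof (rule AE_I2)
      fix y assume y: "y \<in> space M"
      show "norm (h k y *\<^sub>R f y) \<le> 2 * b * B"
        using that(2)[OF y] hb[OF y, of k] h0[of k y] by (auto intro!: mult_mono)
    qed
  qed (use that(1) in measurable)
  define N where "N = (\<lambda>k::nat. if k < 2 then density M (h k) else if k = 2 then M else distr M M (\<lambda>_. x))"
  define a where "a = (\<lambda>k::nat. if k = 0 then c else if k = 1 then c * \<i> else if k = 2 then - c * b * (1 + \<i>) else - 1)"
  have sum4: "(\<Sum>k<4. F k) = F 0 + F 1 + F 2 + F 3" for F :: "nat \<Rightarrow> complex"
    by (simp add: eval_nat_numeral)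
  have sets: "sets (N k) = sets M" for k by (simp add: N_def)
  have xM: "(\<lambda>_. x) \<in> measurable M M" using x by simp
  have fin: "finite_measure (N k)" for k
  proof -
    have "finite_measure (density M (h k))"
    proof (rule finite_measureI)
      have "emeasure (density M (h k)) (space M) = (\<integral>\<^sup>+ y. h k y \<partial>M)"
        by (simp add: emeasure_density cong: nn_integral_cong_simp)
      also have "\<dots> = ennreal (\<integral>y. h k y \<partial>M)"
        using int[of "\<lambda>_. 1::real" 1 k] by (intro nn_integral_eq_integral) (auto simp: h0)
      finally show "emeasure (density M (h k)) (space (density M (h k))) \<noteq> \<infinity>" by simp
    qed
    moreover have "finite_measure (distr M M (\<lambda>_. x))" using xM by (rule finite_measure_distr)
    moreover have "finite_measure M" by unfold_locales
    ultimately show ?thesis by (simp add: N_def)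
  qed
  have integral: "(\<Sum>k<4. a k * (\<integral>y. f y \<partial>N k)) = c * (\<integral>y. g y * f y \<partial>M) - f x"
    if f: "f \<in> borel_measurable M" "\<And>y. y \<in> space M \<Longrightarrow> cmod (f y) \<le> B" for f B
  proof -
    have i0: "integrable M (\<lambda>y. of_real (h k y) * f y)" for k
      using int[OF f, of k] by (simp add: scaleR_conv_of_real)
    have fi: "integrable M f" using f by (intro integrable_const_bound[of _ B]) auto
    have "(\<integral>y. g y * f y \<partial>M) = (\<integral>y. of_real (h 0 y) * f y + \<i> * (of_real (h 1 y) * f y) - of_real b * (1 + \<i>) * f y \<partial>M)"
      by (intro Bochner_Integration.integral_cong) (auto simp: gh algebra_simps)
    also have "\<dots> = (\<integral>y. of_real (h 0 y) * f y \<partial>M) + \<i> * (\<integral>y. of_real (h 1 y) * f y \<partial>M) - of_real b * (1 + \<i>) * (\<integral>y. f y \<partial>M)"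
      using i0 fi by simp
    finally have gf: "(\<integral>y. g y * f y \<partial>M) = \<dots>" .
    have "(\<integral>y. f y \<partial>density M (h k)) = (\<integral>y. of_real (h k y) * f y \<partial>M)" for k
      using f h0 by (subst integral_density) (auto simp: scaleR_conv_of_real)
    moreover have "(\<integral>y. f y \<partial>distr M M (\<lambda>_. x)) = f x"
      using f xM by (subst integral_distr) (auto simp: prob_space)
    ultimately show ?thesis unfolding sum4 gf by (simp add: a_def N_def algebra_simps)
  qed
  have nu: "c * (LINT y:A|M. g y) - dirac_measure x A = (\<Sum>k<4. a k * of_real (measure (N k) A))"
    if A: "A \<in> sets M" for A
  proof -
    have "(\<integral>y. complex_of_real (indicator A y) \<partial>N k) = of_real (measure (N k) A)" for k
      using A sets[of k] by (simp add: sets.Int_space_eq2)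
    moreover have "(\<integral>y. g y * complex_of_real (indicator A y) \<partial>M) = (LINT y:A|M. g y)"
      by (simp add: set_lebesgue_integral_def scaleR_conv_of_real mult.commute)
    moreover have "complex_of_real (indicator A x) = dirac_measure x A"
      by (simp add: dirac_measure_def indicator_def)
    ultimately show ?thesis using integral[of "\<lambda>y. of_real (indicator A y)" 1] A
      by (auto simp: indicator_def)
  qed
  show "complex_measure M (\<lambda>A. c * (LINT y:A|M. g y) - dirac_measure x A)"
    by (rule complex_measureI[OF fin sets nu])
  assume v: "v \<in> borel_measurable M" "\<And>y. y \<in> space M \<Longrightarrow> cmod (v y) \<le> d"
  show "complex_measure_integral M (\<lambda>A. c * (LINT y:A|M. g y) - dirac_measure x A) v =
      c * (\<integral>y. g y * v y \<partial>M) - v x"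
    using complex_measure_integral_eq[OF fin sets nu v] integral[OF v] by simp
qed


section \<open>Cells and vertices\<close>

locale pcf_set =
  fixes S :: "'a::euclidean_space pcf"
  assumes similar: "self_similar_set S" and finite_pc: "post_critically_finite S"
begin

abbreviation "I \<equiv> {1..nmaps S}"
abbreviation "F \<equiv> smap S"
abbreviation "X \<equiv> attr S"
abbreviation "V0 \<equiv> bdry S"
abbreviation "W \<equiv> words_of_length S"

lemma F_inj: "j \<in> I \<Longrightarrow> F j x = F j y \<longleftrightarrow> x = y"
  using similar unfolding self_similar_set_def by (metis injD)

lemma inv_F: "j \<in> I \<Longrightarrow> inv (F j) (F j x) = x"
  by (rule inv_f_f) (simp add: inj_def F_inj)

lemma X_nonempty: "X \<noteq> {}" and X_compact: "compact X" and X_union: "X = (\<Union>j\<in>I. F j ` X)"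
  using similar unfolding self_similar_set_def by blast+

lemma F_in_X: "j \<in> I \<Longrightarrow> x \<in> X \<Longrightarrow> F j x \<in> X"
  using X_union by blast

lemma X_cases:
  assumes "x \<in> X" obtains j y where "j \<in> I" "y \<in> X" "x = F j y"
  using assms X_union by blast

lemma I_nonempty: "I \<noteq> {}"
  using X_union X_nonempty by fastforce

lemma F_contraction:
  obtains L where "0 < L" "L < 1" "\<And>j x y. j \<in> I \<Longrightarrow> dist (F j x) (F j y) \<le> L * dist x y"
proof -
  have "\<exists>L. 0 < L \<and> L < 1 \<and> (\<forall>x y. dist (F j x) (F j y) \<le> L * dist x y)" if "j \<in> I" for j
    using similar that unfolding self_similar_set_def lipschitz_on_def by (metis UNIV_I)
  then obtain L where L: "\<And>j. j \<in> I \<Longrightarrow> 0 < L j \<and> L j < 1 \<and> (\<forall>x y. dist (F j x) (F j y) \<le> L j * dist x y)"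
    by metis
  have fin: "finite (L ` I)" "L ` I \<noteq> {}" using I_nonempty by auto
  show thesis
  proof (rule that)
    show "0 < Max (L ` I)" "Max (L ` I) < 1" using fin L by (auto simp: Max_gr_iff)
    fix j x y assume j: "j \<in> I"
    have "dist (F j x) (F j y) \<le> L j * dist x y" using L[OF j] by blast
    also have "\<dots> \<le> Max (L ` I) * dist x y" using fin j by (intro mult_right_mono Max_ge) auto
    finally show "dist (F j x) (F j y) \<le> Max (L ` I) * dist x y" .
  qed
qed

lemma F_continuous: "j \<in> I \<Longrightarrow> continuous_on A (F j)"
  using similar unfolding self_similar_set_def
  by (meson continuous_on_subset lipschitz_on_continuous_on subset_UNIV)

lemma words_of_length_0: "W 0 = {[]}"
  by (auto simp: words_of_length_def words_def)

lemma words_of_length_Suc: "W (Suc m) = (\<lambda>(j, w). j # w) ` (I \<times> W m)"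
proof -
  have "w \<in> (\<lambda>(j, w). j # w) ` (I \<times> W m)" if "w \<in> W (Suc m)" for w
    using that by (cases w) (auto simp: words_of_length_def words_def)
  then show ?thesis by (auto simp: words_of_length_def words_def)
qed

lemma Cons_in_words_iff: "j # w \<in> W (Suc m) \<longleftrightarrow> j \<in> I \<and> w \<in> W m"
  by (auto simp: words_of_length_def words_def)

lemma words_of_length_Suc_snoc: "W (Suc m) = (\<lambda>(w, j). w @ [j]) ` (W m \<times> I)"
proof -
  have "w \<in> (\<lambda>(w, j). w @ [j]) ` (W m \<times> I)" if "w \<in> W (Suc m)" for w
    using that by (cases w rule: rev_cases) (auto simp: words_of_length_def words_def)
  then show ?thesis by (auto simp: words_of_length_def words_def)
qed

lemma finite_words_of_length: "finite (W m)"
  by (induction m) (simp_all add: words_of_length_0 words_of_length_Suc)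

lemma sum_words_Suc: "(\<Sum>w\<in>W (Suc m). f w) = (\<Sum>j\<in>I. \<Sum>w\<in>W m. f (j # w))"
  unfolding words_of_length_Suc
  by (subst sum.reindex) (auto simp: inj_on_def sum.cartesian_product case_prod_unfold)

lemma sum_words_Suc_snoc: "(\<Sum>w\<in>W (Suc m). f w) = (\<Sum>w\<in>W m. \<Sum>j\<in>I. f (w @ [j]))"
  unfolding words_of_length_Suc_snoc
  by (subst sum.reindex) (auto simp: inj_on_def sum.cartesian_product case_prod_unfold)

lemma words_iff: "w \<in> words S \<longleftrightarrow> w \<in> W (length w)"
  by (simp add: words_of_length_def)

lemma words_of_length_imp_word: "w \<in> W m \<Longrightarrow> w \<in> words S"
  by (simp add: words_of_length_def)

lemma word_map_append: "word_map S (v @ w) x = word_map S v (word_map S w x)"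
  by (induction v) auto

lemma word_map_inj: "w \<in> words S \<Longrightarrow> word_map S w x = word_map S w y \<longleftrightarrow> x = y"
  by (induction w) (auto simp: words_def F_inj)

lemma word_map_inv: "w \<in> words S \<Longrightarrow> inv (word_map S w) (word_map S w x) = x"
  by (rule inv_f_f) (simp add: inj_def word_map_inj)

lemma word_map_in_X: "w \<in> words S \<Longrightarrow> x \<in> X \<Longrightarrow> word_map S w x \<in> X"
  by (induction w) (auto simp: words_def F_in_X)

lemma word_map_continuous: "w \<in> words S \<Longrightarrow> continuous_on A (word_map S w)"
proof (induction w)
  case Nil
  then show ?case by (simp add: id_def)
next
  case (Cons j w)
  then show ?case unfolding word_map.simps
    by (intro continuous_on_compose F_continuous) (auto simp: words_def)
qed

lemma word_map_contraction:
  assumes "\<And>j x y. j \<in> I \<Longrightarrow> dist (F j x) (F j y) \<le> L * dist x y" "0 < L"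
  shows "w \<in> words S \<Longrightarrow> dist (word_map S w x) (word_map S w y) \<le> L ^ length w * dist x y"
proof (induction w)
  case (Cons j w)
  then have w: "w \<in> words S" "j \<in> I" by (auto simp: words_def)
  have "dist (word_map S (j # w) x) (word_map S (j # w) y) \<le> L * dist (word_map S w x) (word_map S w y)"
    using assms(1)[OF w(2)] by simp
  also have "\<dots> \<le> L * (L ^ length w * dist x y)"
    using Cons.IH[OF w(1)] assms(2) by (intro mult_left_mono) auto
  finally show ?case by (simp add: mult.assoc)
qed simp

lemma cell_subset: "w \<in> words S \<Longrightarrow> cell S w \<subseteq> X"
  using word_map_in_X by (auto simp: cell_def)

lemma cell_Nil: "cell S [] = X"
  by (simp add: cell_def)

lemma cell_single: "cell S [j] = F j ` X"
  by (simp add: cell_def)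

lemma cell_Cons: "cell S (j # w) = F j ` cell S w"
  by (auto simp: cell_def)

lemma compact_cell: "w \<in> words S \<Longrightarrow> compact (cell S w)"
  unfolding cell_def by (intro compact_continuous_image word_map_continuous X_compact)

lemma cells_cover: "x \<in> X \<Longrightarrow> \<exists>w\<in>W m. x \<in> cell S w"
proof (induction m arbitrary: x)
  case 0
  then show ?case by (simp add: words_of_length_0 cell_Nil)
next
  case (Suc m)
  then obtain j y where j: "j \<in> I" "y \<in> X" "x = F j y" using X_cases by blast
  with Suc.IH[of y] obtain w where "w \<in> W m" "y \<in> cell S w" by blast
  then have "j # w \<in> W (Suc m)" "x \<in> cell S (j # w)"
    using j by (auto simp: Cons_in_words_iff cell_Cons)
  then show ?case by blast
qed

lemma finite_V0: "finite V0"
  and V0_fixed: "q \<in> V0 \<Longrightarrow> \<exists>i\<in>I. F i q = q"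
  using finite_pc unfolding post_critically_finite_def by blast+

text \<open>Boundary points are given only as fixed points in the ambient space; the orbit of any
  point of \<open>X\<close> under the same map stays in \<open>X\<close> and converges to the fixed
  point.\<close>

lemma V0_subset: "V0 \<subseteq> X"
proof
  fix q assume "q \<in> V0"
  then obtain i where i: "i \<in> I" "F i q = q" using V0_fixed by blast
  obtain L where L: "0 < L" "L < 1" "\<And>j x y. j \<in> I \<Longrightarrow> dist (F j x) (F j y) \<le> L * dist x y"
    using F_contraction by blast
  obtain x where x: "x \<in> X" using X_nonempty by blast
  have orbit: "(F i ^^ n) x \<in> X \<and> dist ((F i ^^ n) x) q \<le> L ^ n * dist x q" for n
  proof (induction n)
    case (Suc n)
    have "dist (F i ((F i ^^ n) x)) q \<le> L * dist ((F i ^^ n) x) q"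
      using L(3)[OF i(1), of _ q] i(2) by simp
    also have "\<dots> \<le> L * (L ^ n * dist x q)" using Suc L(1) by (intro mult_left_mono) auto
    finally show ?case using Suc i by (simp add: F_in_X mult.assoc)
  qed (use x in simp)
  have "(\<lambda>n. L ^ n * dist x q) \<longlonglongrightarrow> 0"
    using L by (intro tendsto_mult_left_zero LIMSEQ_power_zero) auto
  then have "(\<lambda>n. dist ((F i ^^ n) x) q) \<longlonglongrightarrow> 0"
    using orbit by (rule_tac Lim_null_comparison[rotated]) (auto intro: always_eventually)
  then have "(\<lambda>n. (F i ^^ n) x) \<longlonglongrightarrow> q" by (simp add: tendsto_dist_iff[of _ q])
  then show "q \<in> X"
    using closed_sequentially[OF compact_imp_closed[OF X_compact], of "\<lambda>n. (F i ^^ n) x" q] orbit by blast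
qed

lemma word_overlap:
  assumes "w \<in> W m" "w' \<in> W m" "w \<noteq> w'" "x \<in> X" "y \<in> X" "word_map S w x = word_map S w' y"
  shows "x \<in> V0" "y \<in> V0"
proof -
  have w: "w \<in> words S" "w' \<in> words S" "length w = length w'"
    using assms by (auto simp: words_of_length_def)
  have "word_map S w x \<in> cell S w \<inter> cell S w'"
    using assms by (auto simp: cell_def intro: rev_image_eqI)
  then have "word_map S w x \<in> word_map S w ` V0" "word_map S w' y \<in> word_map S w' ` V0"
    using finite_pc w assms(3,6) unfolding post_critically_finite_def by (auto dest!: subsetD)
  then show "x \<in> V0" "y \<in> V0" using word_map_inj[OF w(1)] word_map_inj[OF w(2)] by auto
qed

lemma F_overlap:
  assumes "i \<in> I" "j \<in> I" "i \<noteq> j" "x \<in> X" "y \<in> X" "F i x = F j y"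
  shows "x \<in> V0" "y \<in> V0"
  using word_overlap[of "[i]" 1 "[j]" x y] assms by (auto simp: words_of_length_def words_def)

section \<open>Addresses and the post-critical set\<close>

lemma is_address_Cons:
  assumes "is_address S b y" "j \<in> I"
  shows "is_address S (case_nat j b) (F j y)"
  unfolding is_address_def
proof (intro conjI allI)
  show "range (case_nat j b) \<subseteq> I" using assms
    unfolding is_address_def by (fastforce split: nat.splits)
  fix m
  show "F j y \<in> cell S (map (case_nat j b) [0..<m])"
  proof (cases m)
    case 0
    have "y \<in> cell S (map b [0..<0])" using assms(1) unfolding is_address_def by blast
    then show ?thesis using 0 assms by (auto simp: cell_Nil F_in_X)
  next
    case (Suc k)
    have "y \<in> cell S (map b [0..<k])" using assms(1) unfolding is_address_def by blast
    then show ?thesis unfolding Suc map_upt_Suc by (simp add: cell_Cons)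
  qed
qed

lemma address_exists: "x \<in> X \<Longrightarrow> \<exists>a. is_address S a x"
proof -
  assume x: "x \<in> X"
  have "\<forall>y\<in>X. \<exists>j z. j \<in> I \<and> z \<in> X \<and> y = F j z" using X_cases by metis
  then obtain f g where fg: "\<And>y. y \<in> X \<Longrightarrow> f y \<in> I \<and> g y \<in> X \<and> y = F (f y) (g y)" by metis
  have g: "(g ^^ n) x \<in> X" for n by (induction n) (use x fg in auto)
  define a where "a n = f ((g ^^ n) x)" for n
  have "x = word_map S (map a [0..<n]) ((g ^^ n) x)" for n
  proof (induction n)
    case (Suc n)
    have "(g ^^ n) x = F (a n) ((g ^^ Suc n) x)" using fg[OF g[of n]] by (simp add: a_def)
    then show ?case using Suc by (simp add: word_map_append)
  qed simp
  then have "is_address S a x"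
    unfolding is_address_def cell_def using fg g by (auto simp: a_def)
  then show ?thesis by blast
qed

text \<open>If \<open>q\<close> also had an address \<open>jb\<close> with \<open>j \<noteq> i\<close>, then all \<open>i\<^sup>njb\<close> would be post-critical.\<close>

lemma boundary_point_unique_cell:
  assumes q: "q \<in> V0" and i: "i \<in> I" "F i q = q" and j: "j \<in> I" "q \<in> F j ` X"
  shows "j = i"
proof (rule ccontr)
  assume ne: "j \<noteq> i"
  obtain y where y: "y \<in> X" "q = F j y" using j by blast
  obtain b where b: "is_address S b y" using address_exists[OF y(1)] by blast
  define c where "c n = (case_nat i ^^ n) (case_nat j b)" for n
  have c_Suc: "c (Suc n) = case_nat i (c n)" for n by (simp add: c_def)
  have addr: "is_address S (c n) q" for n
  proof (induction n)
    case 0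
    then show ?case using is_address_Cons[OF b j(1)] by (simp add: c_def y(2))
  next
    case (Suc n)
    then show ?case using is_address_Cons[OF Suc i(1)] i(2) by (simp add: c_Suc)
  qed
  have "q \<in> cell S [i] \<inter> cell S [j]"
    using q V0_subset i j by (auto simp: cell_single intro: rev_image_eqI)
  then have "c n \<in> critical_set S" for n
    unfolding critical_set_def using addr i(1) j(1) ne by blast
  \<comment> \<open>Only proper shifts of critical addresses are post-critical; \<open>c n\<close>
    is the shift of \<open>c (Suc n)\<close> by one place.\<close>
  then have "(\<lambda>k. c (Suc n) (k + 1)) \<in> post_critical_set S" for n
    unfolding post_critical_set_def by (intro UN_I[of 1] imageI) auto
  then have "c n \<in> post_critical_set S" for n by (simp add: c_Suc)
  then have "finite (range c)"
    using finite_pc unfolding post_critically_finite_def by (meson finite_subset image_subsetI)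
  \<comment> \<open>\<open>c n\<close> has \<open>i\<close> at all places before \<open>n\<close>
    and \<open>j\<close> at place \<open>n\<close>.\<close>
  moreover have "inj c"
  proof -
    have small: "c n k = i" if "k < n" for n k
      using that by (induction n arbitrary: k) (auto simp: c_Suc split: nat.splits)
    have eq: "c n n = j" for n by (induction n) (auto simp: c_Suc, simp add: c_def)
    show ?thesis using small eq ne by (intro linorder_injI) metis
  qed
  ultimately show False using range_inj_infinite by blast
qed

text \<open>A boundary point lies in only one 1-cell, so the map that fixes \<open>F j x\<close> is
  \<open>F j\<close> itself, and injectivity removes it from both sides.\<close>

lemma F_boundary: "j \<in> I \<Longrightarrow> x \<in> X \<Longrightarrow> F j x \<in> V0 \<Longrightarrow> F j x = x"
  using boundary_point_unique_cell[of "F j x" _ j] V0_fixed[of "F j x"] F_inj by (metis imageI)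

lemma fixed_point_unique: "i \<in> I \<Longrightarrow> F i x = x \<Longrightarrow> F i y = y \<Longrightarrow> x = y"
proof -
  assume i: "i \<in> I" "F i x = x" "F i y = y"
  obtain L where L: "0 < L" "L < 1" "\<And>j x y. j \<in> I \<Longrightarrow> dist (F j x) (F j y) \<le> L * dist x y"
    using F_contraction by blast
  have "dist x y \<le> L * dist x y" using L(3)[OF i(1), of x y] i by simp
  then show ?thesis using L(2) by (cases "dist x y = 0") (auto simp: mult_le_cancel_right1)
qed

section \<open>Vertices and their density\<close>

lemma level_vertices_0: "level_vertices S 0 = V0"
  by (simp add: level_vertices_def words_of_length_0)

lemma level_vertices_Suc: "level_vertices S (Suc m) = (\<Union>j\<in>I. F j ` level_vertices S m)"
proof -
  have "level_vertices S (Suc m) = (\<Union>p\<in>I \<times> W m. F (fst p) ` word_map S (snd p) ` bdry S)"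
    by (simp add: level_vertices_def words_of_length_Suc case_prod_unfold image_comp)
  also have "\<dots> = (\<Union>j\<in>I. \<Union>w\<in>W m. F j ` word_map S w ` bdry S)" by force
  finally show ?thesis by (simp add: level_vertices_def image_UN)
qed

lemma level_vertices_mono_Suc: "level_vertices S m \<subseteq> level_vertices S (Suc m)"
proof (induction m)
  case 0
  show ?case
  proof
    fix q assume "q \<in> level_vertices S 0"
    then have q: "q \<in> V0" by (simp add: level_vertices_0)
    then obtain i where "i \<in> I" "q = F i q" using V0_fixed by metis
    then show "q \<in> level_vertices S (Suc 0)" using q by (auto simp: level_vertices_Suc level_vertices_0)
  qed
next
  case (Suc m)
  then show ?case unfolding level_vertices_Suc[of "Suc m"] by (subst level_vertices_Suc) blast
qed

lemma level_vertices_mono: "m \<le> n \<Longrightarrow> level_vertices S m \<subseteq> level_vertices S n"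
  by (rule lift_Suc_mono_le[of "level_vertices S"]) (rule level_vertices_mono_Suc)

lemma V0_subset_level: "V0 \<subseteq> level_vertices S m"
  using level_vertices_mono[of 0 m] by (simp add: level_vertices_0)

lemma finite_level_vertices: "finite (level_vertices S m)"
  by (simp add: level_vertices_def finite_words_of_length finite_V0)

lemma level_vertices_subset: "level_vertices S m \<subseteq> X"
  using V0_subset word_map_in_X by (force simp: level_vertices_def words_of_length_def)

lemma level_vertices_subset_all: "level_vertices S m \<subseteq> all_vertices S"
  by (auto simp: all_vertices_def)

lemma all_vertices_subset: "all_vertices S \<subseteq> X"
  using level_vertices_subset by (auto simp: all_vertices_def)

lemma F_in_all_vertices: "j \<in> I \<Longrightarrow> x \<in> all_vertices S \<Longrightarrow> F j x \<in> all_vertices S"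
proof -
  assume j: "j \<in> I" and "x \<in> all_vertices S"
  then obtain m where "x \<in> level_vertices S m" by (auto simp: all_vertices_def)
  then have "F j x \<in> level_vertices S (Suc m)" using j by (auto simp: level_vertices_Suc)
  then show ?thesis using level_vertices_subset_all by blast
qed

text \<open>The vertex \<open>F j x\<close> is also \<open>F i y\<close> with a vertex
  \<open>y\<close>; for \<open>i \<noteq> j\<close> it lies in two 1-cells, and then
  \<open>x\<close> is a boundary point. Passing to a higher level at the start ensures that a letter
  can be split off.\<close>

lemma all_vertices_F: "j \<in> I \<Longrightarrow> x \<in> X \<Longrightarrow> F j x \<in> all_vertices S \<Longrightarrow> x \<in> all_vertices S"
proof -
  assume j: "j \<in> I" and x: "x \<in> X" and "F j x \<in> all_vertices S"
  then obtain m where "F j x \<in> level_vertices S (Suc m)"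
    using level_vertices_mono_Suc by (auto simp: all_vertices_def)
  then obtain i y where iy: "i \<in> I" "y \<in> level_vertices S m" "F j x = F i y"
    by (auto simp: level_vertices_Suc)
  have "y \<in> X" using iy level_vertices_subset by blast
  then have "x = y \<or> x \<in> V0" using F_overlap(1)[OF j iy(1) _ x] F_inj[OF j] iy(3) by (cases "i = j") auto
  then show ?thesis using iy(2) V0_subset_level level_vertices_subset_all by blast
qed

lemma word_map_in_all_vertices: "w \<in> words S \<Longrightarrow> x \<in> all_vertices S \<Longrightarrow> word_map S w x \<in> all_vertices S"
  by (induction w) (auto simp: words_def F_in_all_vertices)

lemma all_vertices_word_map:
  "w \<in> words S \<Longrightarrow> x \<in> X \<Longrightarrow> word_map S w x \<in> all_vertices S \<Longrightarrow> x \<in> all_vertices S"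
proof (induction w)
  case (Cons j w)
  then have w: "w \<in> words S" "j \<in> I" by (auto simp: words_def)
  show ?case using Cons.IH[OF w(1) Cons.prems(2)] all_vertices_F[OF w(2) word_map_in_X[OF w(1) Cons.prems(2)]]
    Cons.prems(3) by simp
qed simp

lemma V0_subset_all: "V0 \<subseteq> all_vertices S"
  using V0_subset_level level_vertices_subset_all by blast

lemma all_vertices_dense:
  assumes "V0 \<noteq> {}"
  shows "X \<subseteq> closure (all_vertices S)"
proof
  fix x assume x: "x \<in> X"
  obtain q where q: "q \<in> V0" using assms by blast
  obtain L where L: "0 < L" "L < 1" "\<And>j x y. j \<in> I \<Longrightarrow> dist (F j x) (F j y) \<le> L * dist x y"
    using F_contraction by blast
  obtain D where D: "\<And>x y. x \<in> X \<Longrightarrow> y \<in> X \<Longrightarrow> dist x y \<le> D"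
    using compact_imp_bounded[OF X_compact] unfolding bounded_two_points by blast
  show "x \<in> closure (all_vertices S)"
    unfolding closure_approachable
  proof (intro allI impI)
    fix e :: real assume "0 < e"
    have "(\<lambda>n. L ^ n * D) \<longlonglongrightarrow> 0"
      using L by (intro tendsto_mult_left_zero LIMSEQ_power_zero) auto
    then have "\<forall>\<^sub>F n in sequentially. L ^ n * D < e" using \<open>0 < e\<close> by (rule order_tendstoD(2))
    then obtain n where n: "L ^ n * D < e" by (auto simp: eventually_sequentially)
    obtain w where w: "w \<in> W n" "x \<in> cell S w" using cells_cover[OF x] by blast
    then obtain y where y: "y \<in> X" "x = word_map S w y" by (auto simp: cell_def)
    have ww: "w \<in> words S" "length w = n" using w by (auto simp: words_of_length_def)
    have qX: "q \<in> X" using q V0_subset by blast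
    have "dist (word_map S w q) x \<le> L ^ n * dist q y"
      using word_map_contraction[OF L(3) L(1) ww(1), of q y] y ww by simp
    also have "\<dots> \<le> L ^ n * D" using D[OF qX y(1)] L(1) by (intro mult_left_mono) auto
    finally have "dist (word_map S w q) x < e" using n by simp
    moreover have "word_map S w q \<in> all_vertices S"
      using word_map_in_all_vertices[OF ww(1)] q V0_subset_all by blast
    ultimately show "\<exists>y\<in>all_vertices S. dist y x < e" by blast
  qed
qed

text \<open>Disjoint cells of the same level have positive distance.\<close>

lemma close_points_in_touching_cells:
  obtains d where "d > 0"
    "\<And>x y. x \<in> X \<Longrightarrow> y \<in> X \<Longrightarrow> dist x y < d \<Longrightarrow>
      \<exists>w\<in>W m. \<exists>w'\<in>W m. x \<in> cell S w \<and> y \<in> cell S w' \<and> cell S w \<inter> cell S w' \<noteq> {}"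
proof -
  define P where "P = {(w, w'). w \<in> W m \<and> w' \<in> W m \<and> cell S w \<inter> cell S w' = {}}"
  have fin: "finite P"
    by (rule finite_subset[of _ "W m \<times> W m"]) (auto simp: P_def finite_words_of_length)
  have "\<exists>d>0. \<forall>x\<in>cell S (fst p). \<forall>y\<in>cell S (snd p). d \<le> dist x y" if "p \<in> P" for p
  proof -
    have "fst p \<in> words S" "snd p \<in> words S" "cell S (fst p) \<inter> cell S (snd p) = {}"
      using that by (auto simp: P_def words_of_length_def)
    then show ?thesis
      using separate_compact_closed[of "cell S (fst p)" "cell S (snd p)"] compact_cell compact_imp_closed
      by metis
  qed
  then obtain d where d: "\<And>p. p \<in> P \<Longrightarrow> d p > 0"
    "\<And>p x y. p \<in> P \<Longrightarrow> x \<in> cell S (fst p) \<Longrightarrow> y \<in> cell S (snd p) \<Longrightarrow> d p \<le> dist x y" by metis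
  define e where "e = Min (insert 1 (d ` P))"
  have e: "e > 0" "\<And>p. p \<in> P \<Longrightarrow> e \<le> d p" using fin d by (auto simp: e_def)
  show thesis
  proof (rule that[OF e(1)])
    fix x y assume xy: "x \<in> X" "y \<in> X" "dist x y < e"
    obtain w w' where w: "w \<in> W m" "x \<in> cell S w" "w' \<in> W m" "y \<in> cell S w'"
      using cells_cover[OF xy(1)] cells_cover[OF xy(2)] by blast
    have "(w, w') \<notin> P"
    proof
      assume p: "(w, w') \<in> P"
      then have "d (w, w') \<le> dist x y" using d(2)[OF p] w by simp
      then show False using e(2)[OF p] xy(3) by simp
    qed
    then have "cell S w \<inter> cell S w' \<noteq> {}" using w by (auto simp: P_def)
    then show "\<exists>w\<in>W m. \<exists>w'\<in>W m. x \<in> cell S w \<and> y \<in> cell S w' \<and> cell S w \<inter> cell S w' \<noteq> {}"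
      using w by blast
  qed
qed

section \<open>Gluing functions along the 1-cells\<close>

lemma continuous_on_glue:
  fixes u :: "'a \<Rightarrow> 'b::topological_space"
  assumes "\<And>j. j \<in> I \<Longrightarrow> continuous_on X (u \<circ> F j)"
  shows "continuous_on X u"
proof -
  have "continuous_on (F j ` X) u" if j: "j \<in> I" for j
  proof -
    have inj: "inj_on (F j) X" using F_inj[OF j] by (simp add: inj_on_def)
    have "continuous_on (F j ` X) ((u \<circ> F j) \<circ> the_inv_into X (F j))"
      using continuous_on_inv_into[OF F_continuous[OF j] X_compact inj]
      by (rule continuous_on_compose)
        (rule continuous_on_subset[OF assms[OF j]], auto simp: the_inv_into_f_f[OF inj])
    then show ?thesis by (rule continuous_on_eq) (auto simp: the_inv_into_f_f[OF inj])
  qed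
  then have "continuous_on (\<Union>j\<in>I. F j ` X) u"
    by (intro continuous_on_closed_Union compact_imp_closed compact_continuous_image F_continuous X_compact) auto
  then show ?thesis using X_union by simp
qed

text \<open>Different 1-cells meet only in images of boundary points, and each map is injective, so
  compatibility on \<open>V0\<close> suffices for a function that is given separately on the
  cells.\<close>

lemma glue_exists:
  fixes f :: "nat \<Rightarrow> 'a \<Rightarrow> 'b"
  assumes "\<And>i j x y. i \<in> I \<Longrightarrow> j \<in> I \<Longrightarrow> x \<in> V0 \<Longrightarrow> y \<in> V0 \<Longrightarrow> F i x = F j y \<Longrightarrow> f i x = f j y"
  shows "\<exists>u. (\<forall>j\<in>I. \<forall>x\<in>X. u (F j x) = f j x) \<and> (\<forall>x. x \<notin> X \<longrightarrow> u x = z)"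
proof -
  have "\<exists>c. (\<forall>j\<in>I. \<forall>y\<in>X. x = F j y \<longrightarrow> c = f j y) \<and> (x \<notin> X \<longrightarrow> c = z)" for x
  proof (cases "x \<in> X")
    case True
    then obtain i y where iy: "i \<in> I" "y \<in> X" "x = F i y" using X_cases by blast
    have "f i y = f j y'" if "j \<in> I" "y' \<in> X" "x = F j y'" for j y'
      using F_overlap[OF iy(1) that(1) _ iy(2) that(2)] assms[OF iy(1) that(1)] F_inj[OF iy(1)] iy that
      by (cases "i = j") auto
    then show ?thesis using True by blast
  next
    case False
    then show ?thesis using F_in_X by blast
  qed
  then obtain u where "\<And>x. (\<forall>j\<in>I. \<forall>y\<in>X. x = F j y \<longrightarrow> u x = f j y) \<and> (x \<notin> X \<longrightarrow> u x = z)" by metis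
  then show ?thesis by (intro exI[of _ u]) blast
qed

end


section \<open>Measure and energy\<close>

locale pcf_energy = pcf_set S for S :: "'a::euclidean_space pcf" +
  assumes ener: "self_similar_energy S" and meas: "self_similar_measure S"
begin

abbreviation "r \<equiv> rfac S"
abbreviation "M \<equiv> meas S"

section \<open>The self-similar measure\<close>

lemma mwt_pos: "j \<in> I \<Longrightarrow> 0 < mwt S j"
  and mwt_less_1: "j \<in> I \<Longrightarrow> mwt S j < 1"
  and sum_mwt: "(\<Sum>j\<in>I. mwt S j) = 1"
  and prob_space_M: "prob_space M"
  and sets_M: "sets M = sets (restrict_space borel X)"
  and measure_self_similar: "A \<in> sets M \<Longrightarrow>
    measure M A = (\<Sum>j\<in>I. mwt S j * measure M (F j -` A \<inter> X))"
  using meas unfolding self_similar_measure_def by blast+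

sublocale prob_space M by (rule prob_space_M)

lemma space_M: "space M = X"
  using sets_eq_imp_space_eq[OF sets_M] by (simp add: space_restrict_space)

lemma continuous_measurable: "continuous_on X u \<Longrightarrow> u \<in> borel_measurable M"
  using borel_measurable_continuous_on_restrict[of X u] by (simp add: measurable_cong_sets[OF sets_M refl])

lemma F_measurable: "j \<in> I \<Longrightarrow> F j \<in> measurable M M"
proof -
  assume j: "j \<in> I"
  have "F j \<in> measurable (restrict_space borel X) (restrict_space borel X)"
    using j F_continuous[OF j, of UNIV] F_in_X
    by (intro measurable_restrict_space3 borel_measurable_continuous_onI) auto
  then show ?thesis using measurable_cong_sets[OF sets_M sets_M] by simp
qed

lemma continuous_bounded:
  fixes u :: "'a \<Rightarrow> 'b::real_normed_vector"
  assumes "continuous_on X u"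
  obtains b where "b > 0" "\<And>x. x \<in> X \<Longrightarrow> norm (u x) \<le> b"
  using compact_imp_bounded[OF compact_continuous_image[OF assms X_compact]]
  unfolding bounded_pos by auto

lemma continuous_integrable:
  fixes u :: "'a \<Rightarrow> 'b::{banach, second_countable_topology}"
  assumes "continuous_on X u"
  shows "integrable M u"
proof -
  obtain b where "\<And>x. x \<in> X \<Longrightarrow> norm (u x) \<le> b" using continuous_bounded[OF assms] by blast
  then show ?thesis
    using continuous_measurable[OF assms] by (intro integrable_const_bound[of _ b] AE_I2) (auto simp: space_M)
qed

lemma integral_norm_le:
  fixes u :: "'a \<Rightarrow> 'b::{banach, second_countable_topology}"
  assumes "u \<in> borel_measurable M" "\<And>x. x \<in> X \<Longrightarrow> norm (u x) \<le> b"
  shows "norm (\<integral>x. u x \<partial>M) \<le> b"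
proof -
  have u: "integrable M u" using assms by (intro integrable_const_bound[of _ b] AE_I2) (auto simp: space_M)
  have "norm (\<integral>x. u x \<partial>M) \<le> (\<integral>x. norm (u x) \<partial>M)" by (rule integral_norm_bound)
  also have "\<dots> \<le> (\<integral>x. b \<partial>M)"
    using u assms(2) by (intro integral_mono) (auto simp: space_M)
  finally show ?thesis by (simp add: prob_space)
qed

text \<open>\<open>M\<close> minus the weighted images \<open>distr M M (F j)\<close> is a
  combination of measures that vanishes on every measurable set, so the general statement on such
  combinations applies. Index 0, which is not in \<open>I\<close>, carries \<open>M\<close>
  itself.\<close>

lemma integral_self_similar:
  fixes u :: "'a \<Rightarrow> complex"
  assumes u: "continuous_on X u"
  shows "(\<integral>x. u x \<partial>M) = (\<Sum>j\<in>I. of_real (mwt S j) * (\<integral>x. u (F j x) \<partial>M))"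
proof -
  define N where "N k = (if k = 0 then M else distr M M (F k))" for k
  define a where "a k = (if k = 0 then 1 else - complex_of_real (mwt S k))" for k
  have F0: "j \<noteq> 0" if "j \<in> I" for j using that by simp
  have split: "(\<Sum>k\<in>insert 0 I. f k) = f 0 + (\<Sum>j\<in>I. f j)" for f :: "nat \<Rightarrow> complex" by simp
  obtain b where b: "\<And>x. x \<in> X \<Longrightarrow> norm (u x) \<le> b" using continuous_bounded[OF u] by blast
  have fin: "finite_measure M" by unfold_locales
  have "(\<Sum>k\<in>insert 0 I. a k * (\<integral>x. u x \<partial>N k)) = 0"
  proof (rule measure_combination_integral_zero)
    show "u \<in> borel_measurable M" using u by (rule continuous_measurable)
    show "\<And>x. x \<in> space M \<Longrightarrow> cmod (u x) \<le> b" using b by (simp add: space_M)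
    show "finite_measure (N k)" if "k \<in> insert 0 I" for k
      using that fin F_measurable finite_measure_distr by (auto simp: N_def)
    fix A assume A: "A \<in> sets M"
    have "measure (distr M M (F j)) A = measure M (F j -` A \<inter> X)" if "j \<in> I" for j
      using measure_distr[OF F_measurable[OF that] A] by (simp add: space_M)
    then have "(\<Sum>j\<in>I. a j * of_real (measure (N j) A)) =
        - of_real (\<Sum>j\<in>I. mwt S j * measure M (F j -` A \<inter> X))"
      using F0 by (simp add: a_def N_def sum_negf)
    then show "(\<Sum>k\<in>insert 0 I. a k * of_real (measure (N k) A)) = 0"
      unfolding split using measure_self_similar[OF A] by (simp add: a_def N_def)
  qed (auto simp: N_def)
  moreover have "(\<integral>x. u x \<partial>N j) = (\<integral>x. u (F j x) \<partial>M)" if "j \<in> I" for j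
    using integral_distr[OF F_measurable[OF that] continuous_measurable[OF u]] F0[OF that] by (simp add: N_def)
  then have "(\<Sum>j\<in>I. a j * (\<integral>x. u x \<partial>N j)) = - (\<Sum>j\<in>I. of_real (mwt S j) * (\<integral>x. u (F j x) \<partial>M))"
    using F0 by (simp add: a_def sum_negf)
  ultimately show ?thesis unfolding split by (simp add: a_def N_def)
qed

lemma compact_in_sets: "K \<subseteq> X \<Longrightarrow> compact K \<Longrightarrow> K \<in> sets M"
  unfolding sets_M sets_restrict_space by (intro image_eqI[of _ _ K]) (auto dest: compact_imp_closed)

lemma cell_in_sets: "w \<in> words S \<Longrightarrow> cell S w \<in> sets M"
  by (intro compact_in_sets cell_subset compact_cell)

lemma measure_cell_pos: "w \<in> words S \<Longrightarrow> 0 < measure M (cell S w)"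
proof (induction w)
  case Nil
  then show ?case using prob_space by (simp add: cell_Nil space_M)
next
  case (Cons j w)
  then have w: "w \<in> words S" "j \<in> I" by (auto simp: words_def)
  have "0 < mwt S j * measure M (cell S w)" using Cons.IH w mwt_pos by simp
  also have "cell S w = F j -` cell S (j # w) \<inter> X"
    using cell_subset[OF w(1)] F_inj[OF w(2)] by (auto simp: cell_Cons)
  also have "mwt S j * measure M (F j -` cell S (j # w) \<inter> X) \<le> measure M (cell S (j # w))"
    unfolding measure_self_similar[OF cell_in_sets[OF Cons.prems]]
    using w(2) by (intro member_le_sum) (auto intro!: mult_nonneg_nonneg less_imp_le[OF mwt_pos])
  finally show ?case .
qed

section \<open>Energies of finite level\<close>

lemma conduct_nonneg: "x \<in> V0 \<Longrightarrow> y \<in> V0 \<Longrightarrow> 0 \<le> conduct S x y"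
  and conduct_sym: "x \<in> V0 \<Longrightarrow> y \<in> V0 \<Longrightarrow> conduct S x y = conduct S y x"
  and r_pos: "j \<in> I \<Longrightarrow> 0 < r j"
  and r_less_1: "j \<in> I \<Longrightarrow> r j < 1"
  and energy0_le_1: "energy0 S (u :: 'a \<Rightarrow> real) u \<le> energy_level S 1 u u"
  and energy0_extend: "\<exists>v :: 'a \<Rightarrow> real. (\<forall>q\<in>V0. v q = u q) \<and> energy_level S 1 v v = energy0 S u u"
  and dirichlet: "dirichlet_form S (dom_energy_real S) (energy S)"
  and zero_energy_constant: "(\<lambda>m. energy_level S m u u) \<longlonglongrightarrow> 0 \<Longrightarrow> \<exists>k. \<forall>x\<in>all_vertices S. u x = k"
  using ener unfolding self_similar_energy_def by blast+

lemma word_r_Nil: "word_r S [] = 1"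
  and word_r_Cons: "word_r S (j # w) = r j * word_r S w"
  and word_r_snoc: "word_r S (w @ [j]) = word_r S w * r j"
  and word_mu_Nil: "word_mu S [] = 1"
  and word_mu_Cons: "word_mu S (j # w) = mwt S j * word_mu S w"
  and word_mu_snoc: "word_mu S (w @ [j]) = word_mu S w * mwt S j"
  by (simp_all add: word_r_def word_mu_def)

lemma word_r_pos: "w \<in> words S \<Longrightarrow> 0 < word_r S w"
  by (induction w) (auto simp: word_r_Nil word_r_Cons words_def intro!: mult_pos_pos r_pos)

lemma word_mu_pos: "w \<in> words S \<Longrightarrow> 0 < word_mu S w"
  by (induction w) (auto simp: word_mu_Nil word_mu_Cons words_def intro!: mult_pos_pos mwt_pos)

lemma word_mu_le_1: "w \<in> words S \<Longrightarrow> word_mu S w \<le> 1"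
proof (induction w)
  case (Cons j w)
  then have w: "w \<in> words S" "j \<in> I" by (auto simp: words_def)
  show ?case unfolding word_mu_Cons
    using Cons.IH[OF w(1)] mwt_pos[OF w(2)] mwt_less_1[OF w(2)] word_mu_pos[OF w(1)]
    by (simp add: mult_le_one)
qed (simp add: word_mu_Nil)

text \<open>The \<rho> of the overview: composing with any map \<open>F j\<close> multiplies the
  energy by at most this factor.\<close>

definition rmax :: real where "rmax = Max (r ` I)"

lemma r_le_rmax: "j \<in> I \<Longrightarrow> r j \<le> rmax"
  unfolding rmax_def by (intro Max_ge) auto

lemma rmax_pos: "0 < rmax" and rmax_less_1: "rmax < 1"
proof -
  obtain j where j: "j \<in> I" using I_nonempty by blast
  show "0 < rmax" using r_pos[OF j] r_le_rmax[OF j] by simp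
  show "rmax < 1" unfolding rmax_def using j r_less_1 by (subst Max_less_iff) auto
qed

lemma word_r_le: "w \<in> W m \<Longrightarrow> word_r S w \<le> rmax ^ m"
proof (induction m arbitrary: w)
  case 0
  then show ?case by (simp add: words_of_length_0 word_r_Nil)
next
  case (Suc m)
  then obtain j v where "w = j # v" "j \<in> I" "v \<in> W m" by (auto simp: words_of_length_Suc)
  then show ?case
    using Suc.IH[of v] r_le_rmax[of j] r_pos[of j] rmax_pos word_r_pos[of v] words_of_length_imp_word[of v m]
    by (auto simp: word_r_Cons intro!: mult_mono)
qed

lemma energy_level_0: "energy_level S 0 u v = energy0 S u v"
  by (simp add: energy_level_def words_of_length_0 word_r_Nil)

lemma energy_level_Suc: "energy_level S (Suc m) u v =
    (\<Sum>j\<in>I. of_real (inverse (r j)) * energy_level S m (u \<circ> F j) (v \<circ> F j))"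
  unfolding energy_level_def sum_words_Suc
  by (intro sum.cong refl) (simp add: word_r_Cons sum_distrib_left mult.assoc o_assoc)

lemma energy0_add: "energy0 S (\<lambda>x. u x + v x) w = energy0 S u w + energy0 S v w"
  unfolding energy0_def add_divide_distrib[symmetric] sum.distrib[symmetric]
  by (intro arg_cong2[where f = "(/)"] sum.cong refl) (simp add: algebra_simps)

lemma energy0_scale: "energy0 S (\<lambda>x. c * u x) w = c * energy0 S u w"
  unfolding energy0_def sum_distrib_left times_divide_eq_right
  by (intro arg_cong2[where f = "(/)"] sum.cong refl) (simp add: algebra_simps)

lemma energy0_sym: "energy0 S u v = energy0 S v u"
  unfolding energy0_def
  by (intro arg_cong2[where f = "(/)"] sum.cong refl) (simp add: algebra_simps)

lemma energy_level_add: "energy_level S m (\<lambda>x. u x + v x) w = energy_level S m u w + energy_level S m v w"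
  unfolding energy_level_def sum.distrib[symmetric]
  by (intro sum.cong refl) (simp add: o_def energy0_add algebra_simps)

lemma energy_level_scale: "energy_level S m (\<lambda>x. c * u x) w = c * energy_level S m u w"
  unfolding energy_level_def sum_distrib_left
  by (intro sum.cong refl) (simp add: o_def energy0_scale algebra_simps)

lemma energy_level_sym: "energy_level S m u v = energy_level S m v u"
  unfolding energy_level_def by (subst energy0_sym) (rule refl)

lemma energy_level_cong:
  assumes "\<And>x. x \<in> level_vertices S m \<Longrightarrow> u x = u' x" "\<And>x. x \<in> level_vertices S m \<Longrightarrow> v x = v' x"
  shows "energy_level S m u v = energy_level S m u' v'"
proof -
  have "energy0 S (u \<circ> word_map S w) (v \<circ> word_map S w) = energy0 S (u' \<circ> word_map S w) (v' \<circ> word_map S w)"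
    if w: "w \<in> W m" for w
  proof -
    have "word_map S w q \<in> level_vertices S m" if "q \<in> V0" for q
      using w that by (auto simp: level_vertices_def)
    then show ?thesis unfolding energy0_def using assms
      by (intro arg_cong2[where f = "(/)"] sum.cong refl) simp
  qed
  then show ?thesis unfolding energy_level_def by simp
qed

lemma energy0_nonneg: "0 \<le> energy0 S (u :: 'a \<Rightarrow> real) u"
  unfolding energy0_def
  by (intro divide_nonneg_nonneg sum_nonneg)
    (simp_all add: mult.assoc mult_nonneg_nonneg[OF conduct_nonneg zero_le_square])

lemma energy_level_nonneg: "0 \<le> energy_level S m (u :: 'a \<Rightarrow> real) u"
  unfolding energy_level_def
  by (intro sum_nonneg mult_nonneg_nonneg energy0_nonneg)
    (auto intro!: less_imp_le[OF word_r_pos] dest: words_of_length_imp_word)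

text \<open>In every cell the passage to the next level replaces \<open>E\<^sub>0\<close> by
  \<open>E\<^sub>1\<close> of the same function, and by the renormalization condition this does not
  decrease the energy.\<close>

lemma energy_level_mono_Suc: "energy_level S m (u :: 'a \<Rightarrow> real) u \<le> energy_level S (Suc m) u u"
proof (induction m arbitrary: u)
  case 0
  then show ?case using energy0_le_1 by (simp add: energy_level_0)
next
  case (Suc m)
  show ?case unfolding energy_level_Suc[of "Suc m"] by (subst energy_level_Suc)
      (auto intro!: sum_mono mult_left_mono Suc.IH less_imp_le[OF r_pos])
qed

lemma energy_level_mono: "m \<le> n \<Longrightarrow> energy_level S m (u :: 'a \<Rightarrow> real) u \<le> energy_level S n u u"
  by (rule lift_Suc_mono_le[of "\<lambda>m. energy_level S m u u"]) (rule energy_level_mono_Suc)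

section \<open>Real functions of finite energy\<close>

abbreviation "D \<equiv> dom_energy_real S"

lemma D_continuous: "u \<in> D \<Longrightarrow> continuous_on X u"
  by (simp add: dom_energy_real_def)

lemma D_zero: "(\<lambda>x. 0) \<in> D"
  and D_add: "u \<in> D \<Longrightarrow> v \<in> D \<Longrightarrow> (\<lambda>x. u x + v x) \<in> D"
  and D_scale: "u \<in> D \<Longrightarrow> (\<lambda>x. a * u x) \<in> D"
  using dirichlet unfolding dirichlet_form_def by blast+

lemma D_diff: "u \<in> D \<Longrightarrow> v \<in> D \<Longrightarrow> (\<lambda>x. u x - v x) \<in> D"
  using D_add[OF _ D_scale[of v "-1"], of u] by simp

text \<open>The domain asks for convergence only on the diagonal; polarization, together with
  closure of the domain under sums, gives convergence of the bilinear energies.\<close>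

lemma D_tendsto:
  assumes u: "u \<in> D" and v: "v \<in> D"
  shows "(\<lambda>m. energy_level S m u v) \<longlonglongrightarrow> energy S u v"
proof -
  have eq: "energy_level S m u v = (energy_level S m (\<lambda>x. u x + v x) (\<lambda>x. u x + v x)
      - energy_level S m u u - energy_level S m v v) / 2" for m
  proof -
    have "energy_level S m u (\<lambda>x. u x + v x) = energy_level S m u u + energy_level S m u v"
      using energy_level_sym[of m u "\<lambda>x. u x + v x"] energy_level_add[of m u v u] energy_level_sym[of m v u]
      by simp
    moreover have "energy_level S m v (\<lambda>x. u x + v x) = energy_level S m u v + energy_level S m v v"
      using energy_level_sym[of m v "\<lambda>x. u x + v x"] energy_level_add[of m u v v] by simp
    ultimately show ?thesis unfolding energy_level_add by simp
  qed
  have "convergent (\<lambda>m. (energy_level S m (\<lambda>x. u x + v x) (\<lambda>x. u x + v x)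
      - energy_level S m u u - energy_level S m v v) / 2)"
  proof -
    obtain a b c where "(\<lambda>m. energy_level S m u u) \<longlonglongrightarrow> a" "(\<lambda>m. energy_level S m v v) \<longlonglongrightarrow> b"
      "(\<lambda>m. energy_level S m (\<lambda>x. u x + v x) (\<lambda>x. u x + v x)) \<longlonglongrightarrow> c"
      using u v D_add[OF u v] unfolding dom_energy_real_def convergent_def by blast
    then show ?thesis
      by (intro convergentI[of _ "(c - a - b) / 2"] tendsto_divide tendsto_diff tendsto_const) auto
  qed
  then show ?thesis unfolding energy_def eq using convergent_LIMSEQ_iff by blast
qed

lemma energy_level_le: "u \<in> D \<Longrightarrow> energy_level S m u u \<le> energy S u u"
  using D_tendsto[of u u] by (intro LIMSEQ_le_const[of "\<lambda>m. energy_level S m u u"]) (auto intro: energy_level_mono)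

lemma energy_nonneg: "u \<in> D \<Longrightarrow> 0 \<le> energy S u u"
  using energy_level_nonneg energy_level_le order_trans by blast

lemma D_I:
  assumes "continuous_on X u" "\<And>m. energy_level S m u u \<le> e"
  shows "u \<in> D" "energy S u u \<le> e"
proof -
  obtain L where "(\<lambda>m. energy_level S m u u) \<longlonglongrightarrow> L"
  proof (rule incseq_convergent)
    show "incseq (\<lambda>m. energy_level S m u u)" unfolding incseq_def using energy_level_mono by blast
    show "\<forall>m. energy_level S m u u \<le> e" using assms(2) by blast
  qed
  then show "u \<in> D" using assms(1) by (auto simp: dom_energy_real_def convergent_def)
  then show "energy S u u \<le> e" using D_tendsto[of u u] assms(2) by (auto intro: LIMSEQ_le_const2)
qed

lemma energy_level_F:
  assumes "j \<in> I" shows "energy_level S m (u \<circ> F j) (u \<circ> F j) \<le> r j * energy_level S (Suc m) (u :: 'a \<Rightarrow> real) u"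
proof -
  have "inverse (r j) * energy_level S m (u \<circ> F j) (u \<circ> F j) \<le> energy_level S (Suc m) u u"
    unfolding energy_level_Suc using assms
    by (simp, intro member_le_sum) (auto intro!: mult_nonneg_nonneg energy_level_nonneg less_imp_le[OF r_pos])
  then show ?thesis using r_pos[OF assms] by (simp add: field_simps)
qed

lemma D_F:
  assumes u: "u \<in> D" and j: "j \<in> I"
  shows "u \<circ> F j \<in> D" "energy S (u \<circ> F j) (u \<circ> F j) \<le> r j * energy S u u"
proof -
  have c: "continuous_on X (u \<circ> F j)"
    using F_continuous[OF j] D_continuous[OF u] j F_in_X
    by (intro continuous_on_compose) (auto elim!: continuous_on_subset)
  have b: "energy_level S m (u \<circ> F j) (u \<circ> F j) \<le> r j * energy S u u" for m
    using energy_level_F[OF j, of m u] energy_level_le[OF u, of "Suc m"] r_pos[OF j]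
    by (meson less_imp_le mult_left_mono order_trans)
  from D_I[OF c b] show "u \<circ> F j \<in> D" "energy S (u \<circ> F j) (u \<circ> F j) \<le> r j * energy S u u" .
qed

lemma D_glue:
  assumes "\<And>j. j \<in> I \<Longrightarrow> u \<circ> F j \<in> D"
  shows "u \<in> D"
proof (rule D_I(1))
  show "continuous_on X u" by (rule continuous_on_glue) (rule D_continuous, rule assms)
  fix m
  have "energy_level S m u u \<le> energy_level S (Suc m) u u" by (rule energy_level_mono_Suc)
  also have "\<dots> \<le> (\<Sum>j\<in>I. inverse (r j) * energy S (u \<circ> F j) (u \<circ> F j))"
    unfolding energy_level_Suc using assms
    by (auto intro!: sum_mono mult_left_mono energy_level_le less_imp_le[OF r_pos])
  finally show "energy_level S m u u \<le> (\<Sum>j\<in>I. inverse (r j) * energy S (u \<circ> F j) (u \<circ> F j))" .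
qed

subsection \<open>Complex-valued functions\<close>

abbreviation "DC \<equiv> dom_energy S"

lemma energy_level_complex:
  "energy_level S m u v =
    of_real (energy_level S m (\<lambda>x. Re (u x)) (\<lambda>x. Re (v x)) - energy_level S m (\<lambda>x. Im (u x)) (\<lambda>x. Im (v x)))
    + \<i> * of_real (energy_level S m (\<lambda>x. Re (u x)) (\<lambda>x. Im (v x)) + energy_level S m (\<lambda>x. Im (u x)) (\<lambda>x. Re (v x)))"
proof -
  have r: "energy_level S m (\<lambda>x. complex_of_real (a x)) (\<lambda>x. complex_of_real (b x)) = of_real (energy_level S m a b)" for a b
    by (simp add: energy_level_def energy0_def)
  have s: "energy_level S m (\<lambda>x. f x + \<i> * g x) w = energy_level S m f w + \<i> * energy_level S m g w" for f g w
    by (simp add: energy_level_add energy_level_scale)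
  have s': "energy_level S m w (\<lambda>x. f x + \<i> * g x) = energy_level S m w f + \<i> * energy_level S m w g" for f g w
    using s energy_level_sym by metis
  have "energy_level S m u v = energy_level S m (\<lambda>x. complex_of_real (Re (u x)) + \<i> * of_real (Im (u x)))
     (\<lambda>x. complex_of_real (Re (v x)) + \<i> * of_real (Im (v x)))"
    by (simp flip: complex_eq)
  also have "\<dots> = of_real (energy_level S m (\<lambda>x. Re (u x)) (\<lambda>x. Re (v x)) - energy_level S m (\<lambda>x. Im (u x)) (\<lambda>x. Im (v x)))
    + \<i> * of_real (energy_level S m (\<lambda>x. Re (u x)) (\<lambda>x. Im (v x)) + energy_level S m (\<lambda>x. Im (u x)) (\<lambda>x. Re (v x)))"
    unfolding s s' r by (simp add: algebra_simps)
  finally show ?thesis .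
qed

lemma DC_parts: "u \<in> DC \<Longrightarrow> (\<lambda>x. Re (u x)) \<in> D" "u \<in> DC \<Longrightarrow> (\<lambda>x. Im (u x)) \<in> D"
  by (simp_all add: dom_energy_def)

lemma DC_continuous: "u \<in> DC \<Longrightarrow> continuous_on X u"
  using DC_parts[THEN D_continuous] continuous_on_Complex[of X "\<lambda>x. Re (u x)" "\<lambda>x. Im (u x)"] by simp

lemma DC_zero: "(\<lambda>x. 0) \<in> DC"
  using D_zero by (simp add: dom_energy_def)

lemma DC_add: "u \<in> DC \<Longrightarrow> v \<in> DC \<Longrightarrow> (\<lambda>x. u x + v x) \<in> DC"
  by (simp add: dom_energy_def D_add)

lemma DC_scale: "u \<in> DC \<Longrightarrow> (\<lambda>x. c * u x) \<in> DC"
  by (simp add: dom_energy_def D_add D_diff D_scale)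

lemma DC_cnj: "u \<in> DC \<Longrightarrow> (\<lambda>x. cnj (u x)) \<in> DC"
  using D_scale[of "\<lambda>x. Im (u x)" "-1"] by (simp add: dom_energy_def)

lemma DC_diff: "u \<in> DC \<Longrightarrow> v \<in> DC \<Longrightarrow> (\<lambda>x. u x - v x) \<in> DC"
  using DC_add[OF _ DC_scale[of v "-1"], of u] by simp

lemma DC_sum: "finite A \<Longrightarrow> (\<And>i. i \<in> A \<Longrightarrow> u i \<in> DC) \<Longrightarrow> (\<lambda>x. \<Sum>i\<in>A. u i x) \<in> DC"
  by (induction A rule: finite_induct) (auto simp: DC_zero intro!: DC_add)

lemma DC_F: "u \<in> DC \<Longrightarrow> j \<in> I \<Longrightarrow> u \<circ> F j \<in> DC"
  using D_F(1)[of "\<lambda>x. Re (u x)" j] D_F(1)[of "\<lambda>x. Im (u x)" j] by (simp add: dom_energy_def o_def)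

lemma DC_glue: "(\<And>j. j \<in> I \<Longrightarrow> u \<circ> F j \<in> DC) \<Longrightarrow> u \<in> DC"
  using D_glue[of "\<lambda>x. Re (u x)"] D_glue[of "\<lambda>x. Im (u x)"] by (simp add: dom_energy_def o_def)

lemma
  assumes "u \<in> DC" "v \<in> DC"
  shows energy_complex: "energy S u v =
      of_real (energy S (\<lambda>x. Re (u x)) (\<lambda>x. Re (v x)) - energy S (\<lambda>x. Im (u x)) (\<lambda>x. Im (v x)))
      + \<i> * of_real (energy S (\<lambda>x. Re (u x)) (\<lambda>x. Im (v x)) + energy S (\<lambda>x. Im (u x)) (\<lambda>x. Re (v x)))"
      (is "_ = ?R")
    and DC_tendsto: "(\<lambda>m. energy_level S m u v) \<longlonglongrightarrow> energy S u v"
proof -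
  have lim: "(\<lambda>m. energy_level S m u v) \<longlonglongrightarrow> ?R"
    unfolding energy_level_complex[of _ u v]
    by (intro tendsto_add tendsto_mult tendsto_diff tendsto_of_real tendsto_const D_tendsto DC_parts assms)
  then show "energy S u v = ?R" unfolding energy_def by (rule limI)
  then show "(\<lambda>m. energy_level S m u v) \<longlonglongrightarrow> energy S u v" using lim by simp
qed

lemma energy_sym: "energy S u v = energy S v u"
  unfolding energy_def by (subst energy_level_sym) (rule refl)

lemma energy_add:
  assumes "u \<in> DC" "v \<in> DC" "w \<in> DC"
  shows "energy S (\<lambda>x. u x + v x) w = energy S u w + energy S v w"
  by (rule LIMSEQ_unique[OF DC_tendsto[OF DC_add[OF assms(1,2)] assms(3)]])
    (unfold energy_level_add, intro tendsto_add DC_tendsto assms)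

lemma energy_scale:
  assumes "u \<in> DC" "w \<in> DC"
  shows "energy S (\<lambda>x. c * u x) w = c * energy S u w"
  by (rule LIMSEQ_unique[OF DC_tendsto[OF DC_scale[OF assms(1)] assms(2)]])
    (unfold energy_level_scale, intro tendsto_mult tendsto_const DC_tendsto assms)

lemma energy_cnj:
  assumes "u \<in> DC" "v \<in> DC"
  shows "energy S (\<lambda>x. cnj (u x)) (\<lambda>x. cnj (v x)) = cnj (energy S u v)"
proof (rule LIMSEQ_unique[OF DC_tendsto[OF DC_cnj[OF assms(1)] DC_cnj[OF assms(2)]]])
  have "energy_level S m (\<lambda>x. cnj (u x)) (\<lambda>x. cnj (v x)) = cnj (energy_level S m u v)" for m
    by (simp add: energy_level_def energy0_def)
  then show "(\<lambda>m. energy_level S m (\<lambda>x. cnj (u x)) (\<lambda>x. cnj (v x))) \<longlonglongrightarrow> cnj (energy S u v)"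
    using DC_tendsto[OF assms] by (simp add: tendsto_cnj)
qed

lemma energy_self:
  assumes "u \<in> DC"
  shows "Re (energy S u (\<lambda>x. cnj (u x))) =
    energy S (\<lambda>x. Re (u x)) (\<lambda>x. Re (u x)) + energy S (\<lambda>x. Im (u x)) (\<lambda>x. Im (u x))"
proof -
  have "(\<lambda>m. energy_level S m (\<lambda>x. Im (u x)) (\<lambda>x. - Im (u x))) \<longlonglongrightarrow> energy S (\<lambda>x. Im (u x)) (\<lambda>x. - Im (u x))"
    using D_tendsto[OF DC_parts(2)[OF assms] DC_parts(2)[OF DC_cnj[OF assms]]] by simp
  moreover have "energy_level S m (\<lambda>x. Im (u x)) (\<lambda>x. - Im (u x)) = - energy_level S m (\<lambda>x. Im (u x)) (\<lambda>x. Im (u x))" for m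
    using energy_level_scale[of m "-1" "\<lambda>x. Im (u x)" "\<lambda>x. Im (u x)"]
      energy_level_sym[of m "\<lambda>x. Im (u x)" "\<lambda>x. - Im (u x)"] by simp
  moreover have "(\<lambda>m. - energy_level S m (\<lambda>x. Im (u x)) (\<lambda>x. Im (u x))) \<longlonglongrightarrow> - energy S (\<lambda>x. Im (u x)) (\<lambda>x. Im (u x))"
    by (intro tendsto_minus D_tendsto DC_parts assms)
  ultimately have "energy S (\<lambda>x. Im (u x)) (\<lambda>x. - Im (u x)) = - energy S (\<lambda>x. Im (u x)) (\<lambda>x. Im (u x))"
    using LIMSEQ_unique by auto
  then show ?thesis unfolding energy_complex[OF assms DC_cnj[OF assms]] by simp
qed

lemma energy_glue:
  assumes "u \<in> DC" "v \<in> DC"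
  shows "energy S u v = (\<Sum>j\<in>I. of_real (inverse (r j)) * energy S (u \<circ> F j) (v \<circ> F j))"
  by (rule LIMSEQ_unique[OF LIMSEQ_Suc[OF DC_tendsto[OF assms]]])
    (unfold energy_level_Suc, intro tendsto_sum tendsto_mult tendsto_const DC_tendsto DC_F assms)

lemma energy_cong:
  assumes "\<And>x. x \<in> X \<Longrightarrow> u x = u' x" "\<And>x. x \<in> X \<Longrightarrow> v x = v' x"
  shows "energy S u v = energy S u' v'"
  unfolding energy_def
  using energy_level_cong[of _ u u' v v'] assms subsetD[OF level_vertices_subset] by simp

lemma D_cong: "u \<in> D \<Longrightarrow> (\<And>x. x \<in> X \<Longrightarrow> u x = u' x) \<Longrightarrow> u' \<in> D"
proof -
  assume u: "u \<in> D" and eq: "\<And>x. x \<in> X \<Longrightarrow> u x = u' x"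
  have "continuous_on X u'" using D_continuous[OF u] eq by (rule continuous_on_eq)
  moreover have "energy_level S m u' u' = energy_level S m u u" for m
    using eq[symmetric] subsetD[OF level_vertices_subset] by (intro energy_level_cong) auto
  ultimately show ?thesis using u by (simp add: dom_energy_real_def)
qed

lemma DC_cong: "u \<in> DC \<Longrightarrow> (\<And>x. x \<in> X \<Longrightarrow> u x = u' x) \<Longrightarrow> u' \<in> DC"
  using D_cong[of "\<lambda>x. Re (u x)" "\<lambda>x. Re (u' x)"] D_cong[of "\<lambda>x. Im (u x)" "\<lambda>x. Im (u' x)"]
  by (simp add: dom_energy_def)


subsection \<open>The boundary is not empty\<close>

text \<open>
  Otherwise the energy vanishes on all continuous functions, and closedness makes every indicator
  function continuous up to a null set.  The cells \<open>F\<^sub>1\<^sup>n(F\<^sub>2(X))\<close> with \<open>n\<close> even contradict this.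
\<close>

lemma V0_nonempty: "V0 \<noteq> {}"
proof
  assume empty: "V0 = {}"
  define bm where "bm f \<longleftrightarrow> f \<in> borel_measurable M \<and> (\<exists>b. \<forall>x\<in>X. \<bar>f x\<bar> \<le> b)" for f :: "'a \<Rightarrow> real"
  define sq where "sq f g = (\<integral>x. (f x - g x)\<^sup>2 \<partial>M)" for f g :: "'a \<Rightarrow> real"
  have int: "integrable M (\<lambda>x. (f x - g x)\<^sup>2)" if f: "bm f" and g: "bm g" for f g
  proof -
    obtain a b where ab: "\<And>x. x \<in> X \<Longrightarrow> \<bar>f x\<bar> \<le> a" "\<And>x. x \<in> X \<Longrightarrow> \<bar>g x\<bar> \<le> b"
      using f g unfolding bm_def by blast
    have "\<bar>f x - g x\<bar>\<^sup>2 \<le> (a + b)\<^sup>2" if "x \<in> X" for x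
      using ab[OF that] by (intro power_mono) auto
    then show ?thesis using f g unfolding bm_def
      by (intro integrable_const_bound[of _ "(a + b)\<^sup>2"] AE_I2) (auto simp: space_M)
  qed
  have sq_triangle: "sq f h \<le> 2 * sq f g + 2 * sq g h" if "bm f" "bm g" "bm h" for f g h
  proof -
    have "sq f h \<le> (\<integral>x. 2 * (f x - g x)\<^sup>2 + 2 * (g x - h x)\<^sup>2 \<partial>M)"
      unfolding sq_def
    proof (intro integral_mono int Bochner_Integration.integrable_add integrable_mult_right that)
      fix x
      have "0 \<le> ((f x - g x) - (g x - h x))\<^sup>2" by simp
      then show "(f x - h x)\<^sup>2 \<le> 2 * (f x - g x)\<^sup>2 + 2 * (g x - h x)\<^sup>2"
        by (simp add: power2_eq_square algebra_simps)
    qed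
    then show ?thesis using int that by (simp add: sq_def)
  qed
  have zero: "energy_level S m u v = 0" for m and u v :: "'a \<Rightarrow> real"
    by (simp add: energy_level_def energy0_def empty)
  have D: "u \<in> D \<longleftrightarrow> continuous_on X u" for u
    by (simp add: dom_energy_real_def zero convergent_const)
  have Ezero: "energy S u v = 0" for u v :: "'a \<Rightarrow> real"
    by (simp add: energy_def zero)
  have D_bm: "bm u" if "u \<in> D" for u
    unfolding bm_def using continuous_measurable continuous_bounded that unfolding D
    by (metis real_norm_def)
  \<comment> \<open>As the energy vanishes, functions of \<open>D\<close> that approximate the
    indicator in \<open>L\<^sup>2\<close> form a Cauchy sequence for the form norm. Its limit in
    \<open>D\<close> is continuous and equals the indicator almost everywhere.\<close>
  have indicator_continuous: "\<exists>u :: 'a \<Rightarrow> real. continuous_on X u \<and> (AE x in M. indicator A x = u x)" if A: "A \<in> sets M" for A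
  proof -
    define f :: "'a \<Rightarrow> real" where "f = indicator A"
    have f: "bm f" using A unfolding bm_def f_def by (auto intro!: exI[of _ 1] simp: indicator_def)
    have "f \<in> L2_functions S"
      using int[OF f D_bm[OF D_zero]] f by (simp add: L2_functions_def bm_def)
    then have "\<exists>u\<in>D. sq f u < e" if "e > 0" for e
      using dirichlet that unfolding dirichlet_form_def sq_def by blast
    then have "\<forall>n. \<exists>u\<in>D. sq f u < 1 / real (Suc n)" by simp
    then obtain U where U: "\<And>n. U n \<in> D" and fU: "\<And>n. sq f (U n) < 1 / real (Suc n)" by metis
    have commute: "sq g h = sq h g" for g h by (simp add: sq_def power2_commute)
    have UU: "sq (U m) (U n) \<le> 2 / real (Suc m) + 2 / real (Suc n)" for m n
      using sq_triangle[OF D_bm[OF U[of m]] f D_bm[OF U[of n]]] fU[of m] fU[of n] commute[of f "U m"] by simp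
    have "\<exists>N::nat. \<forall>m\<ge>N. \<forall>n\<ge>N.
        energy S (\<lambda>x. U m x - U n x) (\<lambda>x. U m x - U n x) + (\<integral>x. (U m x - U n x)\<^sup>2 \<partial>M) < e" if "e > 0" for e
    proof -
      have "0 < e / 4" using that by simp
      then obtain N where N: "1 / real (Suc N) < e / 4" by (rule nat_approx_posE)
      have "sq (U m) (U n) < e" if "N \<le> m" "N \<le> n" for m n
      proof -
        have "2 / real (Suc m) \<le> 2 * (1 / real (Suc N))" "2 / real (Suc n) \<le> 2 * (1 / real (Suc N))"
          using that by (auto intro!: divide_left_mono)
        then show ?thesis using UU[of m n] N by linarith
      qed
      then show ?thesis unfolding Ezero sq_def[symmetric] by (intro exI[of _ N]) auto
    qed
    then have "\<exists>u\<in>D. (\<lambda>n. energy S (\<lambda>x. U n x - u x) (\<lambda>x. U n x - u x) + (\<integral>x. (U n x - u x)\<^sup>2 \<partial>M)) \<longlonglongrightarrow> 0"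
      using dirichlet U unfolding dirichlet_form_def by blast
    then obtain u where u: "u \<in> D" "(\<lambda>n. sq (U n) u) \<longlonglongrightarrow> 0"
      unfolding Ezero sq_def[symmetric] by auto
    have "sq f u \<le> 0"
    proof (rule LIMSEQ_le_const)
      have "(\<lambda>n. 2 * (1 / real (Suc n)) + 2 * sq (U n) u) \<longlonglongrightarrow> 2 * 0 + 2 * 0"
        by (intro tendsto_add tendsto_mult tendsto_const u(2) LIMSEQ_Suc lim_1_over_n)
      then show "(\<lambda>n. 2 * (1 / real (Suc n)) + 2 * sq (U n) u) \<longlonglongrightarrow> 0" by simp
      have "sq f u \<le> 2 * (1 / real (Suc n)) + 2 * sq (U n) u" for n
        using sq_triangle[OF f D_bm[OF U[of n]] D_bm[OF u(1)]] fU[of n] by simp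
      then show "\<exists>N. \<forall>n\<ge>N. sq f u \<le> 2 * (1 / real (Suc n)) + 2 * sq (U n) u" by blast
    qed
    then have "sq f u = 0" unfolding sq_def by (intro antisym integral_nonneg) auto
    then have "AE x in M. (f x - u x)\<^sup>2 = 0"
      unfolding sq_def using int[OF f D_bm[OF u(1)]] by (subst (asm) integral_nonneg_eq_0_iff_AE) auto
    then show ?thesis using u(1) unfolding D f_def by auto
  qed
  \<comment> \<open>Weights below 1 with sum 1 need at least two maps.\<close>
  have two: "1 \<in> I" "2 \<in> I"
  proof -
    have "nmaps S \<noteq> 0" using sum_mwt by (intro notI) simp
    moreover have "nmaps S \<noteq> 1" using sum_mwt mwt_less_1 by (intro notI) simp
    ultimately show "1 \<in> I" "2 \<in> I" by auto
  qed
  define w where "w n = replicate n 1 @ [2::nat]" for n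
  have w: "w n \<in> words S" for n using two by (auto simp: w_def words_def)
  have w_Suc: "cell S (w (Suc n)) = F 1 ` cell S (w n)" for n by (simp add: w_def cell_Cons)
  have disj: "cell S (w m) \<inter> cell S (w n) = {}" if "m < n" for m n
    using that
  proof (induction m arbitrary: n)
    case 0
    then obtain k where k: "n = Suc k" using less_imp_Suc_add by blast
    have "F 2 x \<noteq> F 1 y" if "x \<in> X" "y \<in> X" for x y
      using F_overlap(1)[OF two(2,1) _ that] empty by auto
    then have "F 2 ` X \<inter> F 1 ` cell S (w k) = {}" using cell_subset[OF w, of k] by blast
    then show ?case unfolding k w_Suc by (simp add: w_def cell_single)
  next
    case (Suc m)
    then obtain k where k: "n = Suc k" "m < k" by (cases n) auto
    show ?case using Suc.IH[OF k(2)] F_inj[OF two(1)] unfolding k(1) w_Suc by (auto simp: disjoint_iff)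
  qed
  define A where "A = (\<Union>k. cell S (w (2 * k)))"
  have "A \<in> sets M" unfolding A_def using w by (auto intro!: sets.countable_UN cell_in_sets)
  from indicator_continuous[OF this]
  obtain u :: "'a \<Rightarrow> real" where u: "continuous_on X u" "AE x in M. indicator A x = u x"
    by blast
  have A_iff: "x \<in> A \<longleftrightarrow> even n" if "x \<in> cell S (w n)" for x n
  proof
    assume "x \<in> A"
    then obtain k where "x \<in> cell S (w (2 * k))" by (auto simp: A_def)
    then have "n = 2 * k" using disj that by (meson disjoint_iff linorder_neqE_nat)
    then show "even n" by simp
  qed (use that in \<open>auto simp: A_def elim!: evenE\<close>)
  \<comment> \<open>All cells have positive measure, so an identity that holds almost everywhere
    holds somewhere in each of them.\<close>
  have "\<exists>x\<in>cell S (w n). indicator A x = u x" for n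
  proof (rule ccontr)
    assume neg: "\<not> (\<exists>x\<in>cell S (w n). indicator A x = u x)"
    have "AE x in M. x \<notin> cell S (w n)" using u(2) by eventually_elim (use neg in auto)
    then have "emeasure M (cell S (w n)) = 0"
      using cell_in_sets[OF w] by (simp add: AE_iff_null_sets[symmetric] null_setsD1)
    then show False using measure_cell_pos[OF w[of n]] by (simp add: measure_def)
  qed
  then obtain x where x: "\<And>n. x n \<in> cell S (w n)" "\<And>n. indicator A (x n) = u (x n)" by metis
  have x_dist: "\<bar>u (x n) - u (x (Suc n))\<bar> = 1" for n
    using A_iff[OF x(1)[of n]] A_iff[OF x(1)[of "Suc n"]]
    by (cases "even n") (simp_all add: x(2)[symmetric] indicator_def)
  have "uniformly_continuous_on X u" using u(1) X_compact by (rule compact_uniformly_continuous)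
  then obtain d where d: "d > 0" "\<And>a b. a \<in> X \<Longrightarrow> b \<in> X \<Longrightarrow> dist a b < d \<Longrightarrow> dist (u a) (u b) < 1"
    unfolding uniformly_continuous_on_def by (metis zero_less_one)
  obtain L where L: "0 < L" "L < 1" "\<And>j x y. j \<in> I \<Longrightarrow> dist (F j x) (F j y) \<le> L * dist x y"
    using F_contraction by blast
  obtain B where B: "\<And>x y. x \<in> X \<Longrightarrow> y \<in> X \<Longrightarrow> dist x y \<le> B"
    using compact_imp_bounded[OF X_compact] unfolding bounded_two_points by blast
  have "(\<lambda>n. L ^ n * B) \<longlonglongrightarrow> 0"
    using L by (intro tendsto_mult_left_zero LIMSEQ_power_zero) auto
  then have "\<forall>\<^sub>F n in sequentially. L ^ n * B < d" using d(1) by (rule order_tendstoD(2))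
  then obtain n where n: "L ^ n * B < d" by (auto simp: eventually_sequentially)
  have ones: "replicate n 1 \<in> words S" using two by (auto simp: words_def)
  \<comment> \<open>Both \<open>w n\<close> and \<open>w (Suc n)\<close> begin with \<open>n\<close>
    letters 1, so \<open>x n\<close> and \<open>x (Suc n)\<close> lie in one cell of diameter at
    most \<open>L ^ n * B\<close>, although the values of \<open>u\<close> there differ by
    1.\<close>
  have mem: "\<exists>a\<in>X. x k = word_map S (replicate n 1) a" if k: "k = n \<or> k = Suc n" for k
  proof -
    have split: "w k = replicate n 1 @ (if k = n then [2] else [1, 2])"
      using k by (auto simp: w_def replicate_append_same simp flip: replicate_Suc)
    obtain z where z: "z \<in> X" "x k = word_map S (w k) z" using x(1)[of k] by (auto simp: cell_def)
    define v where "v = (if k = n then [2] else [1, 2::nat])"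
    have "v \<in> words S" using two by (auto simp: v_def words_def)
    then have "word_map S v z \<in> X" using z(1) by (rule word_map_in_X)
    then show ?thesis using z(2) unfolding split v_def[symmetric] word_map_append by blast
  qed
  obtain a b where ab: "a \<in> X" "b \<in> X" "x n = word_map S (replicate n 1) a" "x (Suc n) = word_map S (replicate n 1) b"
    using mem by blast
  have "dist (x n) (x (Suc n)) \<le> L ^ n * dist a b"
    using word_map_contraction[OF L(3) L(1) ones, of a b] ab by simp
  also have "\<dots> \<le> L ^ n * B" using B[OF ab(1,2)] L(1) by (intro mult_left_mono) auto
  finally have "dist (x n) (x (Suc n)) < d" using n by simp
  then have "dist (u (x n)) (u (x (Suc n))) < 1"
    using d(2) ab word_map_in_X[OF ones] by metis
  then show False using x_dist[of n] by (simp add: dist_real_def)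
qed

lemma closure_all_vertices: "closure (all_vertices S) = X"
proof
  show "closure (all_vertices S) \<subseteq> X"
    using all_vertices_subset compact_imp_closed[OF X_compact] by (rule closure_minimal)
qed (rule all_vertices_dense[OF V0_nonempty])

subsection \<open>Harmonic extension\<close>

definition min_ext :: "('a \<Rightarrow> real) \<Rightarrow> 'a \<Rightarrow> real" where
  "min_ext b = (SOME v. (\<forall>q\<in>V0. v q = b q) \<and> energy_level S 1 v v = energy0 S b b)"

lemma min_ext_boundary: "q \<in> V0 \<Longrightarrow> min_ext b q = b q"
  and min_ext_energy: "energy_level S 1 (min_ext b) (min_ext b) = energy0 S b b"
  using someI_ex[OF energy0_extend[of b]] unfolding min_ext_def[symmetric] by blast+

text \<open>\<open>hval w b\<close> is the restriction to the cell of \<open>w\<close> of the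
  harmonic extension of \<open>b\<close>, as a function on \<open>V0\<close> in local coordinates.
  The minimizing extension is repeated letter by letter, the outermost letter first.\<close>

primrec hval :: "nat list \<Rightarrow> ('a \<Rightarrow> real) \<Rightarrow> 'a \<Rightarrow> real" where
  "hval [] = (\<lambda>b. b)"
| "hval (j # w) = (\<lambda>b. hval w (min_ext b \<circ> F j))"

text \<open>By \<open>F_boundary\<close> every letter of \<open>w\<close> fixes a point that ends up
  in the boundary, and \<open>min_ext\<close> keeps boundary values.\<close>

lemma hval_boundary:
  "w \<in> words S \<Longrightarrow> q \<in> V0 \<Longrightarrow> word_map S w q \<in> V0 \<Longrightarrow> hval w b q = b (word_map S w q)"
proof (induction w arbitrary: b)
  case (Cons j w)
  then have w: "w \<in> words S" "j \<in> I" by (auto simp: words_def)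
  have "word_map S w q \<in> X" using w Cons.prems V0_subset word_map_in_X by blast
  then have fixed: "F j (word_map S w q) = word_map S w q"
    using F_boundary[OF w(2)] Cons.prems(3) by simp
  then have "word_map S w q \<in> V0" using Cons.prems(3) by simp
  then show ?case using Cons.IH[OF w(1) Cons.prems(2)] fixed by (simp add: min_ext_boundary)
qed simp

text \<open>A vertex has many representations by words of various lengths, and the values must not
  depend on them. Where two words first differ, the point lies in two 1-cells, so the remaining
  parts give boundary points in local coordinates and \<open>hval_boundary\<close> applies.\<close>

lemma hval_unique:
  "w \<in> words S \<Longrightarrow> w' \<in> words S \<Longrightarrow> q \<in> V0 \<Longrightarrow> q' \<in> V0 \<Longrightarrow>
    word_map S w q = word_map S w' q' \<Longrightarrow> hval w b q = hval w' b q'"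
proof (induction w arbitrary: w' b)
  case Nil
  then show ?case using hval_boundary[of w' q' b] by simp
next
  case (Cons j w)
  then have w: "w \<in> words S" "j \<in> I" by (auto simp: words_def)
  show ?case
  proof (cases w')
    case Nil
    then show ?thesis using hval_boundary[of "j # w" q b] Cons.prems by simp
  next
    case (Cons i v)
    have v: "v \<in> words S" "i \<in> I" using Cons \<open>w' \<in> words S\<close> by (auto simp: words_def)
    define y z where "y = word_map S w q" and "z = word_map S v q'"
    have yz: "y \<in> X" "z \<in> X" "F j y = F i z"
      using w v Cons Cons.prems V0_subset word_map_in_X by (auto simp: y_def z_def)
    show ?thesis
    proof (cases "i = j")
      case True
      then have "word_map S w q = word_map S v q'" using yz F_inj[OF w(2)] by (simp add: y_def z_def)
      then show ?thesis using Cons.IH[OF w(1) v(1) Cons.prems(3,4)] True Cons by simp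
    next
      case False
      then have "y \<in> V0" "z \<in> V0" using F_overlap[OF w(2) v(2) _ yz] by auto
      then have "hval w (min_ext b \<circ> F j) q = min_ext b (F j y)" "hval v (min_ext b \<circ> F i) q' = min_ext b (F i z)"
        using hval_boundary[OF w(1) Cons.prems(3)] hval_boundary[OF v(1) Cons.prems(4)]
        by (simp_all add: y_def z_def)
      then show ?thesis using yz(3) Cons by simp
    qed
  qed
qed

text \<open>In each cell the passage from \<open>V0\<close> to the next level by
  \<open>min_ext\<close> turns \<open>E\<^sub>0\<close> into an equal \<open>E\<^sub>1\<close>, so
  no level adds energy. Off the vertices the values are arbitrary.\<close>

lemma harmonic_on_vertices:
  fixes b :: "'a \<Rightarrow> real"
  obtains h where "\<And>q. q \<in> V0 \<Longrightarrow> h q = b q" "\<And>m. energy_level S m h h = energy0 S b b"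
proof -
  have "\<exists>c. \<forall>w\<in>words S. \<forall>q\<in>V0. x = word_map S w q \<longrightarrow> c = hval w b q" for x
    using hval_unique by metis
  then obtain h where h: "\<And>w q. w \<in> words S \<Longrightarrow> q \<in> V0 \<Longrightarrow> h (word_map S w q) = hval w b q" by metis
  have "(\<forall>w\<in>W m. \<forall>q\<in>V0. h (word_map S w q) = hval w b q) \<Longrightarrow> energy_level S m h h = energy0 S b b" for m h b
  proof (induction m arbitrary: h b)
    case 0
    then have "energy_level S 0 h h = energy_level S 0 b b"
      by (intro energy_level_cong) (auto simp: words_of_length_0 level_vertices_0)
    then show ?case by (simp add: energy_level_0)
  next
    case (Suc m)
    have "energy_level S m (h \<circ> F j) (h \<circ> F j) = energy0 S (min_ext b \<circ> F j) (min_ext b \<circ> F j)" if j: "j \<in> I" for j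
    proof (rule Suc.IH, intro ballI)
      fix w q assume "w \<in> W m" "q \<in> V0"
      then show "(h \<circ> F j) (word_map S w q) = hval w (min_ext b \<circ> F j) q"
        using bspec[OF bspec[OF Suc.prems], of "j # w" q] j by (simp add: Cons_in_words_iff)
    qed
    then have "energy_level S (Suc m) h h = energy_level S (Suc 0) (min_ext b) (min_ext b)"
      unfolding energy_level_Suc by (simp add: energy_level_0)
    then show ?case using min_ext_energy by simp
  qed
  then have "energy_level S m h h = energy0 S b b" for m
    using h words_of_length_imp_word by blast
  moreover have "h q = b q" if "q \<in> V0" for q using h[of "[]" q] that by (simp add: words_def)
  ultimately show thesis using that by blast
qed

subsection \<open>Oscillation of functions of finite energy\<close>

text \<open>Connectedness of the network on \<open>V0\<close> is assumed only through functions on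
  all vertices; the harmonic extension of \<open>b\<close> is such a function, with energy 0 on
  every level.\<close>

lemma energy0_zero_constant:
  assumes "energy0 S (b :: 'a \<Rightarrow> real) b = 0"
  shows "\<exists>k. \<forall>q\<in>V0. b q = k"
proof -
  obtain h where h: "\<And>q. q \<in> V0 \<Longrightarrow> h q = b q" "\<And>m. energy_level S m h h = energy0 S b b"
    using harmonic_on_vertices by blast
  then have "\<exists>k. \<forall>x\<in>all_vertices S. h x = k"
    using assms by (intro zero_energy_constant) simp
  then show ?thesis using h(1) V0_subset_all by (metis subsetD)
qed

lemma level_vertices_1: "level_vertices S 1 = (\<Union>j\<in>I. F j ` V0)"
  unfolding One_nat_def level_vertices_Suc level_vertices_0 by (rule refl)

lemma energy_level_1: "energy_level S 1 u v = (\<Sum>j\<in>I. of_real (inverse (r j)) * energy0 S (u \<circ> F j) (v \<circ> F j))"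
  unfolding One_nat_def energy_level_Suc energy_level_0 by (rule refl)

text \<open>Zero energy makes \<open>u\<close> constant on the vertices of each 1-cell. Spreading
  these constants over the whole cells gives a function with zero energy on every level, so the
  constants of different cells agree.\<close>

lemma energy_level_1_zero_constant:
  assumes "energy_level S 1 (u :: 'a \<Rightarrow> real) u = 0"
  shows "\<exists>k. \<forall>x\<in>level_vertices S 1. u x = k"
proof -
  have "\<forall>j\<in>I. inverse (r j) * energy0 S (u \<circ> F j) (u \<circ> F j) = 0"
    using assms unfolding energy_level_1
    by (subst (asm) sum_nonneg_eq_0_iff) (auto intro!: mult_nonneg_nonneg energy0_nonneg less_imp_le[OF r_pos])
  then have "\<forall>j\<in>I. energy0 S (u \<circ> F j) (u \<circ> F j) = 0" using r_pos by fastforce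
  then have "\<forall>j\<in>I. \<exists>k. \<forall>q\<in>V0. (u \<circ> F j) q = k" using energy0_zero_constant by blast
  then obtain k where k: "\<And>j q. j \<in> I \<Longrightarrow> q \<in> V0 \<Longrightarrow> u (F j q) = k j" unfolding o_def by metis
  have "\<exists>h :: 'a \<Rightarrow> real. (\<forall>j\<in>I. \<forall>x\<in>X. h (F j x) = k j) \<and> (\<forall>x. x \<notin> X \<longrightarrow> h x = 0)"
    by (rule glue_exists) (metis k)
  then obtain h where "\<forall>j\<in>I. \<forall>x\<in>X. h (F j x) = k j" by blast
  then have h: "\<And>j x. j \<in> I \<Longrightarrow> x \<in> X \<Longrightarrow> h (F j x) = k j" by blast
  have const: "energy_level S m (\<lambda>x. c) (\<lambda>x. c) = 0" for m and c :: real
    by (simp add: energy_level_def energy0_def o_def)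
  have Suc0: "energy_level S (Suc m) h h = 0" for m
  proof -
    have "energy_level S m (h \<circ> F j) (h \<circ> F j) = energy_level S m (\<lambda>x. k j) (\<lambda>x. k j)" if "j \<in> I" for j
      using h[OF that] subsetD[OF level_vertices_subset] by (intro energy_level_cong) auto
    then show ?thesis unfolding energy_level_Suc const by simp
  qed
  have "energy_level S m h h = 0" for m
    using energy_level_mono_Suc[of m h] energy_level_nonneg[of m h] Suc0[of m] by simp
  then obtain c where c: "\<And>x. x \<in> all_vertices S \<Longrightarrow> h x = c"
    using zero_energy_constant[of h] by auto
  have "u x = c" if "x \<in> level_vertices S 1" for x
  proof -
    obtain j q where jq: "j \<in> I" "q \<in> V0" "x = F j q"
      using \<open>x \<in> level_vertices S 1\<close> unfolding level_vertices_1 by blast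
    have "u x = k j" using k jq by simp
    also have "\<dots> = h x" using h jq V0_subset by auto
    also have "\<dots> = c" using c that level_vertices_subset_all by blast
    finally show ?thesis .
  qed
  then show ?thesis by blast
qed

text \<open>A Poincare inequality for the finite network on \<open>V\<^sub>1\<close>: each edge of
  positive conductance controls one difference, and differences add up along paths. The network is
  connected because the indicator function of a component has energy 0.\<close>

lemma level_1_oscillation:
  obtains C where "C > 0"
    "\<And>u x y. x \<in> level_vertices S 1 \<Longrightarrow> y \<in> level_vertices S 1 \<Longrightarrow>
       (u x - u y)\<^sup>2 \<le> C * energy_level S 1 (u :: 'a \<Rightarrow> real) u"
proof -
  define R where "R = {(x, y). \<exists>j\<in>I. \<exists>p\<in>V0. \<exists>q\<in>V0. x = F j p \<and> y = F j q \<and> 0 < conduct S p q}"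
  have edge: "\<exists>C\<ge>0. \<forall>u :: 'a \<Rightarrow> real. (u x - u y)\<^sup>2 \<le> C * energy_level S 1 u u" if xy: "(x, y) \<in> R" for x y
  proof -
    obtain j p q where jpq: "j \<in> I" "p \<in> V0" "q \<in> V0" "x = F j p" "y = F j q" "0 < conduct S p q"
      using xy unfolding R_def by blast
    define c where "c = conduct S p q"
    have nn: "0 \<le> conduct S a b * (t * t)" if "a \<in> V0" "b \<in> V0" for a b t
      using conduct_nonneg[OF that] by (intro mult_nonneg_nonneg zero_le_square)
    \<comment> \<open>The edge is one summand of a double sum of nonnegative terms; the 2
      compensates the factor 1/2 in \<open>energy0\<close>, and \<open>r j\<close> comes from
      passing to the cell.\<close>
    have "(u x - u y)\<^sup>2 \<le> 2 * r j / c * energy_level S 1 u u" for u :: "'a \<Rightarrow> real"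
    proof -
      have "c * ((u x - u y) * (u x - u y)) \<le> (\<Sum>b\<in>V0. conduct S p b * ((u (F j p) - u (F j b)) * (u (F j p) - u (F j b))))"
        using jpq finite_V0 nn member_le_sum[of q V0 "\<lambda>b. conduct S p b * ((u (F j p) - u (F j b)) * (u (F j p) - u (F j b)))"]
        by (simp add: c_def)
      also have "\<dots> \<le> (\<Sum>a\<in>V0. \<Sum>b\<in>V0. conduct S a b * ((u (F j a) - u (F j b)) * (u (F j a) - u (F j b))))"
        using jpq finite_V0 nn by (intro member_le_sum[of p V0 "\<lambda>a. \<Sum>b\<in>V0. conduct S a b * ((u (F j a) - u (F j b)) * (u (F j a) - u (F j b)))"] sum_nonneg) auto
      also have "\<dots> = 2 * energy0 S (u \<circ> F j) (u \<circ> F j)" by (simp add: energy0_def mult.assoc)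
      finally have 1: "c * (u x - u y)\<^sup>2 \<le> 2 * energy0 S (u \<circ> F j) (u \<circ> F j)" by (simp add: power2_eq_square)
      have "energy0 S (u \<circ> F j) (u \<circ> F j) \<le> r j * energy_level S 1 u u"
        using energy_level_F[OF jpq(1), of 0 u] by (simp add: energy_level_0)
      then show ?thesis using 1 jpq(6) by (simp add: c_def field_simps)
    qed
    then show ?thesis using jpq(1,6) r_pos[of j] by (intro exI[of _ "2 * r j / c"]) (auto simp: c_def)
  qed
  have path: "\<exists>C\<ge>0. \<forall>u :: 'a \<Rightarrow> real. (u x - u y)\<^sup>2 \<le> C * energy_level S 1 u u" if "(x, y) \<in> R\<^sup>*" for x y
    using that
  proof (induction rule: rtrancl_induct)
    case base
    show ?case by (intro exI[of _ 0]) simp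
  next
    case (step y z)
    from step.IH edge[OF step.hyps(2)] obtain C C' where
      C: "C \<ge> 0" "C' \<ge> 0" "\<And>u :: 'a \<Rightarrow> real. (u x - u y)\<^sup>2 \<le> C * energy_level S 1 u u"
      "\<And>u :: 'a \<Rightarrow> real. (u y - u z)\<^sup>2 \<le> C' * energy_level S 1 u u" by blast
    have "(u x - u z)\<^sup>2 \<le> (2 * C + 2 * C') * energy_level S 1 u u" for u :: "'a \<Rightarrow> real"
    proof -
      have "0 \<le> ((u x - u y) - (u y - u z))\<^sup>2" by simp
      then have "(u x - u z)\<^sup>2 \<le> 2 * (u x - u y)\<^sup>2 + 2 * (u y - u z)\<^sup>2"
        by (simp add: power2_eq_square algebra_simps)
      then show ?thesis using C(3,4)[of u] by (simp add: algebra_simps)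
    qed
    then show ?case using C(1,2) by (intro exI[of _ "2 * C + 2 * C'"]) auto
  qed
  have sym: "(y, x) \<in> R" if "(x, y) \<in> R" for x y
    using that conduct_sym unfolding R_def by fastforce
  have conn: "(x, y) \<in> R\<^sup>*" if "x \<in> level_vertices S 1" "y \<in> level_vertices S 1" for x y
  proof -
    define u :: "'a \<Rightarrow> real" where "u z = (if (x, z) \<in> R\<^sup>* then 1 else 0)" for z
    have eq: "u z = u z'" if "(z, z') \<in> R" for z z'
      using that sym[OF that] unfolding u_def by (auto intro: rtrancl_into_rtrancl)
    have "energy0 S (u \<circ> F j) (u \<circ> F j) = 0" if j: "j \<in> I" for j
    proof -
      have z: "conduct S a b * (u (F j a) - u (F j b)) * (u (F j a) - u (F j b)) = 0" if "a \<in> V0" "b \<in> V0" for a b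
      proof (cases "conduct S a b = 0")
        case False
        then have "0 < conduct S a b" using conduct_nonneg[OF that] by simp
        then have "(F j a, F j b) \<in> R" using that j unfolding R_def by blast
        then show ?thesis using eq by simp
      qed simp
      have "(\<Sum>a\<in>V0. \<Sum>b\<in>V0. conduct S a b * (u (F j a) - u (F j b)) * (u (F j a) - u (F j b))) = 0"
        by (intro sum.neutral ballI z)
      then show ?thesis unfolding energy0_def o_def by simp
    qed
    then have "energy_level S 1 u u = 0" unfolding energy_level_1 by simp
    then obtain k where "\<And>z. z \<in> level_vertices S 1 \<Longrightarrow> u z = k" using energy_level_1_zero_constant by blast
    then have "u y = u x" using that by simp
    then show ?thesis by (simp add: u_def split: if_splits)
  qed
  have "\<exists>C. \<forall>p\<in>level_vertices S 1 \<times> level_vertices S 1. 0 \<le> C p \<and>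
      (\<forall>u :: 'a \<Rightarrow> real. (u (fst p) - u (snd p))\<^sup>2 \<le> C p * energy_level S 1 u u)"
    using path conn by (intro bchoice) auto
  then obtain C where "\<forall>p\<in>level_vertices S 1 \<times> level_vertices S 1. 0 \<le> C p \<and>
      (\<forall>u :: 'a \<Rightarrow> real. (u (fst p) - u (snd p))\<^sup>2 \<le> C p * energy_level S 1 u u)" by (elim exE)
  then have C: "\<And>p. p \<in> level_vertices S 1 \<times> level_vertices S 1 \<Longrightarrow> 0 \<le> C p"
    "\<And>p u. p \<in> level_vertices S 1 \<times> level_vertices S 1 \<Longrightarrow>
      (u (fst p) - u (snd p))\<^sup>2 \<le> C p * energy_level S 1 (u :: 'a \<Rightarrow> real) u" by blast+
  define C0 where "C0 = (\<Sum>p\<in>level_vertices S 1 \<times> level_vertices S 1. C p) + 1"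
  have fin: "finite (level_vertices S 1 \<times> level_vertices S 1)" using finite_level_vertices by blast
  show thesis
  proof (rule that)
    have "0 \<le> (\<Sum>p\<in>level_vertices S 1 \<times> level_vertices S 1. C p)" using C(1) by (rule sum_nonneg)
    then show "C0 > 0" by (simp add: C0_def)
    fix u :: "'a \<Rightarrow> real" and x y assume xy: "x \<in> level_vertices S 1" "y \<in> level_vertices S 1"
    have "C (x, y) \<le> (\<Sum>p\<in>level_vertices S 1 \<times> level_vertices S 1. C p)"
      using xy fin C(1) by (intro member_le_sum) auto
    then have "C (x, y) * energy_level S 1 u u \<le> C0 * energy_level S 1 u u"
      by (intro mult_right_mono energy_level_nonneg) (simp add: C0_def)
    then show "(u x - u y)\<^sup>2 \<le> C0 * energy_level S 1 u u"
      using C(2)[of "(x, y)" u] xy by simp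
  qed
qed

text \<open>The vertices have finite diameter in the resistance metric. A vertex of level
  \<open>n\<close> is joined to \<open>q\<close> through nested cells; each passage to a cell
  multiplies the energy bound by at most \<open>rmax\<close>, so the differences are dominated by a
  geometric series of ratio \<open>s = sqrt rmax\<close>. Its sum \<open>A\<close> solves
  \<open>A = sqrt C + s * A\<close>, which closes the induction over \<open>n\<close>.\<close>

lemma vertices_oscillation:
  obtains R where "R > 0"
    "\<And>u e x y. (\<And>m. energy_level S m (u :: 'a \<Rightarrow> real) u \<le> e) \<Longrightarrow>
       x \<in> all_vertices S \<Longrightarrow> y \<in> all_vertices S \<Longrightarrow> (u x - u y)\<^sup>2 \<le> R * e"
proof -
  obtain C where C: "C > 0" "\<And>u x y. x \<in> level_vertices S 1 \<Longrightarrow> y \<in> level_vertices S 1 \<Longrightarrow>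
       (u x - u y)\<^sup>2 \<le> C * energy_level S 1 (u :: 'a \<Rightarrow> real) u" using level_1_oscillation by blast
  define s where "s = sqrt rmax"
  have s: "0 < s" "s < 1" using rmax_pos rmax_less_1 by (auto simp: s_def)
  define A where "A = sqrt C / (1 - s)"
  have A: "A > 0" "A = sqrt C + s * A" using s C(1) by (auto simp: A_def field_simps)
  have osc1: "\<bar>u x - u y\<bar> \<le> sqrt C * sqrt e"
    if "\<And>m. energy_level S m u u \<le> e" "x \<in> level_vertices S 1" "y \<in> level_vertices S 1"
    for u :: "'a \<Rightarrow> real" and e x y
  proof -
    have "(u x - u y)\<^sup>2 \<le> C * e" using C(2)[OF that(2,3), of u] C(1) that(1)[of 1]
      by (meson less_imp_le mult_left_mono order_trans)
    then show ?thesis using real_sqrt_le_mono by (fastforce simp: real_sqrt_mult)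
  qed
  have main: "\<bar>u x - u q\<bar> \<le> A * sqrt e"
    if "\<And>m. energy_level S m u u \<le> e" "x \<in> level_vertices S n" "q \<in> V0" for u :: "'a \<Rightarrow> real" and e x q n
    using that
  proof (induction n arbitrary: u e x)
    case 0
    have e: "0 \<le> e" using 0(1)[of 0] energy_level_nonneg[of 0 u] by simp
    have "\<bar>u x - u q\<bar> \<le> sqrt C * sqrt e"
      using 0 V0_subset_level by (intro osc1) (auto simp: level_vertices_0)
    also have "\<dots> \<le> A * sqrt e"
      using A(2) mult_pos_pos[OF s(1) A(1)] e by (intro mult_right_mono) auto
    finally show ?case .
  next
    case (Suc n)
    have e: "0 \<le> e" using Suc.prems(1)[of 0] energy_level_nonneg[of 0 u] by simp
    obtain j y where jy: "j \<in> I" "y \<in> level_vertices S n" "x = F j y"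
      using Suc.prems(2) by (auto simp: level_vertices_Suc)
    have "energy_level S m (u \<circ> F j) (u \<circ> F j) \<le> rmax * e" for m
    proof -
      have "energy_level S m (u \<circ> F j) (u \<circ> F j) \<le> r j * energy_level S (Suc m) u u"
        by (rule energy_level_F[OF jy(1)])
      also have "\<dots> \<le> rmax * e" using Suc.prems(1)[of "Suc m"] r_le_rmax[OF jy(1)] r_pos[OF jy(1)] energy_level_nonneg[of "Suc m" u]
        by (intro mult_mono) auto
      finally show ?thesis .
    qed
    from Suc.IH[OF this jy(2) Suc.prems(3)]
    have 1: "\<bar>u (F j y) - u (F j q)\<bar> \<le> A * sqrt (rmax * e)" by simp
    have "F j q \<in> level_vertices S 1" "q \<in> level_vertices S 1"
      using jy(1) Suc.prems(3) V0_subset_level[of 1] unfolding level_vertices_1 by blast+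
    then have "\<bar>u (F j q) - u q\<bar> \<le> sqrt C * sqrt e" using Suc.prems(1) by (intro osc1)
    then have "\<bar>u x - u q\<bar> \<le> (sqrt C + s * A) * sqrt e"
      using 1 jy(3) by (simp add: s_def real_sqrt_mult algebra_simps)
    then show ?case using A(2) by simp
  qed
  show thesis
  proof (rule that)
    show "(2 * A)\<^sup>2 > 0" using A by simp
    fix u :: "'a \<Rightarrow> real" and e x y
    assume u: "\<And>m. energy_level S m u u \<le> e" and xy: "x \<in> all_vertices S" "y \<in> all_vertices S"
    have e: "0 \<le> e" using u[of 0] energy_level_nonneg[of 0 u] by simp
    obtain q where q: "q \<in> V0" using V0_nonempty by blast
    have "\<bar>u x - u q\<bar> \<le> A * sqrt e" "\<bar>u y - u q\<bar> \<le> A * sqrt e"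
      using xy main[OF u _ q] by (auto simp: all_vertices_def)
    then have "\<bar>u x - u y\<bar> \<le> 2 * A * sqrt e" by simp
    then have "\<bar>u x - u y\<bar>\<^sup>2 \<le> (2 * A * sqrt e)\<^sup>2" by (intro power_mono) auto
    then show "(u x - u y)\<^sup>2 \<le> (2 * A)\<^sup>2 * e" using e by (simp add: power_mult_distrib)
  qed
qed

text \<open>An upper bound for effective resistances between vertices. The condition is on the
  energies of all levels instead of \<open>u \<in> D\<close>, because it also serves for functions
  on the vertices that are not yet known to be continuous.\<close>

definition res :: real where
  "res = (SOME R. R > 0 \<and> (\<forall>u e x y. (\<forall>m. energy_level S m (u :: 'a \<Rightarrow> real) u \<le> e) \<longrightarrow>
       x \<in> all_vertices S \<longrightarrow> y \<in> all_vertices S \<longrightarrow> (u x - u y)\<^sup>2 \<le> R * e))"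

lemma res_pos: "res > 0"
  and res_vertices: "(\<And>m. energy_level S m (u :: 'a \<Rightarrow> real) u \<le> e) \<Longrightarrow>
       x \<in> all_vertices S \<Longrightarrow> y \<in> all_vertices S \<Longrightarrow> (u x - u y)\<^sup>2 \<le> res * e"
proof -
  have "\<exists>R. R > 0 \<and> (\<forall>u e x y. (\<forall>m. energy_level S m (u :: 'a \<Rightarrow> real) u \<le> e) \<longrightarrow>
       x \<in> all_vertices S \<longrightarrow> y \<in> all_vertices S \<longrightarrow> (u x - u y)\<^sup>2 \<le> R * e)"
    by (rule vertices_oscillation) blast
  from someI_ex[OF this, folded res_def]
  show "res > 0" "(\<And>m. energy_level S m (u :: 'a \<Rightarrow> real) u \<le> e) \<Longrightarrow>
       x \<in> all_vertices S \<Longrightarrow> y \<in> all_vertices S \<Longrightarrow> (u x - u y)\<^sup>2 \<le> res * e" by blast+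
qed

lemma energy_level_word:
  "w \<in> words S \<Longrightarrow> (\<And>m. energy_level S m (u :: 'a \<Rightarrow> real) u \<le> e) \<Longrightarrow>
    energy_level S m (u \<circ> word_map S w) (u \<circ> word_map S w) \<le> word_r S w * e"
proof (induction w arbitrary: u e m)
  case Nil
  then show ?case by (simp add: word_r_Nil)
next
  case (Cons j w)
  then have w: "w \<in> words S" "j \<in> I" by (auto simp: words_def)
  have "energy_level S m (u \<circ> F j) (u \<circ> F j) \<le> r j * e" for m
    using energy_level_F[OF w(2), of m u] Cons.prems(2)[of "Suc m"] r_pos[OF w(2)]
    by (meson less_imp_le mult_left_mono order_trans)
  from Cons.IH[OF w(1) this] show ?case by (simp add: word_r_Cons o_assoc mult_ac)
qed

lemma D_oscillation:
  assumes u: "u \<in> D" and x: "x \<in> X" and y: "y \<in> X"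
  shows "(u x - u y)\<^sup>2 \<le> res * energy S u u"
proof -
  have c: "continuous_on (closure (all_vertices S)) u" using D_continuous[OF u] closure_all_vertices by simp
  have 1: "norm (u a - u b) \<le> sqrt (res * energy S u u)" if "a \<in> all_vertices S" "b \<in> all_vertices S" for a b
    using res_vertices[OF energy_level_le[OF u] that] by (intro real_le_rsqrt) simp
  have 2: "norm (u a - u y) \<le> sqrt (res * energy S u u)" if "a \<in> all_vertices S" for a
    using 1[OF that] c y closure_all_vertices
    by (intro continuous_on_closure_norm_le[of "all_vertices S" "\<lambda>y. u a - u y"]) (auto intro!: continuous_intros)
  have "norm (u x - u y) \<le> sqrt (res * energy S u u)"
    using 2 c x closure_all_vertices
    by (intro continuous_on_closure_norm_le[of "all_vertices S" "\<lambda>x. u x - u y"]) (auto intro!: continuous_intros)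
  then have "\<bar>u x - u y\<bar>\<^sup>2 \<le> (sqrt (res * energy S u u))\<^sup>2" by (intro power_mono) auto
  then show ?thesis using res_pos energy_nonneg[OF u] by simp
qed

lemma D_word:
  assumes u: "u \<in> D" and w: "w \<in> words S"
  shows "u \<circ> word_map S w \<in> D" "energy S (u \<circ> word_map S w) (u \<circ> word_map S w) \<le> word_r S w * energy S u u"
proof -
  have c: "continuous_on X (u \<circ> word_map S w)"
    using word_map_continuous[OF w] D_continuous[OF u] word_map_in_X[OF w]
    by (intro continuous_on_compose) (auto elim!: continuous_on_subset)
  from D_I[OF c energy_level_word[OF w energy_level_le[OF u]]]
  show "u \<circ> word_map S w \<in> D" "energy S (u \<circ> word_map S w) (u \<circ> word_map S w) \<le> word_r S w * energy S u u" .
qed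

section \<open>Equicontinuity and extension from the vertices\<close>

lemma word_r_mult_le: "w \<in> W m \<Longrightarrow> 0 \<le> e \<Longrightarrow> res * (word_r S w * e) \<le> res * rmax ^ m * e"
  using word_r_le[of w m] res_pos by (simp add: mult.assoc mult_left_mono mult_right_mono)

text \<open>Nearby points lie in the same or in touching \<open>m\<close>-cells, and different
  touching cells share a point that is a boundary point in both local coordinates. The set
  \<open>A\<close> will be \<open>X\<close> for functions in \<open>D\<close> and
  \<open>all_vertices S\<close> for functions known only on the vertices, whence the closure
  condition on it.\<close>

lemma equicontinuity_from_cells:
  assumes "0 < \<epsilon>" and A: "V0 \<subseteq> A" "A \<subseteq> X"
    "\<And>w x. w \<in> words S \<Longrightarrow> x \<in> X \<Longrightarrow> word_map S w x \<in> A \<Longrightarrow> x \<in> A"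
  obtains d where "d > 0"
    "\<And>u e x y. 0 \<le> e \<Longrightarrow>
      (\<And>m w a b. w \<in> W m \<Longrightarrow> a \<in> A \<Longrightarrow> b \<in> A \<Longrightarrow>
        (u (word_map S w a) - u (word_map S w b))\<^sup>2 \<le> res * rmax ^ m * e) \<Longrightarrow>
      x \<in> A \<Longrightarrow> y \<in> A \<Longrightarrow> dist x y < d \<Longrightarrow> (u x - u y :: real)\<^sup>2 \<le> \<epsilon> * e"
proof -
  \<comment> \<open>The 4 accounts for the detour through the common point: two differences,
    combined by \<open>(a + b)\<^sup>2 \<le> 2 a\<^sup>2 + 2 b\<^sup>2\<close>.\<close>
  have "(\<lambda>m. 4 * (res * rmax ^ m)) \<longlonglongrightarrow> 4 * (res * 0)"
    using rmax_pos rmax_less_1 by (intro tendsto_mult tendsto_const LIMSEQ_power_zero) auto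
  then have "\<forall>\<^sub>F m in sequentially. 4 * (res * rmax ^ m) < \<epsilon>"
    using assms(1) by (intro order_tendstoD(2)) auto
  then obtain m where m: "4 * (res * rmax ^ m) < \<epsilon>" by (auto simp: eventually_sequentially)
  obtain d where d: "d > 0" "\<And>x y. x \<in> X \<Longrightarrow> y \<in> X \<Longrightarrow> dist x y < d \<Longrightarrow>
      \<exists>w\<in>W m. \<exists>w'\<in>W m. x \<in> cell S w \<and> y \<in> cell S w' \<and> cell S w \<inter> cell S w' \<noteq> {}"
    using close_points_in_touching_cells by blast
  show thesis
  proof (rule that[OF d(1)])
    fix u :: "'a \<Rightarrow> real" and e x y
    assume e: "0 \<le> e" and u: "\<And>m w a b. w \<in> W m \<Longrightarrow> a \<in> A \<Longrightarrow> b \<in> A \<Longrightarrow>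
        (u (word_map S w a) - u (word_map S w b))\<^sup>2 \<le> res * rmax ^ m * e"
      and xy: "x \<in> A" "y \<in> A" "dist x y < d"
    obtain w w' where w: "w \<in> W m" "w' \<in> W m" "x \<in> cell S w" "y \<in> cell S w'" "cell S w \<inter> cell S w' \<noteq> {}"
      using d(2)[of x y] xy A(2) by blast
    have ww: "w \<in> words S" "w' \<in> words S" using w by (auto simp: words_of_length_def)
    obtain a b c c' where abc: "a \<in> X" "b \<in> X" "c \<in> X" "c' \<in> X" "x = word_map S w a" "y = word_map S w' b"
      "word_map S w c = word_map S w' c'" using w(3-5) unfolding cell_def by blast
    have ab: "a \<in> A" "b \<in> A" using A(3)[OF ww(1) abc(1)] A(3)[OF ww(2) abc(2)] abc xy by auto
    have "(u x - u y)\<^sup>2 \<le> 4 * (res * rmax ^ m) * e"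
    proof (cases "w = w'")
      case True
      have "(u x - u y)\<^sup>2 \<le> res * rmax ^ m * e" using u[OF w(1) ab] abc True by simp
      also have "\<dots> \<le> 4 * (res * rmax ^ m) * e" using e res_pos rmax_pos by simp
      finally show ?thesis .
    next
      case False
      then have "c \<in> A" "c' \<in> A" using word_overlap[OF w(1,2) False abc(3,4,7)] A(1) by auto
      define z where "z = word_map S w c"
      have "(u x - u z)\<^sup>2 \<le> res * rmax ^ m * e" "(u z - u y)\<^sup>2 \<le> res * rmax ^ m * e"
        using u[OF w(1) ab(1) \<open>c \<in> A\<close>] u[OF w(2) \<open>c' \<in> A\<close> ab(2)] abc by (simp_all add: z_def)
      moreover have "0 \<le> ((u x - u z) - (u z - u y))\<^sup>2" by simp
      then have "(u x - u y)\<^sup>2 \<le> 2 * (u x - u z)\<^sup>2 + 2 * (u z - u y)\<^sup>2"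
        by (simp add: power2_eq_square algebra_simps)
      ultimately show ?thesis by simp
    qed
    also have "\<dots> \<le> \<epsilon> * e" using m e by (intro mult_right_mono) auto
    finally show "(u x - u y)\<^sup>2 \<le> \<epsilon> * e" .
  qed
qed

lemma D_equicontinuous:
  assumes "0 < \<epsilon>"
  obtains d where "d > 0"
    "\<And>u x y. u \<in> D \<Longrightarrow> x \<in> X \<Longrightarrow> y \<in> X \<Longrightarrow> dist x y < d \<Longrightarrow> (u x - u y)\<^sup>2 \<le> \<epsilon> * energy S u u"
proof -
  obtain d where d: "d > 0"
    "\<And>u e x y. 0 \<le> e \<Longrightarrow>
      (\<And>m w a b. w \<in> W m \<Longrightarrow> a \<in> X \<Longrightarrow> b \<in> X \<Longrightarrow>
        (u (word_map S w a) - u (word_map S w b))\<^sup>2 \<le> res * rmax ^ m * e) \<Longrightarrow>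
      x \<in> X \<Longrightarrow> y \<in> X \<Longrightarrow> dist x y < d \<Longrightarrow> (u x - u y :: real)\<^sup>2 \<le> \<epsilon> * e"
    using equicontinuity_from_cells[OF assms V0_subset subset_refl] by blast
  show thesis
  proof (rule that[OF d(1)])
    fix u x y assume u: "u \<in> D" and xy: "x \<in> X" "y \<in> X" "dist x y < d"
    show "(u x - u y)\<^sup>2 \<le> \<epsilon> * energy S u u"
    proof (rule d(2)[OF energy_nonneg[OF u] _ xy])
      fix m w a b assume w: "w \<in> W m" and ab: "a \<in> X" "b \<in> X"
      have ww: "w \<in> words S" using w by (simp add: words_of_length_def)
      have "(u (word_map S w a) - u (word_map S w b))\<^sup>2 \<le> res * energy S (u \<circ> word_map S w) (u \<circ> word_map S w)"
        using D_oscillation[OF D_word(1)[OF u ww] ab] by simp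
      also have "\<dots> \<le> res * (word_r S w * energy S u u)"
        using D_word(2)[OF u ww] res_pos by simp
      also have "\<dots> \<le> res * rmax ^ m * energy S u u" by (rule word_r_mult_le[OF w energy_nonneg[OF u]])
      finally show "(u (word_map S w a) - u (word_map S w b))\<^sup>2 \<le> res * rmax ^ m * energy S u u" .
    qed
  qed
qed

text \<open>Bounded level energies force uniform continuity on the vertices, which are dense in
  \<open>X\<close>. This supplies the continuity that membership in \<open>D\<close>
  demands.\<close>

lemma extend_from_vertices:
  assumes u: "\<And>m. energy_level S m u u \<le> e"
  obtains v where "v \<in> D" "\<And>x. x \<in> all_vertices S \<Longrightarrow> v x = u x"
proof -
  have e: "0 \<le> e" using u[of 0] energy_level_nonneg[of 0 u] by simp
  have "uniformly_continuous_on (all_vertices S) u"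
    unfolding uniformly_continuous_on_def
  proof (intro allI impI)
    fix t :: real assume t: "0 < t"
    define \<epsilon> where "\<epsilon> = t\<^sup>2 / (2 * (e + 1))"
    have eps: "0 < \<epsilon>" using t e by (simp add: \<epsilon>_def)
    obtain d where d: "d > 0"
      "\<And>u e x y. 0 \<le> e \<Longrightarrow>
        (\<And>m w a b. w \<in> W m \<Longrightarrow> a \<in> all_vertices S \<Longrightarrow> b \<in> all_vertices S \<Longrightarrow>
          (u (word_map S w a) - u (word_map S w b))\<^sup>2 \<le> res * rmax ^ m * e) \<Longrightarrow>
        x \<in> all_vertices S \<Longrightarrow> y \<in> all_vertices S \<Longrightarrow> dist x y < d \<Longrightarrow> (u x - u y :: real)\<^sup>2 \<le> \<epsilon> * e"
      using equicontinuity_from_cells[OF eps V0_subset_all all_vertices_subset] all_vertices_word_map by blast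
    have cell: "(u (word_map S w a) - u (word_map S w b))\<^sup>2 \<le> res * rmax ^ m * e"
      if w: "w \<in> W m" and ab: "a \<in> all_vertices S" "b \<in> all_vertices S" for m w a b
    proof -
      have ww: "w \<in> words S" using w by (simp add: words_of_length_def)
      have "(u (word_map S w a) - u (word_map S w b))\<^sup>2 \<le> res * (word_r S w * e)"
        using res_vertices[OF energy_level_word[OF ww u] ab] by simp
      also have "\<dots> \<le> res * rmax ^ m * e" by (rule word_r_mult_le[OF w e])
      finally show ?thesis .
    qed
    show "\<exists>d>0. \<forall>x\<in>all_vertices S. \<forall>x'\<in>all_vertices S. dist x' x < d \<longrightarrow> dist (u x') (u x) < t"
    proof (intro exI[of _ d] conjI d(1) ballI impI)
      fix x y assume xy: "x \<in> all_vertices S" "y \<in> all_vertices S" "dist y x < d"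
      have "(u y - u x)\<^sup>2 \<le> \<epsilon> * e" using d(2)[of e u y x, OF e cell xy(2,1,3)] .
      also have "\<dots> < t\<^sup>2"
      proof -
        have "e < 2 * (e + 1)" "0 < t\<^sup>2" using e t by auto
        then have "t\<^sup>2 * e < t\<^sup>2 * (2 * (e + 1))" by (intro mult_strict_left_mono)
        then show ?thesis using e by (simp add: \<epsilon>_def field_simps)
      qed
      finally have "\<bar>u y - u x\<bar>\<^sup>2 < t\<^sup>2" by simp
      then have "\<bar>u y - u x\<bar> < t" by (rule power_less_imp_less_base) (use t in simp)
      then show "dist (u y) (u x) < t" by (simp add: dist_real_def)
    qed
  qed
  then obtain v where v: "uniformly_continuous_on (closure (all_vertices S)) v"
    "\<And>x. x \<in> all_vertices S \<Longrightarrow> u x = v x"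
    using uniformly_continuous_on_extension_on_closure by metis
  have c: "continuous_on X v"
    using uniformly_continuous_imp_continuous[OF v(1)] by (simp add: closure_all_vertices)
  have "energy_level S m v v = energy_level S m u u" for m
    using v(2) subsetD[OF level_vertices_subset_all] by (intro energy_level_cong) auto
  then have "v \<in> D" using D_I(1)[OF c, of e] u by simp
  then show thesis using that v(2) by metis
qed

lemma harmonic_function:
  obtains h where "h \<in> D" "\<And>q. q \<in> V0 \<Longrightarrow> h q = b q" "\<And>m. energy_level S m h h = energy0 S h h"
proof -
  obtain g where g: "\<And>q. q \<in> V0 \<Longrightarrow> g q = b q" "\<And>m. energy_level S m g g = energy0 S b b"
    using harmonic_on_vertices by blast
  obtain h where h: "h \<in> D" "\<And>x. x \<in> all_vertices S \<Longrightarrow> h x = g x"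
    using extend_from_vertices[of g "energy0 S b b"] g(2) by auto
  have eq: "energy_level S m h h = energy_level S m g g" for m
    using h(2) subsetD[OF level_vertices_subset_all] by (intro energy_level_cong) auto
  show thesis
  proof (rule that[OF h(1)])
    show "h q = b q" if "q \<in> V0" for q using that g(1) h(2) V0_subset_all by auto
    show "energy_level S m h h = energy0 S h h" for m
      using eq[of m] eq[of 0] g(2)[of m] g(2)[of 0] by (simp add: energy_level_0)
  qed
qed

text \<open>The nonnegative form \<open>E\<^sub>m - E\<^sub>0\<close> vanishes at \<open>h\<close>, hence \<open>h\<close> lies in its radical.\<close>

lemma harmonic_energy_level:
  assumes h: "\<And>m. energy_level S m h h = energy0 S h h"
  shows "energy_level S m u h = energy0 S (u :: 'a \<Rightarrow> real) h"
proof -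
  define a where "a = energy_level S m u u - energy_level S 0 u u"
  define b where "b = energy_level S m u h - energy_level S 0 u h"
  \<comment> \<open>The quadratic term in \<open>t\<close> drops out because \<open>h\<close> has
    the same energy on both levels, and an affine function of \<open>t\<close> that is nonnegative
    everywhere has slope 0.\<close>
  have pos: "0 \<le> a + 2 * t * b" for t
  proof -
    have ex: "energy_level S k (\<lambda>x. u x + t * h x) (\<lambda>x. u x + t * h x) =
        energy_level S k u u + 2 * t * energy_level S k u h + t\<^sup>2 * energy_level S k h h" for k
    proof -
      have l: "energy_level S k (\<lambda>x. u x + t * h x) w = energy_level S k u w + t * energy_level S k h w" for w
        by (simp add: energy_level_add energy_level_scale)
      show ?thesis
        unfolding l energy_level_sym[of k u "\<lambda>x. u x + t * h x"] energy_level_sym[of k h "\<lambda>x. u x + t * h x"]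
        by (simp add: energy_level_sym[of k h u] power2_eq_square algebra_simps)
    qed
    show ?thesis
      using energy_level_mono[of 0 m "\<lambda>x. u x + t * h x"] unfolding ex h
      by (simp add: a_def b_def algebra_simps)
  qed
  have "b = 0"
  proof (rule ccontr)
    assume "b \<noteq> 0"
    then have "2 * (- (a + 1) / (2 * b)) * b = - (a + 1)" by simp
    then show False using pos[of "- (a + 1) / (2 * b)"] by linarith
  qed
  then show ?thesis by (simp add: b_def energy_level_0)
qed


section \<open>Solvability of the Dirichlet problem\<close>

text \<open>\<open>Z 0\<close> is the space of test functions. The spaces with larger
  \<open>m\<close> have finite codimension in it and are those on which the term with \<kappa>
  becomes small.\<close>

definition Z :: "nat \<Rightarrow> ('a \<Rightarrow> complex) set" where
  "Z m = {u \<in> DC. \<forall>x\<in>level_vertices S m. u x = 0}"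

lemma dom0_eq: "dom0_energy S = Z 0"
  by (simp add: Z_def dom0_energy_def level_vertices_0)

lemma Z_DC: "u \<in> Z m \<Longrightarrow> u \<in> DC"
  by (simp add: Z_def)

lemma Z_vertex: "u \<in> Z m \<Longrightarrow> x \<in> level_vertices S m \<Longrightarrow> u x = 0"
  by (simp add: Z_def)

lemma Z_V0: "u \<in> Z m \<Longrightarrow> x \<in> V0 \<Longrightarrow> u x = 0"
  using Z_vertex V0_subset_level by blast

lemma Z_subset: "Z m \<subseteq> Z 0"
  using V0_subset_level by (auto simp: Z_def level_vertices_0)

lemma Z_0I: "u \<in> DC \<Longrightarrow> (\<And>x. x \<in> V0 \<Longrightarrow> u x = 0) \<Longrightarrow> u \<in> Z 0"
  by (simp add: Z_def level_vertices_0)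

text \<open>In the local coordinates of an \<open>m\<close>-cell that contains the point,
  \<open>u\<close> vanishes on the boundary and has at most \<open>rmax ^ m\<close> times its full
  energy, so the oscillation bound yields the factor.\<close>

lemma vanishing_bound:
  assumes u: "u \<in> D" "\<And>x. x \<in> level_vertices S m \<Longrightarrow> u x = 0" and x: "x \<in> X"
  shows "(u x)\<^sup>2 \<le> res * rmax ^ m * energy S u u"
proof -
  obtain w a where w: "w \<in> W m" and a: "a \<in> X" "x = word_map S w a"
    using cells_cover[OF x, of m] unfolding cell_def by blast
  have ww: "w \<in> words S" using w by (rule words_of_length_imp_word)
  obtain q where q: "q \<in> V0" using V0_nonempty by blast
  then have "word_map S w q \<in> level_vertices S m" using w by (auto simp: level_vertices_def)
  then have "(u x)\<^sup>2 = ((u \<circ> word_map S w) a - (u \<circ> word_map S w) q)\<^sup>2" using u(2) a by simp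
  also have "\<dots> \<le> res * energy S (u \<circ> word_map S w) (u \<circ> word_map S w)"
    by (rule D_oscillation[OF D_word(1)[OF u(1) ww] a(1)]) (use q V0_subset in blast)
  also have "\<dots> \<le> res * (word_r S w * energy S u u)" using D_word(2)[OF u(1) ww] res_pos by simp
  also have "\<dots> \<le> res * rmax ^ m * energy S u u" by (rule word_r_mult_le[OF w energy_nonneg[OF u(1)]])
  finally show ?thesis .
qed

text \<open>The form is closed with respect to energy plus \<open>L\<^sup>2\<close> norm, and for
  functions vanishing on \<open>V0\<close> the energy alone controls the latter. Closedness says
  nothing about values of the limit, so convergence at the vertices has to be recovered from the two
  norms.\<close>

lemma D_complete:
  assumes U: "\<And>n. U n \<in> D" "\<And>n x. x \<in> level_vertices S m \<Longrightarrow> U n x = 0"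
    and C: "\<And>e. e > 0 \<Longrightarrow> \<exists>N::nat. \<forall>k\<ge>N. \<forall>n\<ge>N.
      energy S (\<lambda>x. U k x - U n x) (\<lambda>x. U k x - U n x) < e"
  shows "\<exists>u\<in>D. (\<forall>x\<in>level_vertices S m. u x = 0) \<and>
    (\<lambda>n. energy S (\<lambda>x. U n x - u x) (\<lambda>x. U n x - u x)) \<longlonglongrightarrow> 0"
proof -
  define E where "E u = energy S u u" for u :: "'a \<Rightarrow> real"
  define L where "L u = (\<integral>x. (u x)\<^sup>2 \<partial>M)" for u :: "'a \<Rightarrow> real"
  have sq_int: "integrable M (\<lambda>x. (u x)\<^sup>2)" if "u \<in> D" for u
    using D_continuous[OF that] by (intro continuous_integrable continuous_intros)
  have L0: "0 \<le> L u" for u by (simp add: L_def integral_nonneg)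
  have LE: "L (\<lambda>x. U k x - U n x) \<le> res * E (\<lambda>x. U k x - U n x)" for k n
  proof -
    have d: "(\<lambda>x. U k x - U n x) \<in> D" using U(1) by (intro D_diff)
    have v: "(U k x - U n x)\<^sup>2 \<le> res * E (\<lambda>x. U k x - U n x)" if x: "x \<in> X" for x
      using vanishing_bound[OF d _ x, of 0] U(2) V0_subset_level
      by (auto simp: level_vertices_0 E_def subset_iff)
    have "L (\<lambda>x. U k x - U n x) \<le> (\<integral>x. res * E (\<lambda>x. U k x - U n x) \<partial>M)"
      unfolding L_def using sq_int[OF d] v by (intro integral_mono) (auto simp: space_M)
    then show ?thesis by (simp add: prob_space)
  qed
  have "\<exists>N::nat. \<forall>k\<ge>N. \<forall>n\<ge>N. E (\<lambda>x. U k x - U n x) + L (\<lambda>x. U k x - U n x) < e" if e: "e > 0" for e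
  proof -
    have "e / (1 + res) > 0" using e res_pos by simp
    then obtain N where N: "\<And>k n. k \<ge> N \<Longrightarrow> n \<ge> N \<Longrightarrow> E (\<lambda>x. U k x - U n x) < e / (1 + res)"
      unfolding E_def using C by blast
    show ?thesis
    proof (intro exI allI impI)
      fix k n assume "k \<ge> N" "n \<ge> N"
      from N[OF this] have "(1 + res) * E (\<lambda>x. U k x - U n x) < e" using res_pos by (simp add: field_simps)
      then show "E (\<lambda>x. U k x - U n x) + L (\<lambda>x. U k x - U n x) < e"
        using LE[of k n] by (simp add: algebra_simps)
    qed
  qed
  then have "\<exists>u\<in>D. (\<lambda>n. E (\<lambda>x. U n x - u x) + L (\<lambda>x. U n x - u x)) \<longlonglongrightarrow> 0"
    using dirichlet U(1) unfolding dirichlet_form_def E_def L_def by blast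
  then obtain u where u: "u \<in> D" "(\<lambda>n. E (\<lambda>x. U n x - u x) + L (\<lambda>x. U n x - u x)) \<longlonglongrightarrow> 0" by blast
  have d: "(\<lambda>x. U n x - u x) \<in> D" for n using U(1) u(1) by (intro D_diff)
  have E0: "0 \<le> E (\<lambda>x. U n x - u x)" for n unfolding E_def by (rule energy_nonneg[OF d])
  have Elim: "(\<lambda>n. E (\<lambda>x. U n x - u x)) \<longlonglongrightarrow> 0"
    using E0 L0 by (intro tendsto_sandwich[OF _ _ tendsto_const u(2)] always_eventually) auto
  have Llim: "(\<lambda>n. L (\<lambda>x. U n x - u x)) \<longlonglongrightarrow> 0"
    using E0 L0 by (intro tendsto_sandwich[OF _ _ tendsto_const u(2)] always_eventually) auto
  \<comment> \<open>A value differs from every other value by at most the oscillation, so averaging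
    over \<open>y\<close> bounds it by the \<open>L\<^sup>2\<close> norm and the energy.\<close>
  have pt: "(U n x - u x)\<^sup>2 \<le> 2 * L (\<lambda>x. U n x - u x) + 2 * (res * E (\<lambda>x. U n x - u x))" if x: "x \<in> X" for n x
  proof -
    define v where "v = (\<lambda>x. U n x - u x)"
    have v: "v \<in> D" unfolding v_def by (rule d)
    have "(v x)\<^sup>2 \<le> 2 * (v y)\<^sup>2 + 2 * (res * E v)" if y: "y \<in> X" for y
    proof -
      have "0 \<le> (v y - (v x - v y))\<^sup>2" by simp
      then have "(v x)\<^sup>2 \<le> 2 * (v y)\<^sup>2 + 2 * (v x - v y)\<^sup>2" by (simp add: power2_eq_square algebra_simps)
      then show ?thesis using D_oscillation[OF v x y] by (simp add: E_def)
    qed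
    then have "(\<integral>y. (v x)\<^sup>2 \<partial>M) \<le> (\<integral>y. 2 * (v y)\<^sup>2 + 2 * (res * E v) \<partial>M)"
      using sq_int[OF v] by (intro integral_mono) (auto simp: space_M)
    then have "(v x)\<^sup>2 \<le> 2 * L v + 2 * (res * E v)" using sq_int[OF v] by (simp add: prob_space L_def)
    then show ?thesis by (simp add: v_def)
  qed
  have "u x = 0" if x: "x \<in> level_vertices S m" for x
  proof -
    have xX: "x \<in> X" using x level_vertices_subset by blast
    have "(\<lambda>n. 2 * L (\<lambda>x. U n x - u x) + 2 * (res * E (\<lambda>x. U n x - u x))) \<longlonglongrightarrow> 2 * 0 + 2 * (res * 0)"
      by (intro tendsto_add tendsto_mult tendsto_const Elim Llim)
    then have "(u x)\<^sup>2 \<le> 2 * 0 + 2 * (res * 0)"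
      using pt[OF xX] U(2)[OF x] by (intro LIMSEQ_le_const) auto
    then show ?thesis by simp
  qed
  then show ?thesis using u(1) Elim unfolding E_def by blast
qed

lemma Z_hilbert: "function_hilbert (Z m) (energy S)"
proof
  show "(\<lambda>x. 0) \<in> Z m" by (simp add: Z_def DC_zero)
  show "(\<lambda>x. u x + v x) \<in> Z m" if "u \<in> Z m" "v \<in> Z m" for u v using that by (simp add: Z_def DC_add)
  show "(\<lambda>x. c * u x) \<in> Z m" if "u \<in> Z m" for u c using that by (simp add: Z_def DC_scale)
  show "(\<lambda>x. cnj (u x)) \<in> Z m" if "u \<in> Z m" for u using that by (simp add: Z_def DC_cnj)
  show "energy S u v = energy S v u" for u v :: "'a \<Rightarrow> complex" by (rule energy_sym)
  show "energy S (\<lambda>x. u x + v x) w = energy S u w + energy S v w"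
    if "u \<in> Z m" "v \<in> Z m" "w \<in> Z m" for u v w using that by (intro energy_add Z_DC)
  show "energy S (\<lambda>x. c * u x) w = c * energy S u w" if "u \<in> Z m" "w \<in> Z m" for u w c
    using that by (intro energy_scale Z_DC)
  show "energy S (\<lambda>x. cnj (u x)) (\<lambda>x. cnj (v x)) = cnj (energy S u v)" if "u \<in> Z m" "v \<in> Z m" for u v
    using that by (intro energy_cnj Z_DC)
  show "0 \<le> Re (energy S u (\<lambda>x. cnj (u x)))" if "u \<in> Z m" for u
    unfolding energy_self[OF Z_DC[OF that]] by (intro add_nonneg_nonneg energy_nonneg DC_parts Z_DC[OF that])
next
  fix U :: "nat \<Rightarrow> 'a \<Rightarrow> complex"
  assume U: "\<And>n. U n \<in> Z m" and C: "\<And>e. 0 < e \<Longrightarrow> \<exists>N. \<forall>k\<ge>N. \<forall>n\<ge>N.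
      Re (energy S (\<lambda>x. U k x - U n x) (\<lambda>x. cnj (U k x - U n x))) < e"
  have split: "Re (energy S (\<lambda>x. u x - v x) (\<lambda>x. cnj (u x - v x))) =
      energy S (\<lambda>x. Re (u x) - Re (v x)) (\<lambda>x. Re (u x) - Re (v x)) +
      energy S (\<lambda>x. Im (u x) - Im (v x)) (\<lambda>x. Im (u x) - Im (v x))" if "u \<in> DC" "v \<in> DC" for u v
    using energy_self[OF DC_diff[OF that]] by simp
  have pos: "0 \<le> energy S (\<lambda>x. Re (u x) - Re (v x)) (\<lambda>x. Re (u x) - Re (v x))"
    "0 \<le> energy S (\<lambda>x. Im (u x) - Im (v x)) (\<lambda>x. Im (u x) - Im (v x))" if "u \<in> DC" "v \<in> DC" for u v
    using that by (auto intro!: energy_nonneg D_diff DC_parts)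
  have C': "\<exists>N. \<forall>k\<ge>N. \<forall>n\<ge>N. energy S (\<lambda>x. Re (U k x) - Re (U n x)) (\<lambda>x. Re (U k x) - Re (U n x)) < e \<and>
      energy S (\<lambda>x. Im (U k x) - Im (U n x)) (\<lambda>x. Im (U k x) - Im (U n x)) < e" if e: "e > 0" for e
  proof -
    obtain N where N: "\<And>k n. k \<ge> N \<Longrightarrow> n \<ge> N \<Longrightarrow>
        Re (energy S (\<lambda>x. U k x - U n x) (\<lambda>x. cnj (U k x - U n x))) < e" using C[OF e] by blast
    show ?thesis
    proof (intro exI[of _ N] allI impI)
      fix k n assume "k \<ge> N" "n \<ge> N"
      from N[OF this] show "energy S (\<lambda>x. Re (U k x) - Re (U n x)) (\<lambda>x. Re (U k x) - Re (U n x)) < e \<and>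
          energy S (\<lambda>x. Im (U k x) - Im (U n x)) (\<lambda>x. Im (U k x) - Im (U n x)) < e"
        unfolding split[OF Z_DC[OF U] Z_DC[OF U]]
        using pos[OF Z_DC[OF U[of k]] Z_DC[OF U[of n]]] by linarith
    qed
  qed
  have "\<exists>a\<in>D. (\<forall>x\<in>level_vertices S m. a x = 0) \<and>
      (\<lambda>n. energy S (\<lambda>x. Re (U n x) - a x) (\<lambda>x. Re (U n x) - a x)) \<longlonglongrightarrow> 0"
    using U C' by (intro D_complete) (auto simp: Z_def intro: DC_parts, blast)
  moreover have "\<exists>b\<in>D. (\<forall>x\<in>level_vertices S m. b x = 0) \<and>
      (\<lambda>n. energy S (\<lambda>x. Im (U n x) - b x) (\<lambda>x. Im (U n x) - b x)) \<longlonglongrightarrow> 0"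
    using U C' by (intro D_complete) (auto simp: Z_def intro: DC_parts, blast)
  ultimately obtain a b where ab: "a \<in> D" "b \<in> D" "\<And>x. x \<in> level_vertices S m \<Longrightarrow> a x = 0 \<and> b x = 0"
    "(\<lambda>n. energy S (\<lambda>x. Re (U n x) - a x) (\<lambda>x. Re (U n x) - a x)) \<longlonglongrightarrow> 0"
    "(\<lambda>n. energy S (\<lambda>x. Im (U n x) - b x) (\<lambda>x. Im (U n x) - b x)) \<longlonglongrightarrow> 0" by blast
  define u where "u x = Complex (a x) (b x)" for x
  have u: "u \<in> Z m" using ab(1-3) by (simp add: u_def Z_def dom_energy_def Complex_eq_0)
  have "(\<lambda>n. Re (energy S (\<lambda>x. U n x - u x) (\<lambda>x. cnj (U n x - u x)))) \<longlonglongrightarrow> 0"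
    unfolding split[OF Z_DC[OF U] Z_DC[OF u]] using tendsto_add[OF ab(4,5)] by (simp add: u_def)
  then show "\<exists>u\<in>Z m. (\<lambda>n. Re (energy S (\<lambda>x. U n x - u x) (\<lambda>x. cnj (U n x - u x)))) \<longlonglongrightarrow> 0"
    using u by blast
qed

sublocale Zm: function_hilbert "Z m" "energy S" for m
  by (rule Z_hilbert)

section \<open>The form of the equation and its small perturbations\<close>

abbreviation "nrm \<equiv> function_hilbert.nrm (energy S)"
abbreviation "nrm2 \<equiv> function_hilbert.nrm2 (energy S)"

lemma nrm2_parts:
  "u \<in> DC \<Longrightarrow> nrm2 u = energy S (\<lambda>x. Re (u x)) (\<lambda>x. Re (u x)) + energy S (\<lambda>x. Im (u x)) (\<lambda>x. Im (u x))"
  unfolding Zm.nrm2_def by (rule energy_self)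

lemma nrm_cong: "(\<And>x. x \<in> X \<Longrightarrow> u x = u' x) \<Longrightarrow> nrm u = nrm u'"
  unfolding Zm.nrm_def Zm.nrm2_def by (simp cong: energy_cong)

lemma Z_bound:
  assumes u: "u \<in> Z m" and x: "x \<in> X"
  shows "cmod (u x) \<le> sqrt (res * rmax ^ m) * nrm u"
proof -
  have "(Re (u x))\<^sup>2 \<le> res * rmax ^ m * energy S (\<lambda>x. Re (u x)) (\<lambda>x. Re (u x))"
    "(Im (u x))\<^sup>2 \<le> res * rmax ^ m * energy S (\<lambda>x. Im (u x)) (\<lambda>x. Im (u x))"
    using u DC_parts[OF Z_DC[OF u]] by (auto intro!: vanishing_bound[OF _ _ x] simp: Z_def)
  then have "(cmod (u x))\<^sup>2 \<le> res * rmax ^ m * nrm2 u"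
    unfolding nrm2_parts[OF Z_DC[OF u]] cmod_power2 by (simp add: algebra_simps)
  then show ?thesis unfolding Zm.nrm_def real_sqrt_mult[symmetric] by (simp add: real_le_rsqrt)
qed

lemma Z0_bound: "u \<in> Z 0 \<Longrightarrow> x \<in> X \<Longrightarrow> cmod (u x) \<le> sqrt res * nrm u"
  using Z_bound[of u 0 x] by simp

text \<open>The weak form of \<open>k - \<Delta>\<close>, symmetric and bilinear: for
  \<open>u\<close> of finite energy, \<open>A k u v = 0\<close> for all \<open>v \<in> Z 0\<close>
  means \<open>\<Delta>u = k u\<close>.\<close>

definition A :: "complex \<Rightarrow> ('a \<Rightarrow> complex) \<Rightarrow> ('a \<Rightarrow> complex) \<Rightarrow> complex" where
  "A k u v = energy S u v + k * (\<integral>x. u x * v x \<partial>M)"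

lemma DC_integrable: "u \<in> DC \<Longrightarrow> v \<in> DC \<Longrightarrow> integrable M (\<lambda>x. u x * v x)"
  by (intro continuous_integrable continuous_intros DC_continuous)

lemma A_sym: "A k u v = A k v u"
  unfolding A_def by (simp add: energy_sym[of u v] mult.commute)

lemma A_add: "u \<in> DC \<Longrightarrow> v \<in> DC \<Longrightarrow> w \<in> DC \<Longrightarrow> A k (\<lambda>x. u x + v x) w = A k u w + A k v w"
  unfolding A_def using DC_integrable[of u w] DC_integrable[of v w]
  by (simp add: energy_add ring_distribs)

lemma A_scale: "u \<in> DC \<Longrightarrow> w \<in> DC \<Longrightarrow> A k (\<lambda>x. c * u x) w = c * A k u w"
  unfolding A_def by (simp add: energy_scale mult.assoc algebra_simps)

lemma A_diff: "u \<in> DC \<Longrightarrow> v \<in> DC \<Longrightarrow> w \<in> DC \<Longrightarrow> A k (\<lambda>x. u x - v x) w = A k u w - A k v w"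
  using A_add[OF _ DC_scale[of v "-1"], of u w k] A_scale[of v w k "-1"] by simp

lemma A_zero: "w \<in> DC \<Longrightarrow> A k (\<lambda>x. 0) w = 0"
  using A_scale[OF DC_zero, of w k 0] by simp

lemma A_sum: "finite B \<Longrightarrow> (\<And>i. i \<in> B \<Longrightarrow> u i \<in> DC) \<Longrightarrow> w \<in> DC \<Longrightarrow>
    A k (\<lambda>x. \<Sum>i\<in>B. u i x) w = (\<Sum>i\<in>B. A k (u i) w)"
  by (induction B rule: finite_induct) (auto simp: A_zero A_add DC_sum)

lemma A_cong:
  assumes "\<And>x. x \<in> X \<Longrightarrow> u x = u' x" "\<And>x. x \<in> X \<Longrightarrow> v x = v' x"
  shows "A k u v = A k u' v'"
proof -
  have "(\<integral>x. u x * v x \<partial>M) = (\<integral>x. u' x * v' x \<partial>M)"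
    using assms by (intro Bochner_Integration.integral_cong) (auto simp: space_M)
  then show ?thesis unfolding A_def using energy_cong[of u u' v v', OF assms] by simp
qed

lemma integral_product_bound:
  assumes u: "u \<in> Z m" and v: "v \<in> Z m"
  shows "cmod (\<integral>x. u x * v x \<partial>M) \<le> res * rmax ^ m * (nrm u * nrm v)"
proof (rule integral_norm_le)
  show "(\<lambda>x. u x * v x) \<in> borel_measurable M"
    using u v by (intro borel_measurable_times continuous_measurable DC_continuous Z_DC)
  fix x assume x: "x \<in> X"
  have "cmod (u x * v x) \<le> (sqrt (res * rmax ^ m) * nrm u) * (sqrt (res * rmax ^ m) * nrm v)"
    unfolding norm_mult
    by (intro mult_mono Z_bound u v x norm_ge_zero order_trans[OF norm_ge_zero Z_bound[OF u x]])
  also have "\<dots> = res * rmax ^ m * (nrm u * nrm v)"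
    using res_pos rmax_pos by (simp add: algebra_simps flip: real_sqrt_mult power2_eq_square)
  finally show "cmod (u x * v x) \<le> res * rmax ^ m * (nrm u * nrm v)" .
qed

lemma functional_A:
  assumes u: "u \<in> Z 0"
  shows "Zm.functional m (A k u) ((1 + cmod k * res) * nrm u)"
  unfolding Zm.functional_def
proof (intro conjI ballI allI)
  fix v assume v: "v \<in> Z m"
  then have v0: "v \<in> Z 0" using Z_subset by blast
  have "cmod (A k u v) \<le> cmod (energy S u v) + cmod k * cmod (\<integral>x. u x * v x \<partial>M)"
    unfolding A_def norm_mult[symmetric] by (rule norm_triangle_ineq)
  also have "\<dots> \<le> nrm u * nrm v + cmod k * (res * (nrm u * nrm v))"
    using Zm.Cauchy_Schwarz[OF u v0] integral_product_bound[OF u v0] by (intro add_mono mult_left_mono) auto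
  finally show "cmod (A k u v) \<le> (1 + cmod k * res) * nrm u * nrm v" by (simp add: algebra_simps)
next
  fix v w assume "v \<in> Z m" "w \<in> Z m"
  then show "A k u (\<lambda>x. v x + w x) = A k u v + A k u w"
    using A_add[of v w u k] Z_DC u by (simp add: A_sym[of k u])
next
  fix c v assume "v \<in> Z m"
  then show "A k u (\<lambda>x. c * v x) = c * A k u v"
    using A_scale[of v u k c] Z_DC u by (simp add: A_sym[of k u])
qed

lemma functional_subset:
  "Zm.functional 0 l C \<Longrightarrow> Zm.functional m l C"
  using Z_subset unfolding Zm.functional_def by blast

text \<open>On \<open>Z m\<close> the sup bound turns the hypothesis on \<open>k\<close> into the
  factor 1/2 that \<open>perturbed_Riesz\<close> asks of the term
  \<open>k \<integral>u v\<close>.\<close>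

lemma solve_small:
  assumes k: "cmod k * (res * rmax ^ m) \<le> 1 / 2" and C: "0 \<le> C" and l: "Zm.functional m l C"
  obtains u where "u \<in> Z m" "nrm u \<le> 2 * C" "\<And>v. v \<in> Z m \<Longrightarrow> A k u v = l v"
proof -
  define b where "b u v = k * (\<integral>x. u x * v x \<partial>M)" for u v
  have b1: "Zm.functional m (b u) (nrm u / 2)" if u: "u \<in> Z m" for u
    unfolding Zm.functional_def
  proof (intro conjI ballI allI)
    fix v w assume v: "v \<in> Z m" and w: "w \<in> Z m"
    show "b u (\<lambda>x. v x + w x) = b u v + b u w"
      using DC_integrable[OF Z_DC[OF u] Z_DC[OF v]] DC_integrable[OF Z_DC[OF u] Z_DC[OF w]]
      by (simp add: b_def ring_distribs)
  next
    fix c v assume v: "v \<in> Z m"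
    show "b u (\<lambda>x. c * v x) = c * b u v" by (simp add: b_def mult.left_commute)
  next
    fix v assume v: "v \<in> Z m"
    have "cmod (b u v) \<le> cmod k * (res * rmax ^ m * (nrm u * nrm v))"
      unfolding b_def norm_mult by (intro mult_left_mono integral_product_bound u v) auto
    also have "\<dots> = (cmod k * (res * rmax ^ m)) * (nrm u * nrm v)" by simp
    also have "\<dots> \<le> 1 / 2 * (nrm u * nrm v)"
      using k Zm.nrm_nonneg[OF u] Zm.nrm_nonneg[OF v] by (intro mult_right_mono) auto
    finally show "cmod (b u v) \<le> nrm u / 2 * nrm v" by simp
  qed
  have b2: "b (\<lambda>x. u x - v x) w = b u w - b v w" if "u \<in> Z m" "v \<in> Z m" "w \<in> Z m" for u v w
    using DC_integrable[of u w] DC_integrable[of v w] that Z_DC by (simp add: b_def ring_distribs)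
  obtain u where "u \<in> Z m" "nrm u \<le> 2 * C" "\<And>v. v \<in> Z m \<Longrightarrow> energy S u v + b u v = l v"
    using Zm.perturbed_Riesz[OF C l b1 b2] by blast
  then show thesis using that by (simp add: A_def b_def)
qed

text \<open>Harmonic functions take arbitrary values on \<open>V0\<close>; gluing them level by
  level preserves finite energy and reaches the values on finer vertex sets.\<close>

lemma interpolation:
  fixes b :: "'a \<Rightarrow> complex"
  shows "\<exists>u\<in>DC. \<forall>x\<in>level_vertices S m. u x = b x"
proof (induction m arbitrary: b)
  case 0
  obtain h g where h: "h \<in> D" "\<And>q. q \<in> V0 \<Longrightarrow> h q = Re (b q)" and g: "g \<in> D" "\<And>q. q \<in> V0 \<Longrightarrow> g q = Im (b q)"
    using harmonic_function[of "\<lambda>x. Re (b x)"] harmonic_function[of "\<lambda>x. Im (b x)"] by metis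
  then show ?case
    by (intro bexI[of _ "\<lambda>x. Complex (h x) (g x)"]) (auto simp: dom_energy_def level_vertices_0 complex_eq_iff)
next
  case (Suc m)
  have "\<exists>u\<in>DC. \<forall>x\<in>level_vertices S m. u x = b (F j x)" for j by (rule Suc.IH)
  then obtain f where f: "\<And>j. f j \<in> DC" "\<And>j x. x \<in> level_vertices S m \<Longrightarrow> f j x = b (F j x)" by metis
  have "\<exists>u. (\<forall>j\<in>I. \<forall>x\<in>X. u (F j x) = f j x) \<and> (\<forall>x. x \<notin> X \<longrightarrow> u x = 0)"
    using f(2) subsetD[OF V0_subset_level] by (intro glue_exists) metis
  then obtain u where "\<forall>j\<in>I. \<forall>x\<in>X. u (F j x) = f j x" by blast
  then have u: "\<And>j x. j \<in> I \<Longrightarrow> x \<in> X \<Longrightarrow> u (F j x) = f j x" by blast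
  have "u \<in> DC"
  proof (rule DC_glue)
    fix j assume "j \<in> I"
    then show "u \<circ> F j \<in> DC" using DC_cong[OF f(1)[of j], of "u \<circ> F j"] u by simp
  qed
  moreover have "u x = b x" if "x \<in> level_vertices S (Suc m)" for x
    using that u f(2) level_vertices_subset unfolding level_vertices_Suc by (auto simp: subset_iff)
  ultimately show ?case by blast
qed

text \<open>The eigenvalue hypothesis enters here: \<open>k * u\<close> is continuous for every
  \<open>u\<close> of finite energy, so a weak solution is an eigenfunction in the sense of the
  definition unless it vanishes on \<open>X\<close>.\<close>

lemma not_eigenvalue_zero:
  assumes k: "\<not> dirichlet_eigenvalue S k" and u: "u \<in> Z 0" and z: "\<And>v. v \<in> Z 0 \<Longrightarrow> A k u v = 0"
    and x: "x \<in> X"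
  shows "u x = 0"
proof -
  have "energy S u v = - (\<integral>x. k * u x * v x \<partial>M)" if "v \<in> Z 0" for v
    using z[OF that] by (simp add: A_def eq_neg_iff_add_eq_0 mult.assoc)
  then have "has_laplacian S u (\<lambda>x. k * u x)"
    unfolding has_laplacian_def weak_laplacian_def dom0_eq
    using DC_continuous[OF Z_DC[OF u]] Z_DC[OF u] by (auto intro!: continuous_intros)
  moreover have "\<forall>q\<in>V0. u q = 0" using Z_V0[OF u] by blast
  ultimately show ?thesis using k x unfolding dirichlet_eigenvalue_def by blast
qed

lemma unique_solution:
  assumes k: "\<not> dirichlet_eigenvalue S k" and "u \<in> Z 0" "u' \<in> Z 0"
    and "\<And>v. v \<in> Z 0 \<Longrightarrow> A k u v = A k u' v" and x: "x \<in> X"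
  shows "u x = u' x"
proof -
  have "u x - u' x = 0"
  proof (rule not_eigenvalue_zero[OF k _ _ x])
    show "(\<lambda>x. u x - u' x) \<in> Z 0" using assms(2,3) by (rule Zm.diff)
    show "A k (\<lambda>x. u x - u' x) v = 0" if v: "v \<in> Z 0" for v
      using A_diff[OF Z_DC[OF assms(2)] Z_DC[OF assms(3)] Z_DC[OF v], of k] assms(4)[OF v] by simp
  qed
  then show ?thesis by simp
qed

text \<open>
  Functions vanishing on a fine vertex set form a subspace of finite codimension on which the
  equation is a small perturbation of Riesz' theorem; the rest is a finite linear system.
\<close>

theorem Fredholm:
  assumes k: "\<not> dirichlet_eigenvalue S k"
  shows "\<exists>K\<ge>0. \<forall>l C. 0 \<le> C \<longrightarrow> Zm.functional 0 l C \<longrightarrow>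
    (\<exists>u\<in>Z 0. nrm u \<le> K * C \<and> (\<forall>v\<in>Z 0. A k u v = l v))"
proof -
  have "(\<lambda>m. cmod k * (res * rmax ^ m)) \<longlonglongrightarrow> cmod k * (res * 0)"
    using rmax_pos rmax_less_1 by (intro tendsto_mult tendsto_const LIMSEQ_power_zero) auto
  then have "\<forall>\<^sub>F m in sequentially. cmod k * (res * rmax ^ m) < 1 / 2"
    by (rule order_tendstoD(2)) simp
  then obtain m where m: "cmod k * (res * rmax ^ m) \<le> 1 / 2"
    by (auto simp: eventually_sequentially intro: less_imp_le)
  define P where "P = level_vertices S m - V0"
  have finP: "finite P" using finite_level_vertices by (simp add: P_def)
  \<comment> \<open>A basis of a complement of \<open>Z m\<close> in \<open>Z 0\<close> that is
    orthogonal to \<open>Z m\<close> for \<open>A k\<close>: an interpolant is corrected by an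
    element of \<open>Z m\<close>. These functions belong to \<open>V\<^sub>m\<close> and differ
    from the \<open>psi\<close> of the theorem.\<close>
  have "\<exists>u. u \<in> Z 0 \<and> (\<forall>x\<in>level_vertices S m. u x = (if x = p then 1 else 0)) \<and> (\<forall>v\<in>Z m. A k u v = 0)"
    if p: "p \<in> P" for p
  proof -
    obtain e where e: "e \<in> DC" "\<And>x. x \<in> level_vertices S m \<Longrightarrow> e x = (if x = p then 1 else 0)"
      using interpolation[of m "\<lambda>x. if x = p then 1 else 0"] by blast
    have e0: "e \<in> Z 0" using e p subsetD[OF V0_subset_level] by (intro Z_0I) (auto simp: P_def)
    obtain z where z: "z \<in> Z m" "\<And>v. v \<in> Z m \<Longrightarrow> A k z v = A k e v"
      using solve_small[OF m _ functional_A[OF e0]] Zm.nrm_nonneg[OF e0] res_pos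
      by (metis add_nonneg_nonneg less_eq_real_def mult_nonneg_nonneg norm_ge_zero zero_le_one)
    have z0: "z \<in> Z 0" using z(1) Z_subset by blast
    show ?thesis
    proof (intro exI[of _ "\<lambda>x. e x - z x"] conjI ballI)
      show "(\<lambda>x. e x - z x) \<in> Z 0" using e0 z0 by (rule Zm.diff)
      show "e x - z x = (if x = p then 1 else 0)" if "x \<in> level_vertices S m" for x
        using e(2)[OF that] Z_vertex[OF z(1) that] by simp
      show "A k (\<lambda>x. e x - z x) v = 0" if "v \<in> Z m" for v
        using A_diff[OF e(1) Z_DC[OF z(1)] Z_DC[OF that]] z(2)[OF that] by simp
    qed
  qed
  then obtain \<psi> where psi: "\<And>p. p \<in> P \<Longrightarrow> \<psi> p \<in> Z 0"
    "\<And>p x. p \<in> P \<Longrightarrow> x \<in> level_vertices S m \<Longrightarrow> \<psi> p x = (if x = p then 1 else 0)"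
    "\<And>p v. p \<in> P \<Longrightarrow> v \<in> Z m \<Longrightarrow> A k (\<psi> p) v = 0" by metis
  have comb: "(\<lambda>x. \<Sum>p\<in>P. a p * \<psi> p x) \<in> Z 0" for a
    using finP psi(1) by (intro conjunct1[OF Zm.nrm_triangle_sum] Zm.scale)
  have A_comb: "A k (\<lambda>x. \<Sum>p\<in>P. a p * \<psi> p x) v = (\<Sum>p\<in>P. a p * A k (\<psi> p) v)" if "v \<in> DC" for a v
  proof -
    have "A k (\<lambda>x. \<Sum>p\<in>P. a p * \<psi> p x) v = (\<Sum>p\<in>P. A k (\<lambda>x. a p * \<psi> p x) v)"
      using finP psi(1) that by (intro A_sum DC_scale) (auto dest: Z_DC)
    also have "\<dots> = (\<Sum>p\<in>P. a p * A k (\<psi> p) v)"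
      using psi(1) that by (intro sum.cong refl A_scale) (auto dest: Z_DC)
    finally show ?thesis .
  qed
  have comb_vertex: "(\<Sum>p\<in>P. a p * \<psi> p x) = (if x \<in> P then a x else 0)" if "x \<in> level_vertices S m" for a x
  proof -
    have "(\<Sum>p\<in>P. a p * \<psi> p x) = (\<Sum>p\<in>P. if x = p then a p else 0)"
      using psi(2)[OF _ that] by (intro sum.cong) auto
    then show ?thesis using finP by simp
  qed
  have decomp: "(\<lambda>x. v x - (\<Sum>p\<in>P. v p * \<psi> p x)) \<in> Z m" if v: "v \<in> Z 0" for v
  proof -
    have "(\<lambda>x. v x - (\<Sum>p\<in>P. v p * \<psi> p x)) \<in> Z 0" using v comb by (rule Zm.diff)
    moreover have "v x - (\<Sum>p\<in>P. v p * \<psi> p x) = 0" if x: "x \<in> level_vertices S m" for x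
      using comb_vertex[OF x, of v] Z_V0[OF v] x by (auto simp: P_def)
    ultimately show ?thesis by (simp add: Z_def)
  qed
  \<comment> \<open>By the decomposition, the equation has to be tested only on \<open>Z m\<close>
    and on finitely many functions \<open>\<psi> q\<close>.\<close>
  have test: "(\<forall>v\<in>Z 0. A k u v = l v)" if u: "u \<in> Z 0" and l: "Zm.functional 0 l C"
    and 1: "\<And>v. v \<in> Z m \<Longrightarrow> A k u v = l v" and 2: "\<And>q. q \<in> P \<Longrightarrow> A k u (\<psi> q) = l (\<psi> q)" for u l C
  proof
    fix v assume v: "v \<in> Z 0"
    define c where "c = (\<lambda>x. \<Sum>p\<in>P. v p * \<psi> p x)"
    define z where "z = (\<lambda>x. v x - c x)"
    have c: "c \<in> Z 0" and z: "z \<in> Z m" using comb decomp[OF v] by (auto simp: c_def z_def)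
    have ladd: "l (\<lambda>x. f x + g x) = l f + l g" if "f \<in> Z 0" "g \<in> Z 0" for f g
      using l that unfolding Zm.functional_def by blast
    have lscale: "l (\<lambda>x. a * f x) = a * l f" if "f \<in> Z 0" for a f
      using l that unfolding Zm.functional_def by blast
    have lsum: "l (\<lambda>x. \<Sum>p\<in>B. v p * \<psi> p x) = (\<Sum>p\<in>B. v p * l (\<psi> p))" if "B \<subseteq> P" for B
      using finite_subset[OF that finP] that
    proof (induction B rule: finite_induct)
      case empty
      then show ?case using lscale[OF Zm.zero, of 0] by simp
    next
      case (insert p B)
      then have "(\<lambda>x. v p * \<psi> p x) \<in> Z 0" "(\<lambda>x. \<Sum>p\<in>B. v p * \<psi> p x) \<in> Z 0"
        using psi(1) by (auto intro!: conjunct1[OF Zm.nrm_triangle_sum] Zm.scale)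
      then show ?case using insert ladd lscale psi(1) by auto
    qed
    have v_eq: "v = (\<lambda>x. z x + c x)" by (simp add: z_def)
    have "A k u v = A k u z + A k u c"
      using A_add[OF Z_DC[OF z] Z_DC[OF c] Z_DC[OF u], of k] unfolding v_eq[symmetric] by (simp add: A_sym[of k u])
    also have "A k u c = (\<Sum>p\<in>P. v p * A k u (\<psi> p))"
      unfolding A_sym[of k u] using A_comb[OF Z_DC[OF u], of v] by (simp add: c_def)
    also have "\<dots> = l c" using 2 lsum[OF subset_refl] by (simp add: c_def)
    also have "A k u z + l c = l v"
      using 1[OF z] ladd[of z c] c z Z_subset v_eq by (metis subsetD)
    finally show "A k u v = l v" .
  qed
  have zero_functional: "Zm.functional 0 (\<lambda>v. 0) 0" by (simp add: Zm.functional_def)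
  \<comment> \<open>A combination of the \<open>\<psi> p\<close> that is orthogonal to all
    \<open>\<psi> q\<close> is orthogonal to \<open>Z m\<close> as well, hence solves
    \<open>\<Delta>u = k u\<close> with zero boundary values. It vanishes since \<open>k\<close> is
    not an eigenvalue, and its vertex values are the coefficients.\<close>
  have "\<exists>B. \<forall>p\<in>P. \<forall>q\<in>P. (\<Sum>s\<in>P. B p s * A k (\<psi> s) (\<psi> q)) = (if p = q then 1 else 0)"
  proof (rule injective_matrix_left_inverse[OF finP])
    fix a assume a: "\<And>q. q \<in> P \<Longrightarrow> (\<Sum>p\<in>P. a p * A k (\<psi> p) (\<psi> q)) = 0"
    define u where "u = (\<lambda>x. \<Sum>p\<in>P. a p * \<psi> p x)"
    have u: "u \<in> Z 0" unfolding u_def by (rule comb)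
    have "\<forall>v\<in>Z 0. A k u v = 0"
    proof (rule test[OF u zero_functional])
      show "A k u v = 0" if "v \<in> Z m" for v
        using psi(3) that unfolding u_def A_comb[OF Z_DC[OF that]] by simp
      show "A k u (\<psi> q) = 0" if "q \<in> P" for q
        using a[OF that] unfolding u_def A_comb[OF Z_DC[OF psi(1)[OF that]]] .
    qed
    then have zero: "u x = 0" if "x \<in> X" for x using not_eigenvalue_zero[OF k u _ that] by blast
    show "\<forall>p\<in>P. a p = 0"
    proof
      fix p assume p: "p \<in> P"
      then have "p \<in> level_vertices S m" by (simp add: P_def)
      then show "a p = 0" using comb_vertex[of p a] zero[of p] level_vertices_subset p by (auto simp: u_def)
    qed
  qed
  then obtain B where "\<forall>p\<in>P. \<forall>q\<in>P. (\<Sum>s\<in>P. B p s * A k (\<psi> s) (\<psi> q)) = (if p = q then 1 else 0)" by blast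
  then have B: "\<And>p q. p \<in> P \<Longrightarrow> q \<in> P \<Longrightarrow> (\<Sum>s\<in>P. B p s * A k (\<psi> s) (\<psi> q)) = (if p = q then 1 else 0)" by blast
  \<comment> \<open>The 2 comes from the part of the solution in \<open>Z m\<close>, the double sum
    from the coefficients \<open>a p\<close> below, estimated through
    \<open>|l (\<psi> q)| \<le> C * nrm (\<psi> q)\<close>.\<close>
  define K where "K = 2 + (\<Sum>p\<in>P. (\<Sum>q\<in>P. cmod (B q p) * nrm (\<psi> q)) * nrm (\<psi> p))"
  show ?thesis
  proof (intro exI[of _ K] conjI allI impI)
    show "K \<ge> 0" unfolding K_def using psi(1) Zm.nrm_nonneg
      by (intro add_nonneg_nonneg sum_nonneg mult_nonneg_nonneg) auto
    fix l C assume C: "0 \<le> (C::real)" and l: "Zm.functional 0 l C"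
    obtain z where z: "z \<in> Z m" "nrm z \<le> 2 * C" "\<And>v. v \<in> Z m \<Longrightarrow> A k z v = l v"
      using solve_small[OF m C functional_subset[OF l]] by blast
    have z0: "z \<in> Z 0" using z(1) Z_subset by blast
    define a where "a p = (\<Sum>q\<in>P. B q p * l (\<psi> q))" for p
    define c where "c = (\<lambda>x. \<Sum>p\<in>P. a p * \<psi> p x)"
    have c: "c \<in> Z 0" unfolding c_def by (rule comb)
    define u where "u = (\<lambda>x. z x + c x)"
    have u: "u \<in> Z 0" unfolding u_def using z0 c by (rule Zm.add)
    have A_u: "A k u v = A k z v + A k c v" if "v \<in> DC" for v
      unfolding u_def using Z_DC[OF z(1)] Z_DC[OF c] that by (rule A_add)
    have sol: "\<forall>v\<in>Z 0. A k u v = l v"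
    proof (rule test[OF u l])
      show "A k u v = l v" if v: "v \<in> Z m" for v
        using A_u[OF Z_DC[OF v]] A_comb[OF Z_DC[OF v], of a] psi(3) v z(3) by (simp add: c_def)
      show "A k u (\<psi> q) = l (\<psi> q)" if q: "q \<in> P" for q
      proof -
        have "A k c (\<psi> q) = (\<Sum>p\<in>P. (\<Sum>s\<in>P. B s p * l (\<psi> s)) * A k (\<psi> p) (\<psi> q))"
          using A_comb[OF Z_DC[OF psi(1)[OF q]], of a] by (simp add: c_def a_def)
        also have "\<dots> = (\<Sum>p\<in>P. \<Sum>s\<in>P. l (\<psi> s) * (B s p * A k (\<psi> p) (\<psi> q)))"
          by (simp add: sum_distrib_right sum_distrib_left mult_ac)
        also have "\<dots> = (\<Sum>s\<in>P. l (\<psi> s) * (\<Sum>p\<in>P. B s p * A k (\<psi> p) (\<psi> q)))"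
          by (subst sum.swap) (simp add: sum_distrib_left)
        also have "\<dots> = (\<Sum>s\<in>P. if s = q then l (\<psi> s) else 0)"
          using B[OF _ q] by (intro sum.cong) auto
        also have "\<dots> = l (\<psi> q)" using finP q by simp
        finally show ?thesis
          using A_u[OF Z_DC[OF psi(1)[OF q]]] psi(3)[OF q z(1)] by (simp add: A_sym)
      qed
    qed
    have lb: "cmod (l (\<psi> q)) \<le> C * nrm (\<psi> q)" if "q \<in> P" for q
      using l psi(1)[OF that] unfolding Zm.functional_def by blast
    have "cmod (a p) \<le> (\<Sum>q\<in>P. cmod (B q p) * nrm (\<psi> q)) * C" for p
    proof -
      have "cmod (a p) \<le> (\<Sum>q\<in>P. cmod (B q p) * (C * nrm (\<psi> q)))"
        unfolding a_def using lb by (intro sum_norm_le) (simp add: norm_mult mult_left_mono)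
      then show ?thesis by (simp add: sum_distrib_left mult_ac)
    qed
    then have "(\<Sum>p\<in>P. cmod (a p) * nrm (\<psi> p)) \<le> (\<Sum>p\<in>P. (\<Sum>q\<in>P. cmod (B q p) * nrm (\<psi> q)) * C * nrm (\<psi> p))"
      using psi(1) Zm.nrm_nonneg by (intro sum_mono mult_right_mono) auto
    moreover have "nrm c \<le> (\<Sum>p\<in>P. cmod (a p) * nrm (\<psi> p))"
      unfolding c_def using Zm.nrm_triangle_sum[OF finP, of "\<lambda>p x. a p * \<psi> p x" 0] psi(1)
      by (simp add: Zm.nrm_scale[where m = 0] Zm.scale)
    moreover have "nrm u \<le> nrm z + nrm c" unfolding u_def using z0 c by (rule Zm.nrm_triangle)
    ultimately have "nrm u \<le> K * C"
      using z(2) by (simp add: K_def ring_distribs sum_distrib_left sum_distrib_right mult_ac)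
    then show "\<exists>u\<in>Z 0. nrm u \<le> K * C \<and> (\<forall>v\<in>Z 0. A k u v = l v)" using u sol by blast
  qed
qed

section \<open>The Green function\<close>

text \<open>The \<open>g\<^sub>\<kappa>(x,\<cdot>)\<close> of the overview; for \<open>k\<close>
  that is not an eigenvalue and \<open>x \<in> X\<close>, the choice is determined exactly on the
  attractor.\<close>

definition green :: "complex \<Rightarrow> 'a \<Rightarrow> 'a \<Rightarrow> complex" where
  "green k x = (SOME u. u \<in> Z 0 \<and> (\<forall>v\<in>Z 0. A k u v = v x))"

lemma functional_evaluation: "x \<in> X \<Longrightarrow> Zm.functional 0 (\<lambda>v. v x) (sqrt res)"
  unfolding Zm.functional_def using Z0_bound by blast

context
  fixes k :: complex
  assumes k: "\<not> dirichlet_eigenvalue S k"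
begin

lemma
  assumes "x \<in> X"
  shows green_Z: "green k x \<in> Z 0" and green_eq: "v \<in> Z 0 \<Longrightarrow> A k (green k x) v = v x"
proof -
  obtain K where K: "\<forall>l C. 0 \<le> C \<longrightarrow> Zm.functional 0 l C \<longrightarrow> (\<exists>u\<in>Z 0. nrm u \<le> K * C \<and> (\<forall>v\<in>Z 0. A k u v = l v))"
    using Fredholm[OF k] by blast
  have "\<exists>u\<in>Z 0. nrm u \<le> K * sqrt res \<and> (\<forall>v\<in>Z 0. A k u v = v x)"
    using spec[OF spec[OF K, of "\<lambda>v. v x"], of "sqrt res"] functional_evaluation[OF assms] res_pos by simp
  then have "\<exists>u. u \<in> Z 0 \<and> (\<forall>v\<in>Z 0. A k u v = v x)" by auto
  from someI_ex[OF this] show "green k x \<in> Z 0" "v \<in> Z 0 \<Longrightarrow> A k (green k x) v = v x"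
    unfolding green_def by blast+
qed

lemma green_unique:
  assumes "x \<in> X" "u \<in> Z 0" "\<And>v. v \<in> Z 0 \<Longrightarrow> A k u v = v x" "y \<in> X"
  shows "u y = green k x y"
  by (rule unique_solution[OF k assms(2) green_Z[OF assms(1)] _ assms(4)])
    (simp add: assms(3) green_eq[OF assms(1)])

lemma green_sym: "x \<in> X \<Longrightarrow> y \<in> X \<Longrightarrow> green k x y = green k y x"
  by (metis green_eq[of x "green k y"] green_eq[of y "green k x"] green_Z A_sym[of k "green k x" "green k y"])

lemma green_boundary_right: "x \<in> X \<Longrightarrow> y \<in> V0 \<Longrightarrow> green k x y = 0"
  using green_Z Z_V0 by blast

lemma green_boundary_left: "x \<in> V0 \<Longrightarrow> y \<in> X \<Longrightarrow> green k x y = 0"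
  using green_sym[of x y] green_boundary_right[of y x] subsetD[OF V0_subset, of x] by simp

text \<open>The constant of \<open>Fredholm\<close> does not depend on the functional, and the
  evaluations at all points of \<open>X\<close> share the bound \<open>sqrt res\<close>. The
  solution so obtained agrees with the chosen \<open>green k x\<close> on \<open>X\<close>, which is
  all that the norm sees.\<close>

lemma green_nrm_bounded: "\<exists>C. \<forall>x\<in>X. nrm (green k x) \<le> C"
proof -
  obtain K where K: "\<forall>l C. 0 \<le> C \<longrightarrow> Zm.functional 0 l C \<longrightarrow> (\<exists>u\<in>Z 0. nrm u \<le> K * C \<and> (\<forall>v\<in>Z 0. A k u v = l v))"
    using Fredholm[OF k] by blast
  have "nrm (green k x) \<le> K * sqrt res" if x: "x \<in> X" for x
  proof -
    obtain u where u: "u \<in> Z 0" "nrm u \<le> K * sqrt res" "\<forall>v\<in>Z 0. A k u v = v x"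
      using spec[OF spec[OF K, of "\<lambda>v. v x"], of "sqrt res"] functional_evaluation[OF x] res_pos by auto
    have "nrm u = nrm (green k x)" using green_unique[OF x u(1)] u(3) by (intro nrm_cong) auto
    then show ?thesis using u(2) by simp
  qed
  then show ?thesis by blast
qed

text \<open>For such \<open>k\<close> the perturbation argument works on \<open>Z 0\<close> itself,
  with a bound that does not depend on \<open>k\<close>. This uniformity controls the remainder of
  the series for long words.\<close>

lemma green_small:
  assumes "cmod k * res \<le> 1 / 2" "x \<in> X" "y \<in> X"
  shows "cmod (green k x y) \<le> 2 * res"
proof -
  have "cmod k * (res * rmax ^ 0) \<le> 1 / 2" using assms(1) by simp
  then obtain u where u: "u \<in> Z 0" "nrm u \<le> 2 * sqrt res" "\<And>v. v \<in> Z 0 \<Longrightarrow> A k u v = v x"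
    using solve_small[where l = "\<lambda>v. v x", OF _ real_sqrt_ge_zero[OF less_imp_le[OF res_pos]]
        functional_evaluation[OF assms(2)]] by blast
  have "cmod (green k x y) = cmod (u y)" using green_unique[OF assms(2) u(1,3) assms(3)] by simp
  also have "\<dots> \<le> sqrt res * nrm u" by (rule Z0_bound[OF u(1) assms(3)])
  also have "\<dots> \<le> sqrt res * (2 * sqrt res)" using u(2) res_pos by (intro mult_left_mono) auto
  also have "\<dots> = 2 * (sqrt res * sqrt res)" by simp
  also have "sqrt res * sqrt res = res" using res_pos by simp
  finally show ?thesis .
qed

text \<open>The bounded norms make all functions \<open>green k z\<close> equicontinuous in the
  second variable; symmetry transfers this to the first, and the triangle inequality joins
  both.\<close>

lemma green_continuous: "continuous_on (X \<times> X) (\<lambda>(x, y). green k x y)"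
proof -
  obtain C where C: "\<And>x. x \<in> X \<Longrightarrow> nrm (green k x) \<le> C" using green_nrm_bounded by blast
  have mod: "\<exists>d>0. \<forall>z\<in>X. \<forall>x\<in>X. \<forall>y\<in>X. dist x y < d \<longrightarrow> cmod (green k z x - green k z y) < e" if e: "e > 0" for e
  proof -
    define t where "t = e\<^sup>2 / (2 * (C\<^sup>2 + 1))"
    have "C\<^sup>2 + 1 > 0" by (simp add: add_nonneg_pos)
    then have t: "t > 0" using e by (simp add: t_def)
    obtain d where d: "d > 0" "\<And>u x y. u \<in> D \<Longrightarrow> x \<in> X \<Longrightarrow> y \<in> X \<Longrightarrow> dist x y < d \<Longrightarrow>
        (u x - u y)\<^sup>2 \<le> t * energy S u u" using D_equicontinuous[OF t] by blast
    have "cmod (green k z x - green k z y) < e" if z: "z \<in> X" and xy: "x \<in> X" "y \<in> X" "dist x y < d" for x y z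
    proof -
      define u where "u = green k z"
      have u: "u \<in> DC" unfolding u_def by (rule Z_DC[OF green_Z[OF z]])
      have "(cmod (u x - u y))\<^sup>2 = (Re (u x) - Re (u y))\<^sup>2 + (Im (u x) - Im (u y))\<^sup>2"
        by (simp add: cmod_power2)
      also have "\<dots> \<le> t * nrm2 u"
        using d(2)[OF DC_parts(1)[OF u] xy] d(2)[OF DC_parts(2)[OF u] xy]
        by (simp add: nrm2_parts[OF u] algebra_simps)
      also have "nrm2 u = (nrm u)\<^sup>2" unfolding u_def by (rule Zm.nrm_power2[OF green_Z[OF z], symmetric])
      also have "t * (nrm u)\<^sup>2 \<le> t * C\<^sup>2"
        using t C[OF z] Zm.nrm_nonneg[OF green_Z[OF z]] by (intro mult_left_mono power_mono) (auto simp: u_def)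
      also have "\<dots> < e\<^sup>2"
      proof -
        have "C\<^sup>2 < 2 * (C\<^sup>2 + 1)" by (simp add: add_nonneg_pos)
        then have "e\<^sup>2 * C\<^sup>2 < e\<^sup>2 * (2 * (C\<^sup>2 + 1))" using e by (intro mult_strict_left_mono) auto
        then show ?thesis using \<open>C\<^sup>2 + 1 > 0\<close> by (simp add: t_def field_simps)
      qed
      finally show ?thesis unfolding u_def by (rule power_less_imp_less_base) (use e in simp)
    qed
    then show ?thesis using d(1) by blast
  qed
  show ?thesis
    unfolding continuous_on_iff
  proof (intro ballI allI impI)
    fix p e assume p: "p \<in> X \<times> X" and e: "0 < (e::real)"
    obtain d where d: "d > 0" "\<And>x y z. z \<in> X \<Longrightarrow> x \<in> X \<Longrightarrow> y \<in> X \<Longrightarrow> dist x y < d \<Longrightarrow> cmod (green k z x - green k z y) < e / 2"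
      using mod[of "e / 2"] e by (metis half_gt_zero)
    show "\<exists>d>0. \<forall>q\<in>X \<times> X. dist q p < d \<longrightarrow> dist (case q of (x, y) \<Rightarrow> green k x y) (case p of (x, y) \<Rightarrow> green k x y) < e"
    proof (intro exI[of _ d] conjI d(1) ballI impI)
      fix q assume q: "q \<in> X \<times> X" and dist: "dist q p < d"
      obtain x y x' y' where pq: "p = (x, y)" "q = (x', y')" by fastforce
      have xy: "x \<in> X" "y \<in> X" "x' \<in> X" "y' \<in> X" using p q pq by auto
      have "dist x' x < d" "dist y' y < d"
        using dist dist_fst_le[of q p] dist_snd_le[of q p] by (auto simp: pq)
      then have "cmod (green k x' y' - green k x' y) < e / 2" "cmod (green k y x' - green k y x) < e / 2"
        using d(2) xy by blast+
      then show "dist (case q of (x, y) \<Rightarrow> green k x y) (case p of (x, y) \<Rightarrow> green k x y) < e"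
        using green_sym[of y x] green_sym[of y x'] xy
          norm_triangle_ineq[of "green k x' y' - green k x' y" "green k x' y - green k x y"]
        by (simp add: pq dist_norm)
    qed
  qed
qed

end


section \<open>Gauss--Green formula\<close>

lemma complex_harmonic:
  obtains h where "h \<in> DC" "\<And>q. q \<in> V0 \<Longrightarrow> h q = b q" "\<And>u. u \<in> DC \<Longrightarrow> energy S u h = energy0 S u h"
proof -
  obtain f where f: "f \<in> D" "\<And>q. q \<in> V0 \<Longrightarrow> f q = Re (b q)" "\<And>m. energy_level S m f f = energy0 S f f"
    using harmonic_function[of "\<lambda>x. Re (b x)"] by metis
  obtain g where g: "g \<in> D" "\<And>q. q \<in> V0 \<Longrightarrow> g q = Im (b q)" "\<And>m. energy_level S m g g = energy0 S g g"
    using harmonic_function[of "\<lambda>x. Im (b x)"] by metis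
  define h where "h x = Complex (f x) (g x)" for x
  have h: "h \<in> DC" using f(1) g(1) by (simp add: h_def dom_energy_def)
  have level: "energy_level S m u h = energy_level S 0 u h" for m u
    unfolding energy_level_complex[of _ u h]
    by (simp add: h_def harmonic_energy_level[OF f(3)] harmonic_energy_level[OF g(3)])
  have "energy S u h = energy0 S u h" if "u \<in> DC" for u
    using DC_tendsto[OF that h] level[of _ u] by (simp add: energy_level_0 LIMSEQ_const_iff)
  then show thesis using that[of h] h f(2) g(2) by (simp add: h_def complex_eq_iff)
qed

text \<open>The terms with \<open>x = q\<close> and those with \<open>y = q\<close> contribute the
  same amount, which cancels the factor 1/2. The result is the expression in the definition of the
  normal derivative for \<open>m = 0\<close>.\<close>

lemma energy0_delta:
  fixes u :: "'a \<Rightarrow> 'b::real_normed_field"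
  assumes q: "q \<in> V0" and h: "\<And>p. p \<in> V0 \<Longrightarrow> h p = (if p = q then 1 else 0)"
  shows "energy0 S u h = (\<Sum>y\<in>V0. of_real (conduct S q y) * (u q - u y))"
proof -
  define a where "a x y = of_real (conduct S x y) * (u x - u y)" for x y
  have anti: "a y x = - a x y" if "x \<in> V0" "y \<in> V0" for x y
    using conduct_sym[OF that] by (simp add: a_def algebra_simps)
  have first: "(\<Sum>x\<in>V0. \<Sum>y\<in>V0. a x y * h x) = (\<Sum>y\<in>V0. a q y)"
  proof -
    have "(\<Sum>x\<in>V0. \<Sum>y\<in>V0. a x y * h x) = (\<Sum>x\<in>V0. if x = q then \<Sum>y\<in>V0. a x y else 0)"
      using h by (intro sum.cong) auto
    then show ?thesis using q finite_V0 by simp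
  qed
  have "(\<Sum>x\<in>V0. \<Sum>y\<in>V0. a x y * h y) = (\<Sum>x\<in>V0. \<Sum>y\<in>V0. a y x * h x)"
    by (rule sum.swap)
  also have "\<dots> = - (\<Sum>x\<in>V0. \<Sum>y\<in>V0. a x y * h x)"
    unfolding sum_negf[symmetric]
  proof (intro sum.cong refl)
    fix x y assume "x \<in> V0" "y \<in> V0"
    from anti[OF this] show "a y x * h x = - (a x y * h x)" by simp
  qed
  finally have second: "(\<Sum>x\<in>V0. \<Sum>y\<in>V0. a x y * h y) = - (\<Sum>y\<in>V0. a q y)" using first by simp
  have "energy0 S u h = ((\<Sum>x\<in>V0. \<Sum>y\<in>V0. a x y * h x) - (\<Sum>x\<in>V0. \<Sum>y\<in>V0. a x y * h y)) / 2"
    by (simp add: energy0_def a_def right_diff_distrib sum_subtractf)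
  then show ?thesis unfolding first second by (simp add: a_def)
qed

text \<open>Zeros of \<open>v\<close> are required only at boundary points whose image also lies in
  another 1-cell. This leaves room for \<open>v q = 1\<close> at a boundary point
  \<open>q = F i q\<close>, which belongs to a single 1-cell.\<close>

lemma zero_extension:
  assumes v: "v \<in> DC" and i: "i \<in> I"
    and zero: "\<And>p p' j. p \<in> V0 \<Longrightarrow> p' \<in> V0 \<Longrightarrow> j \<in> I \<Longrightarrow> j \<noteq> i \<Longrightarrow> F i p = F j p' \<Longrightarrow> v p = 0"
  obtains w where "w \<in> DC" "\<And>x. x \<in> X \<Longrightarrow> w (F i x) = v x" "\<And>j x. j \<in> I \<Longrightarrow> j \<noteq> i \<Longrightarrow> x \<in> X \<Longrightarrow> w (F j x) = 0"
proof -
  have "\<exists>w. (\<forall>j\<in>I. \<forall>x\<in>X. w (F j x) = (if j = i then v x else 0)) \<and> (\<forall>x. x \<notin> X \<longrightarrow> w x = 0)"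
  proof (rule glue_exists)
    fix j j' x y assume a: "j \<in> I" "j' \<in> I" "x \<in> V0" "y \<in> V0" "F j x = F j' y"
    show "(if j = i then v x else 0) = (if j' = i then v y else 0)"
      using zero[of x y j'] zero[of y x j] a F_inj[OF i, of x y]
      by (cases "j = i"; cases "j' = i") auto
  qed
  then obtain w where w: "\<forall>j\<in>I. \<forall>x\<in>X. w (F j x) = (if j = i then v x else 0)" by blast
  have "w \<in> DC"
  proof (rule DC_glue)
    fix j assume j: "j \<in> I"
    have "(if j = i then v else (\<lambda>x. 0)) \<in> DC" using v DC_zero by simp
    then show "w \<circ> F j \<in> DC" by (rule DC_cong) (use w j in auto)
  qed
  then show thesis using that[of w] w i by auto
qed

lemma energy_zero_extension:
  assumes "u \<in> DC" "w \<in> DC" "i \<in> I"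
    and "\<And>x. x \<in> X \<Longrightarrow> w (F i x) = v x" "\<And>j x. j \<in> I \<Longrightarrow> j \<noteq> i \<Longrightarrow> x \<in> X \<Longrightarrow> w (F j x) = 0"
  shows "energy S u w = of_real (inverse (r i)) * energy S (u \<circ> F i) v"
proof -
  have i: "energy S (u \<circ> F i) (w \<circ> F i) = energy S (u \<circ> F i) v"
    using assms(4) by (intro energy_cong) auto
  have zero: "energy S (u \<circ> F j) (w \<circ> F j) = 0" if "j \<in> I" "j \<noteq> i" for j
  proof -
    have "energy S (u \<circ> F j) (w \<circ> F j) = energy S (u \<circ> F j) (\<lambda>x. 0)"
      using assms(5)[OF that] by (intro energy_cong) auto
    also have "\<dots> = 0"
      using energy_scale[OF DC_zero DC_F[OF assms(1) that(1)], of 0] energy_sym[of "u \<circ> F j"] by simp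
    finally show ?thesis .
  qed
  have "energy S u w = (\<Sum>j\<in>I. if j = i then of_real (inverse (r i)) * energy S (u \<circ> F i) v else 0)"
    unfolding energy_glue[OF assms(1,2)] using i zero by (intro sum.cong) auto
  then show ?thesis using assms(3) by simp
qed

lemma integral_zero_extension:
  assumes "continuous_on X f" "w \<in> DC" "i \<in> I"
    and "\<And>x. x \<in> X \<Longrightarrow> w (F i x) = v x" "\<And>j x. j \<in> I \<Longrightarrow> j \<noteq> i \<Longrightarrow> x \<in> X \<Longrightarrow> w (F j x) = 0"
  shows "(\<integral>x. f x * w x \<partial>M) = of_real (mwt S i) * (\<integral>x. f (F i x) * v x \<partial>M)"
proof -
  have "(\<integral>x. f x * w x \<partial>M) = (\<Sum>j\<in>I. of_real (mwt S j) * (\<integral>x. f (F j x) * w (F j x) \<partial>M))"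
    using assms(1) DC_continuous[OF assms(2)] by (intro integral_self_similar continuous_intros)
  also have "\<dots> = (\<Sum>j\<in>I. if j = i then of_real (mwt S i) * (\<integral>x. f (F i x) * v x \<partial>M) else 0)"
  proof (intro sum.cong refl)
    fix j assume j: "j \<in> I"
    have "(\<integral>x. f (F j x) * w (F j x) \<partial>M) = (\<integral>x. (if j = i then f (F i x) * v x else 0) \<partial>M)"
      using assms(4,5) j by (intro Bochner_Integration.integral_cong) (auto simp: space_M)
    then show "of_real (mwt S j) * (\<integral>x. f (F j x) * w (F j x) \<partial>M) =
        (if j = i then of_real (mwt S i) * (\<integral>x. f (F i x) * v x \<partial>M) else 0)" by auto
  qed
  finally show ?thesis using assms(3) by simp
qed

lemma the_boundary_index: "q \<in> V0 \<Longrightarrow> i \<in> I \<Longrightarrow> F i q = q \<Longrightarrow> (THE i. i \<in> I \<and> F i q = q) = i"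
  using boundary_point_unique_cell[of q i] V0_subset by (intro the_equality) (auto simp: image_iff, metis subsetD)

text \<open>The \<open>m\<close>-th function is supported in the cell \<open>F\<^sub>i\<^sup>m(X)\<close>, the only \<open>m\<close>-cell containing \<open>q\<close>.\<close>

lemma shrinking_delta_functions:
  assumes q: "q \<in> V0" and i: "i \<in> I" "F i q = q"
  shows "\<exists>B. \<forall>m. \<exists>w\<in>DC. (\<forall>p\<in>V0. w p = (if p = q then 1 else 0)) \<and>
    (\<forall>u\<in>DC. energy S u w = of_real (inverse (r i ^ m)) *
       (\<Sum>p\<in>V0. of_real (conduct S q p) * (u q - u ((F i ^^ m) p)))) \<and>
    (\<forall>f b. continuous_on X f \<longrightarrow> (\<forall>x\<in>X. cmod (f x) \<le> b) \<longrightarrow> cmod (\<integral>x. f x * w x \<partial>M) \<le> mwt S i ^ m * (b * B))"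
proof -
  obtain h where h: "h \<in> DC" "\<And>p. p \<in> V0 \<Longrightarrow> h p = (if p = q then 1 else 0)"
    "\<And>u. u \<in> DC \<Longrightarrow> energy S u h = energy0 S u h"
    using complex_harmonic[of "\<lambda>p. if p = q then 1 else 0"] by blast
  obtain B where B: "\<And>x. x \<in> X \<Longrightarrow> cmod (h x) \<le> B" using continuous_bounded[OF DC_continuous[OF h(1)]] by blast
  have mem: "q \<in> X" using q V0_subset by blast
  have unique: "j = i" if "j \<in> I" "x \<in> X" "q = F j x" for j x
    using boundary_point_unique_cell[OF q i that(1)] that by blast
  have "\<exists>w\<in>DC. (\<forall>p\<in>V0. w p = (if p = q then 1 else 0)) \<and>
    (\<forall>u\<in>DC. energy S u w = of_real (inverse (r i ^ m)) *
       (\<Sum>p\<in>V0. of_real (conduct S q p) * (u q - u ((F i ^^ m) p)))) \<and>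
    (\<forall>f b. continuous_on X f \<longrightarrow> (\<forall>x\<in>X. cmod (f x) \<le> b) \<longrightarrow> cmod (\<integral>x. f x * w x \<partial>M) \<le> mwt S i ^ m * (b * B))" for m
  proof (induction m)
    case 0
    have "cmod (\<integral>x. f x * h x \<partial>M) \<le> b * B"
      if f: "continuous_on X f" "\<forall>x\<in>X. cmod (f x) \<le> b" for f b
    proof (rule integral_norm_le)
      show "(\<lambda>x. f x * h x) \<in> borel_measurable M"
        using f(1) DC_continuous[OF h(1)] by (intro continuous_measurable continuous_intros)
      fix x assume x: "x \<in> X"
      then show "cmod (f x * h x) \<le> b * B"
        unfolding norm_mult using f(2) B[OF x] order_trans[OF norm_ge_zero, of "f x" b]
        by (intro mult_mono) auto
    qed
    then show ?case using h energy0_delta[OF q h(2)] by (intro bexI[of _ h]) auto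
  next
    case (Suc m)
    then obtain v where v: "v \<in> DC" "\<And>p. p \<in> V0 \<Longrightarrow> v p = (if p = q then 1 else 0)"
      "\<And>u. u \<in> DC \<Longrightarrow> energy S u v = of_real (inverse (r i ^ m)) *
         (\<Sum>p\<in>V0. of_real (conduct S q p) * (u q - u ((F i ^^ m) p)))"
      "\<And>f b. continuous_on X f \<Longrightarrow> (\<forall>x\<in>X. cmod (f x) \<le> b) \<Longrightarrow> cmod (\<integral>x. f x * v x \<partial>M) \<le> mwt S i ^ m * (b * B)"
      by blast
    have "v p = 0" if "p \<in> V0" "p' \<in> V0" "j \<in> I" "j \<noteq> i" "F i p = F j p'" for p p' j
    proof -
      have "p \<noteq> q" using unique[OF that(3), of p'] that i(2) V0_subset by auto
      then show ?thesis using v(2) that(1) by simp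
    qed
    then obtain w where w: "w \<in> DC" "\<And>x. x \<in> X \<Longrightarrow> w (F i x) = v x"
      "\<And>j x. j \<in> I \<Longrightarrow> j \<noteq> i \<Longrightarrow> x \<in> X \<Longrightarrow> w (F j x) = 0"
      using zero_extension[OF v(1) i(1)] by blast
    show ?case
    proof (intro bexI[OF _ w(1)] conjI ballI allI impI)
      fix p assume p: "p \<in> V0"
      then have pX: "p \<in> X" using V0_subset by blast
      obtain j where j: "j \<in> I" "F j p = p" using V0_fixed[OF p] by blast
      show "w p = (if p = q then 1 else 0)"
      proof (cases "p = q")
        case True
        then show ?thesis using w(2)[OF pX] v(2)[OF p] i(2) by simp
      next
        case False
        then have "j \<noteq> i" using fixed_point_unique[OF i(1) i(2), of p] j by auto
        then show ?thesis using w(3)[OF j(1) _ pX] j False by simp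
      qed
    next
      fix u assume u: "u \<in> DC"
      show "energy S u w = of_real (inverse (r i ^ Suc m)) *
          (\<Sum>p\<in>V0. of_real (conduct S q p) * (u q - u ((F i ^^ Suc m) p)))"
        using energy_zero_extension[where v = v, OF u w(1) i(1) w(2,3)] v(3)[OF DC_F[OF u i(1)]] i(2) by simp
    next
      fix f b assume f: "continuous_on X f" "\<forall>x\<in>X. cmod (f x) \<le> b"
      have "continuous_on X (f \<circ> F i)"
        using F_continuous[OF i(1)] f(1) F_in_X[OF i(1)]
        by (intro continuous_on_compose) (auto elim!: continuous_on_subset)
      moreover have "\<forall>x\<in>X. cmod ((f \<circ> F i) x) \<le> b" using f(2) F_in_X[OF i(1)] by simp
      ultimately have "cmod (\<integral>x. (f \<circ> F i) x * v x \<partial>M) \<le> mwt S i ^ m * (b * B)" by (rule v(4))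
      moreover have "(\<integral>x. f x * w x \<partial>M) = of_real (mwt S i) * (\<integral>x. f (F i x) * v x \<partial>M)"
        using f(1) w(1) i(1) w(2,3) by (rule integral_zero_extension)
      ultimately show "cmod (\<integral>x. f x * w x \<partial>M) \<le> mwt S i ^ Suc m * (b * B)"
        using mwt_pos[OF i(1)] by (simp add: norm_mult mult.assoc)
    qed
  qed
  then show ?thesis by blast
qed

text \<open>The left-hand side depends on \<open>v\<close> only through its boundary values, because
  \<open>u\<close> satisfies the weak equation. It is evaluated on the shrinking functions with
  boundary value 1 at \<open>q\<close> and 0 elsewhere: the integral tends to 0 like
  \<open>mwt S i ^ m\<close>, while the energies form exactly the sequence in the definition of the
  normal derivative, which therefore converges.\<close>

lemma Gauss_Green:
  assumes lap: "has_laplacian S u f" and v: "v \<in> DC"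
  shows "energy S u v + (\<integral>x. f x * v x \<partial>M) = (\<Sum>q\<in>V0. v q * normal_derivative S u q)"
proof -
  have f: "continuous_on X f" and u: "u \<in> DC"
    and weak: "\<And>v. v \<in> Z 0 \<Longrightarrow> energy S u v = - (\<integral>x. f x * v x \<partial>M)"
    using lap unfolding has_laplacian_def weak_laplacian_def dom0_eq by blast+
  define \<Phi> where "\<Phi> v = energy S u v + (\<integral>x. f x * v x \<partial>M)" for v
  have fint: "integrable M (\<lambda>x. f x * v x)" if "v \<in> DC" for v
    using f DC_continuous[OF that] by (intro continuous_integrable continuous_intros)
  have Phi_add: "\<Phi> (\<lambda>x. v x + w x) = \<Phi> v + \<Phi> w" if "v \<in> DC" "w \<in> DC" for v w
    using energy_add[OF that u] fint[OF that(1)] fint[OF that(2)]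
    by (simp add: \<Phi>_def energy_sym[of u] ring_distribs)
  have Phi_scale: "\<Phi> (\<lambda>x. c * v x) = c * \<Phi> v" if "v \<in> DC" for c v
    using energy_scale[OF that u] by (simp add: \<Phi>_def energy_sym[of u] ring_distribs mult.left_commute)
  have Phi_sum: "\<Phi> (\<lambda>x. \<Sum>i\<in>B. c i * w i x) = (\<Sum>i\<in>B. c i * \<Phi> (w i))"
    if "finite B" "\<And>i. i \<in> B \<Longrightarrow> w i \<in> DC" for B c and w :: "'a \<Rightarrow> 'a \<Rightarrow> complex"
    using that
  proof (induction B rule: finite_induct)
    case empty
    then show ?case using Phi_scale[OF DC_zero, of 0] by simp
  next
    case (insert i B)
    then show ?case using Phi_add[OF DC_scale[of "w i" "c i"] DC_sum[of B "\<lambda>i x. c i * w i x"]]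
      by (simp add: Phi_scale DC_scale)
  qed
  have Phi_boundary: "\<Phi> v = \<Phi> w" if "v \<in> DC" "w \<in> DC" "\<And>q. q \<in> V0 \<Longrightarrow> v q = w q" for v w
  proof -
    have "(\<lambda>x. v x - w x) \<in> Z 0" using that by (intro Z_0I DC_diff) auto
    then have "\<Phi> (\<lambda>x. v x - w x) = 0" using weak by (simp add: \<Phi>_def)
    then show ?thesis using Phi_add[OF that(2) DC_diff[OF that(1,2)]] by simp
  qed
  have delta: "\<exists>w\<in>DC. (\<forall>p\<in>V0. w p = (if p = q then 1 else 0)) \<and> \<Phi> w = normal_derivative S u q"
    if q: "q \<in> V0" for q
  proof -
    obtain i where i: "i \<in> I" "F i q = q" using V0_fixed[OF q] by blast
    define N where "N m = of_real (inverse (r i ^ m)) *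
        (\<Sum>p\<in>V0. of_real (conduct S q p) * (u q - u ((F i ^^ m) p)))" for m
    from shrinking_delta_functions[OF q i] obtain B where B: "\<forall>m. \<exists>w\<in>DC. (\<forall>p\<in>V0. w p = (if p = q then 1 else 0)) \<and>
      (\<forall>u\<in>DC. energy S u w = of_real (inverse (r i ^ m)) *
         (\<Sum>p\<in>V0. of_real (conduct S q p) * (u q - u ((F i ^^ m) p)))) \<and>
      (\<forall>f b. continuous_on X f \<longrightarrow> (\<forall>x\<in>X. cmod (f x) \<le> b) \<longrightarrow> cmod (\<integral>x. f x * w x \<partial>M) \<le> mwt S i ^ m * (b * B))"
      by blast
    obtain b where "\<And>x. x \<in> X \<Longrightarrow> cmod (f x) \<le> b" using continuous_bounded[OF f] by blast
    then have b: "\<forall>x\<in>X. cmod (f x) \<le> b" by blast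
    have "\<exists>w\<in>DC. (\<forall>p\<in>V0. w p = (if p = q then 1 else 0)) \<and> energy S u w = N m \<and>
        cmod (\<integral>x. f x * w x \<partial>M) \<le> mwt S i ^ m * (b * B)" for m
    proof -
      obtain w where "w \<in> DC" "\<forall>p\<in>V0. w p = (if p = q then 1 else 0)"
        "\<forall>u\<in>DC. energy S u w = of_real (inverse (r i ^ m)) *
           (\<Sum>p\<in>V0. of_real (conduct S q p) * (u q - u ((F i ^^ m) p)))"
        "\<forall>f b. continuous_on X f \<longrightarrow> (\<forall>x\<in>X. cmod (f x) \<le> b) \<longrightarrow> cmod (\<integral>x. f x * w x \<partial>M) \<le> mwt S i ^ m * (b * B)"
        using spec[OF B, of m] by (elim bexE conjE)
      then show ?thesis using u f b unfolding N_def by (intro bexI[of _ w]) auto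
    qed
    then obtain w where w: "\<And>m. w m \<in> DC" "\<And>m p. p \<in> V0 \<Longrightarrow> w m p = (if p = q then 1 else 0)"
      "\<And>m. energy S u (w m) = N m" "\<And>m. cmod (\<integral>x. f x * w m x \<partial>M) \<le> mwt S i ^ m * (b * B)" by metis
    have const: "\<Phi> (w m) = \<Phi> (w 0)" for m using w(1,2) by (intro Phi_boundary) auto
    have "(\<lambda>m. mwt S i ^ m * (b * B)) \<longlonglongrightarrow> 0"
      using mwt_pos[OF i(1)] mwt_less_1[OF i(1)] by (intro tendsto_mult_left_zero LIMSEQ_power_zero) auto
    then have "(\<lambda>m. \<integral>x. f x * w m x \<partial>M) \<longlonglongrightarrow> 0"
      by (rule Lim_null_comparison[rotated]) (use w(4) in \<open>auto intro: always_eventually\<close>)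
    then have "(\<lambda>m. \<Phi> (w 0) - (\<integral>x. f x * w m x \<partial>M)) \<longlonglongrightarrow> \<Phi> (w 0) - 0" by (intro tendsto_diff tendsto_const)
    moreover have "N = (\<lambda>m. \<Phi> (w 0) - (\<integral>x. f x * w m x \<partial>M))"
    proof
      show "N m = \<Phi> (w 0) - (\<integral>x. f x * w m x \<partial>M)" for m
        using const[of m] w(3)[of m] by (simp add: \<Phi>_def algebra_simps)
    qed
    ultimately have "N \<longlonglongrightarrow> \<Phi> (w 0)" by simp
    then have "normal_derivative S u q = \<Phi> (w 0)"
      unfolding normal_derivative_def the_boundary_index[OF q i] Let_def N_def by (rule limI)
    then show ?thesis using w(1)[of 0] w(2)[of _ 0] by (intro bexI[of _ "w 0"]) auto
  qed
  then obtain w where w: "\<And>q. q \<in> V0 \<Longrightarrow> w q \<in> DC" "\<And>q p. q \<in> V0 \<Longrightarrow> p \<in> V0 \<Longrightarrow> w q p = (if p = q then 1 else 0)"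
    "\<And>q. q \<in> V0 \<Longrightarrow> \<Phi> (w q) = normal_derivative S u q" by metis
  have "\<Phi> v = \<Phi> (\<lambda>x. \<Sum>q\<in>V0. v q * w q x)"
  proof (rule Phi_boundary[OF v])
    show "(\<lambda>x. \<Sum>q\<in>V0. v q * w q x) \<in> DC" using finite_V0 w(1) by (intro DC_sum DC_scale)
    fix p assume p: "p \<in> V0"
    have "(\<Sum>q\<in>V0. v q * w q p) = (\<Sum>q\<in>V0. if q = p then v q else 0)"
      using w(2)[OF _ p] by (intro sum.cong) auto
    then show "v p = (\<Sum>q\<in>V0. v q * w q p)" using p finite_V0 by simp
  qed
  also have "\<dots> = (\<Sum>q\<in>V0. v q * \<Phi> (w q))" using finite_V0 w(1) by (rule Phi_sum)
  also have "\<dots> = (\<Sum>q\<in>V0. v q * normal_derivative S u q)" using w(3) by simp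
  finally show ?thesis by (simp add: \<Phi>_def)
qed

section \<open>The functions \<open>\<psi>\<close> and the matrix \<open>B\<close>\<close>

definition child_lam :: "complex \<Rightarrow> nat \<Rightarrow> complex" where
  "child_lam k j = of_real (r j * mwt S j) * k"

text \<open>Quantifying over all words makes the condition pass from \<open>k\<close> to
  \<open>child_lam k j\<close>, as the iteration of the decomposition requires.\<close>

definition admissible :: "complex \<Rightarrow> bool" where
  "admissible k \<longleftrightarrow> (\<forall>w\<in>words S. \<not> dirichlet_eigenvalue S (of_real (word_r S w * word_mu S w) * k))"

lemma admissible_not_eigenvalue: "admissible k \<Longrightarrow> \<not> dirichlet_eigenvalue S k"
  unfolding admissible_def by (drule bspec[of _ _ "[]"]) (simp_all add: words_def word_r_Nil word_mu_Nil)

lemma admissible_child_lam: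
  assumes "admissible k" "j \<in> I" shows "admissible (child_lam k j)"
  unfolding admissible_def
proof
  fix w assume w: "w \<in> words S"
  then have "w @ [j] \<in> words S" using assms(2) by (auto simp: words_def)
  then have "\<not> dirichlet_eigenvalue S (of_real (word_r S (w @ [j]) * word_mu S (w @ [j])) * k)"
    using assms(1) unfolding admissible_def by blast
  then show "\<not> dirichlet_eigenvalue S (of_real (word_r S w * word_mu S w) * child_lam k j)"
    by (simp add: word_r_snoc word_mu_snoc child_lam_def mult_ac)
qed

lemma has_laplacian_iff:
  assumes "u \<in> DC"
  shows "has_laplacian S u (\<lambda>x. k * u x) \<longleftrightarrow> (\<forall>v\<in>Z 0. A k u v = 0)"
proof -
  have "continuous_on X (\<lambda>x. k * u x)" using DC_continuous[OF assms] by (intro continuous_intros)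
  then show ?thesis
    unfolding has_laplacian_def weak_laplacian_def dom0_eq A_def using assms
    by (simp add: eq_neg_iff_add_eq_0 mult.assoc)
qed

lemma has_laplacian_DC: "has_laplacian S u f \<Longrightarrow> u \<in> DC"
  by (simp add: has_laplacian_def weak_laplacian_def)

lemma has_laplacian_on_1_cell:
  "has_laplacian_on_cell S [j] u (\<lambda>x. k * u x) \<longleftrightarrow> has_laplacian S (u \<circ> F j) (\<lambda>x. child_lam k j * (u \<circ> F j) x)"
  by (simp add: has_laplacian_on_cell_def word_r_def word_mu_def child_lam_def mult.assoc)

text \<open>The harmonic extension \<open>h\<close> has energy 0 against functions vanishing on
  \<open>V0\<close>, so \<open>A k h\<close> reduces to the integral and is a bounded functional.
  Subtracting the Dirichlet solution for this functional from \<open>h\<close> solves the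
  problem.\<close>

lemma boundary_value_problem:
  assumes k: "\<not> dirichlet_eigenvalue S k"
  shows "\<exists>u\<in>DC. (\<forall>q\<in>V0. u q = b q) \<and> (\<forall>v\<in>Z 0. A k u v = 0)"
proof -
  obtain h where h: "h \<in> DC" "\<And>q. q \<in> V0 \<Longrightarrow> h q = b q" "\<And>u. u \<in> DC \<Longrightarrow> energy S u h = energy0 S u h"
    using complex_harmonic[of b] by blast
  obtain c where c: "c > 0" "\<And>x. x \<in> X \<Longrightarrow> cmod (h x) \<le> c" using continuous_bounded[OF DC_continuous[OF h(1)]] by blast
  have A_h: "A k h v = k * (\<integral>x. h x * v x \<partial>M)" if v: "v \<in> Z 0" for v
  proof -
    have "energy S v h = 0"
      unfolding h(3)[OF Z_DC[OF v]] energy0_def using Z_V0[OF v] by simp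
    then show ?thesis by (simp add: A_def energy_sym[of h])
  qed
  have "Zm.functional 0 (A k h) (cmod k * (c * sqrt res))"
    unfolding Zm.functional_def
  proof (intro conjI ballI allI)
    fix u v assume "u \<in> Z 0" "v \<in> Z 0"
    then show "A k h (\<lambda>x. u x + v x) = A k h u + A k h v"
      using A_add[of u v h k] h(1) Z_DC by (simp add: A_sym[of k h])
  next
    fix a u assume "u \<in> Z 0"
    then show "A k h (\<lambda>x. a * u x) = a * A k h u"
      using A_scale[of u h k a] h(1) Z_DC by (simp add: A_sym[of k h])
  next
    fix v assume v: "v \<in> Z 0"
    have "cmod (\<integral>x. h x * v x \<partial>M) \<le> c * (sqrt res * nrm v)"
    proof (rule integral_norm_le)
      show "(\<lambda>x. h x * v x) \<in> borel_measurable M"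
        using DC_continuous[OF h(1)] DC_continuous[OF Z_DC[OF v]] by (intro continuous_measurable continuous_intros)
      show "cmod (h x * v x) \<le> c * (sqrt res * nrm v)" if "x \<in> X" for x
        unfolding norm_mult using c Z0_bound[OF v that] that by (intro mult_mono) auto
    qed
    then have "cmod k * cmod (\<integral>x. h x * v x \<partial>M) \<le> cmod k * (c * (sqrt res * nrm v))"
      by (intro mult_left_mono) auto
    then show "cmod (A k h v) \<le> cmod k * (c * sqrt res) * nrm v"
      unfolding A_h[OF v] norm_mult by (simp add: mult.assoc)
  qed
  moreover obtain K where K: "\<forall>l C. 0 \<le> C \<longrightarrow> Zm.functional 0 l C \<longrightarrow>
      (\<exists>u\<in>Z 0. nrm u \<le> K * C \<and> (\<forall>v\<in>Z 0. A k u v = l v))" using Fredholm[OF k] by blast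
  ultimately have "\<exists>z\<in>Z 0. nrm z \<le> K * (cmod k * (c * sqrt res)) \<and> (\<forall>v\<in>Z 0. A k z v = A k h v)"
    using spec[OF spec[OF K, of "A k h"], of "cmod k * (c * sqrt res)"] c(1) res_pos by simp
  then obtain z where z: "z \<in> Z 0" "\<And>v. v \<in> Z 0 \<Longrightarrow> A k z v = A k h v" by blast
  show ?thesis
  proof (intro bexI[of _ "\<lambda>x. h x - z x"] conjI ballI)
    show "(\<lambda>x. h x - z x) \<in> DC" using h(1) Z_DC[OF z(1)] by (rule DC_diff)
    show "h q - z q = b q" if "q \<in> V0" for q using that h(2) Z_V0[OF z(1)] by simp
    show "A k (\<lambda>x. h x - z x) v = 0" if "v \<in> Z 0" for v
      using A_diff[OF h(1) Z_DC[OF z(1)] Z_DC[OF that], of k] z(2)[OF that] by simp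
  qed
qed

context
  fixes k :: complex
  assumes k: "admissible k"
begin

lemma child_lam_not_eigenvalue: "j \<in> I \<Longrightarrow> \<not> dirichlet_eigenvalue S (child_lam k j)"
  using admissible_child_lam[OF k] admissible_not_eigenvalue by blast

lemma k_not_eigenvalue: "\<not> dirichlet_eigenvalue S k"
  using k by (rule admissible_not_eigenvalue)

text \<open>This justifies the definite description behind \<open>psi\<close>. On the cell of
  \<open>j\<close> the equation becomes one on \<open>X\<close> with parameter
  \<open>child_lam k j\<close>, whose boundary value problem is uniquely solvable; the pieces fit
  together since their values at the vertices are prescribed.\<close>

lemma psi_properties:
  "(\<forall>j\<in>I. has_laplacian_on_cell S [j] (psi S k p) (\<lambda>x. k * psi S k p x)) \<and>
   (\<forall>q\<in>level_vertices S 1. psi S k p q = (if q = p then 1 else 0)) \<and>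
   (\<forall>x. x \<notin> X \<longrightarrow> psi S k p x = 0)"
proof -
  have "\<exists>u\<in>DC. (\<forall>q\<in>V0. u q = (if F j q = p then 1 else 0)) \<and> (\<forall>v\<in>Z 0. A (child_lam k j) u v = 0)" if "j \<in> I" for j
    by (rule boundary_value_problem[OF child_lam_not_eigenvalue[OF that]])
  then obtain f where f: "\<And>j. j \<in> I \<Longrightarrow> f j \<in> DC"
    "\<And>j q. j \<in> I \<Longrightarrow> q \<in> V0 \<Longrightarrow> f j q = (if F j q = p then 1 else 0)"
    "\<And>j v. j \<in> I \<Longrightarrow> v \<in> Z 0 \<Longrightarrow> A (child_lam k j) (f j) v = 0" by metis
  have "\<exists>u. (\<forall>j\<in>I. \<forall>x\<in>X. u (F j x) = f j x) \<and> (\<forall>x. x \<notin> X \<longrightarrow> u x = 0)"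
    using f(2) by (intro glue_exists) simp
  then obtain u where u: "\<forall>j\<in>I. \<forall>x\<in>X. u (F j x) = f j x" "\<forall>x. x \<notin> X \<longrightarrow> u x = 0" by blast
  have "\<exists>!u. (\<forall>j\<in>I. has_laplacian_on_cell S [j] u (\<lambda>x. k * u x)) \<and>
      (\<forall>q\<in>level_vertices S 1. u q = (if q = p then 1 else 0)) \<and> (\<forall>x. x \<notin> X \<longrightarrow> u x = 0)"
  proof (rule ex1I[of _ u], intro conjI ballI u(2))
    fix j assume j: "j \<in> I"
    have uj: "u \<circ> F j \<in> DC" by (rule DC_cong[OF f(1)[OF j]]) (use u j in auto)
    have "A (child_lam k j) (u \<circ> F j) v = A (child_lam k j) (f j) v" for v using u j by (intro A_cong) auto
    then show "has_laplacian_on_cell S [j] u (\<lambda>x. k * u x)"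
      unfolding has_laplacian_on_1_cell has_laplacian_iff[OF uj] using f(3)[OF j] by simp
  next
    fix q assume "q \<in> level_vertices S 1"
    then obtain j q' where "j \<in> I" "q' \<in> V0" "q = F j q'" unfolding level_vertices_1 by blast
    then show "u q = (if q = p then 1 else 0)" using u(1) f(2) V0_subset by auto
  next
    fix u' assume u': "(\<forall>j\<in>I. has_laplacian_on_cell S [j] u' (\<lambda>x. k * u' x)) \<and>
      (\<forall>q\<in>level_vertices S 1. u' q = (if q = p then 1 else 0)) \<and> (\<forall>x. x \<notin> X \<longrightarrow> u' x = 0)"
    have "u' x = u x" if x: "x \<in> X" for x
    proof -
      obtain j y where jy: "j \<in> I" "y \<in> X" "x = F j y" using X_cases[OF x] by blast
      have lap: "has_laplacian S (u' \<circ> F j) (\<lambda>x. child_lam k j * (u' \<circ> F j) x)"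
        using u' jy(1) has_laplacian_on_1_cell by blast
      note uj = has_laplacian_DC[OF lap]
      have "(u' \<circ> F j) y - f j y = 0"
      proof (rule not_eigenvalue_zero[OF child_lam_not_eigenvalue[OF jy(1)] _ _ jy(2)])
        show "(\<lambda>x. (u' \<circ> F j) x - f j x) \<in> Z 0"
        proof (rule Z_0I[OF DC_diff[OF uj f(1)[OF jy(1)]]])
          fix q assume "q \<in> V0"
          then show "(u' \<circ> F j) q - f j q = 0"
            using f(2)[OF jy(1)] u' jy(1) unfolding level_vertices_1 by auto
        qed
        show "A (child_lam k j) (\<lambda>x. (u' \<circ> F j) x - f j x) v = 0" if v: "v \<in> Z 0" for v
          using A_diff[OF uj f(1)[OF jy(1)] Z_DC[OF v], of "child_lam k j"] f(3)[OF jy(1) v]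
            lap[unfolded has_laplacian_iff[OF uj]] v by simp
      qed
      then show ?thesis using u(1) jy by simp
    qed
    then show "u' = u" using u' u(2) by (intro ext) (metis)
  qed
  from theI'[OF this] show ?thesis unfolding psi_def[symmetric] .
qed

lemma psi_laplacian: "j \<in> I \<Longrightarrow> has_laplacian S (psi S k p \<circ> F j) (\<lambda>x. child_lam k j * (psi S k p \<circ> F j) x)"
  using psi_properties has_laplacian_on_1_cell by blast

lemma psi_vertex: "q \<in> level_vertices S 1 \<Longrightarrow> psi S k p q = (if q = p then 1 else 0)"
  using psi_properties by blast

lemma psi_F_DC: "j \<in> I \<Longrightarrow> psi S k p \<circ> F j \<in> DC"
  using psi_laplacian has_laplacian_DC by blast

lemma psi_DC: "psi S k p \<in> DC"
  by (rule DC_glue) (rule psi_F_DC)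

lemma psi_A: "j \<in> I \<Longrightarrow> v \<in> Z 0 \<Longrightarrow> A (child_lam k j) (psi S k p \<circ> F j) v = 0"
  using psi_laplacian has_laplacian_iff[OF psi_F_DC] by blast

lemma finite_inner: "finite (inner_vertices S)"
  by (simp add: inner_vertices_def finite_level_vertices)

lemma inner_subset: "inner_vertices S \<subseteq> X"
  using level_vertices_subset by (auto simp: inner_vertices_def)

lemma psi_inner: "p \<in> inner_vertices S \<Longrightarrow> q \<in> inner_vertices S \<Longrightarrow> psi S k p q = (if q = p then 1 else 0)"
  by (simp add: inner_vertices_def psi_vertex)

lemma psi_Z: "p \<in> inner_vertices S \<Longrightarrow> psi S k p \<in> Z 0"
  using psi_DC psi_vertex V0_subset_level[of 1] by (intro Z_0I) (auto simp: inner_vertices_def subset_iff)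

text \<open>Gauss--Green on each 1-cell leaves only normal derivatives at the vertices; collecting
  for each vertex the cells that contain it yields the entries of \<open>B_matrix\<close>. Vertices
  in \<open>V0\<close> drop out because \<open>v\<close> vanishes there.\<close>

lemma psi_B:
  assumes v: "v \<in> Z 0"
  shows "A k (psi S k p) v = (\<Sum>q\<in>inner_vertices S. v q * B_matrix S k p q)"
proof -
  define T where "T j x = cell_normal_derivative S [j] (psi S k p) x" for j x
  have T: "T j (F j q) = of_real (inverse (r j)) * normal_derivative S (psi S k p \<circ> F j) q" if "j \<in> I" for j q
    using inv_F[OF that] by (simp add: T_def cell_normal_derivative_def word_r_def)
  have vc: "v \<in> DC" using v by (rule Z_DC)
  have "A k (psi S k p) v = (\<Sum>j\<in>I. of_real (inverse (r j)) * energy S (psi S k p \<circ> F j) (v \<circ> F j))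
      + k * (\<Sum>j\<in>I. of_real (mwt S j) * (\<integral>x. psi S k p (F j x) * v (F j x) \<partial>M))"
  proof -
    have "continuous_on X (\<lambda>x. psi S k p x * v x)"
      by (intro continuous_intros DC_continuous[OF psi_DC] DC_continuous[OF vc])
    then show ?thesis
      unfolding A_def energy_glue[OF psi_DC vc] by (simp only: integral_self_similar)
  qed
  also have "\<dots> = (\<Sum>j\<in>I. \<Sum>q\<in>V0. v (F j q) * T j (F j q))"
    unfolding sum_distrib_left sum.distrib[symmetric]
  proof (intro sum.cong refl)
    fix j assume j: "j \<in> I"
    have "energy S (psi S k p \<circ> F j) (v \<circ> F j) + (\<integral>x. child_lam k j * (psi S k p \<circ> F j) x * (v \<circ> F j) x \<partial>M) =
        (\<Sum>q\<in>V0. (v \<circ> F j) q * normal_derivative S (psi S k p \<circ> F j) q)"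
      by (rule Gauss_Green[OF psi_laplacian[OF j] DC_F[OF vc j]])
    then have "of_real (inverse (r j)) * (energy S (psi S k p \<circ> F j) (v \<circ> F j)
        + child_lam k j * (\<integral>x. psi S k p (F j x) * v (F j x) \<partial>M)) =
        (\<Sum>q\<in>V0. v (F j q) * T j (F j q))"
      by (simp add: T[OF j] sum_distrib_left mult.assoc mult.left_commute)
    \<comment> \<open>The energy scales by \<open>1 / r j\<close> and the measure by
      \<open>mwt S j\<close>; \<open>child_lam\<close> makes both terms of the form on the cell
      carry the same factor.\<close>
    moreover have "of_real (inverse (r j)) * child_lam k j = k * of_real (mwt S j)"
      using r_pos[OF j] by (simp add: child_lam_def)
    ultimately show "of_real (inverse (r j)) * energy S (psi S k p \<circ> F j) (v \<circ> F j) +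
        k * (of_real (mwt S j) * (\<integral>x. psi S k p (F j x) * v (F j x) \<partial>M)) =
        (\<Sum>q\<in>V0. v (F j q) * T j (F j q))"
      by (simp add: distrib_left flip: mult.assoc)
  qed
  also have "\<dots> = (\<Sum>j\<in>I. \<Sum>x\<in>level_vertices S 1. if x \<in> F j ` V0 then v x * T j x else 0)"
  proof (rule sum.cong[OF refl])
    fix j assume j: "j \<in> I"
    have "(\<Sum>q\<in>V0. v (F j q) * T j (F j q)) = (\<Sum>x\<in>F j ` V0. v x * T j x)"
      using F_inj[OF j] by (subst sum.reindex) (auto simp: inj_on_def)
    also have "\<dots> = (\<Sum>x\<in>level_vertices S 1. if x \<in> F j ` V0 then v x * T j x else 0)"
    proof -
      have "level_vertices S 1 \<inter> F j ` V0 = F j ` V0" using j unfolding level_vertices_1 by blast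
      then show ?thesis
        using sum.inter_restrict[OF finite_level_vertices, of "\<lambda>x. v x * T j x" 1 "F j ` V0"] by simp
    qed
    finally show "(\<Sum>q\<in>V0. v (F j q) * T j (F j q)) =
        (\<Sum>x\<in>level_vertices S 1. if x \<in> F j ` V0 then v x * T j x else 0)" .
  qed
  also have "\<dots> = (\<Sum>x\<in>level_vertices S 1. \<Sum>j\<in>I. if x \<in> F j ` V0 then v x * T j x else 0)"
    by (rule sum.swap)
  also have "\<dots> = (\<Sum>x\<in>level_vertices S 1. v x * B_matrix S k p x)"
  proof (intro sum.cong refl)
    fix x assume "x \<in> level_vertices S 1"
    then obtain i q where iq: "i \<in> I" "q \<in> V0" "x = F i q" unfolding level_vertices_1 by blast
    \<comment> \<open>\<open>B_matrix\<close> sums over the cells that contain \<open>x\<close>, the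
      boundary terms over those of which \<open>x\<close> is a boundary point; for a vertex of level
      1 these are the same cells.\<close>
    have "x \<in> F j ` V0 \<longleftrightarrow> x \<in> cell S [j]" if j: "j \<in> I" for j
    proof
      assume "x \<in> cell S [j]"
      then obtain y where y: "y \<in> X" "x = F j y" by (auto simp: cell_single)
      have "y \<in> V0" using F_overlap(1)[OF j iq(1) _ y(1), of q] F_inj[OF j] iq y V0_subset
        by (cases "j = i") auto
      then show "x \<in> F j ` V0" using y by blast
    qed (use V0_subset in \<open>auto simp: cell_single\<close>)
    then have "(\<Sum>j\<in>I. if x \<in> F j ` V0 then v x * T j x else 0) = (\<Sum>j\<in>I. if x \<in> cell S [j] then v x * T j x else 0)"
      by (intro sum.cong) auto
    also have "\<dots> = v x * B_matrix S k p x"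
      unfolding B_matrix_def T_def sum_distrib_left
      using sum.inter_filter[of I "\<lambda>j. v x * cell_normal_derivative S [j] (psi S k p) x" "\<lambda>j. x \<in> cell S [j]"]
      by simp
    finally show "(\<Sum>j\<in>I. if x \<in> F j ` V0 then v x * T j x else 0) = v x * B_matrix S k p x" .
  qed
  also have "\<dots> = (\<Sum>q\<in>inner_vertices S. v q * B_matrix S k p q)"
    unfolding inner_vertices_def using finite_level_vertices Z_V0[OF v]
    by (intro sum.mono_neutral_right) auto
  finally show ?thesis .
qed

lemma psi_eq_green:
  assumes p: "p \<in> inner_vertices S" and x: "x \<in> X"
  shows "psi S k p x = (\<Sum>q\<in>inner_vertices S. B_matrix S k p q * green k q x)"
proof (rule unique_solution[OF k_not_eigenvalue psi_Z[OF p] _ _ x])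
  have g: "green k q \<in> Z 0" if "q \<in> inner_vertices S" for q
    using that inner_subset green_Z[OF k_not_eigenvalue] by blast
  show "(\<lambda>x. \<Sum>q\<in>inner_vertices S. B_matrix S k p q * green k q x) \<in> Z 0"
    using finite_inner g by (intro conjunct1[OF Zm.nrm_triangle_sum] Zm.scale)
  fix v assume v: "v \<in> Z 0"
  have "A k (\<lambda>x. \<Sum>q\<in>inner_vertices S. B_matrix S k p q * green k q x) v =
      (\<Sum>q\<in>inner_vertices S. A k (\<lambda>x. B_matrix S k p q * green k q x) v)"
    using finite_inner g v by (intro A_sum DC_scale) (auto dest: Z_DC)
  also have "\<dots> = (\<Sum>q\<in>inner_vertices S. v q * B_matrix S k p q)"
  proof (intro sum.cong refl)
    fix q assume q: "q \<in> inner_vertices S"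
    have "q \<in> X" using q inner_subset by blast
    then show "A k (\<lambda>x. B_matrix S k p q * green k q x) v = v q * B_matrix S k p q"
      using A_scale[OF Z_DC[OF g[OF q]] Z_DC[OF v]] green_eq[OF k_not_eigenvalue _ v] by simp
  qed
  finally show "A k (psi S k p) v = A k (\<lambda>x. \<Sum>q\<in>inner_vertices S. B_matrix S k p q * green k q x) v"
    unfolding psi_B[OF v] by simp
qed

text \<open>Evaluating \<open>psi_B\<close> at \<open>v = psi S k q\<close>, which is 1 at
  \<open>q\<close> and 0 at the other inner vertices, identifies the entry with
  \<open>A k (psi S k p) (psi S k q)\<close>.\<close>

lemma B_sym:
  assumes "p \<in> inner_vertices S" "q \<in> inner_vertices S"
  shows "B_matrix S k p q = B_matrix S k q p"
proof -
  have "A k (psi S k p) (psi S k q) = B_matrix S k p q" if pq: "p \<in> inner_vertices S" "q \<in> inner_vertices S" for p q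
  proof -
    have "A k (psi S k p) (psi S k q) = (\<Sum>s\<in>inner_vertices S. if s = q then B_matrix S k p s else 0)"
      unfolding psi_B[OF psi_Z[OF pq(2)]] using psi_inner[OF pq(2)] by (intro sum.cong) auto
    then show ?thesis using finite_inner pq by simp
  qed
  then show ?thesis using assms A_sym by metis
qed

lemma B_green:
  assumes "p \<in> inner_vertices S" "q \<in> inner_vertices S"
  shows "(\<Sum>s\<in>inner_vertices S. B_matrix S k p s * green k s q) = (if p = q then 1 else 0)"
  using psi_eq_green[OF assms(1), of q] psi_inner[OF assms] inner_subset assms(2) by auto

text \<open>\<open>G_matrix\<close> is a choice, so an inverse has to be produced before anything is
  known about it: the Green function is a right inverse of \<open>B\<close> by
  \<open>B_green\<close> and a left inverse by the symmetry of both. Any inverse agrees with it on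
  the inner vertices by associativity.\<close>

lemma G_matrix_eq_green:
  assumes p: "p \<in> inner_vertices S" and q: "q \<in> inner_vertices S"
  shows "G_matrix S k p q = green k p q"
proof -
  let ?I = "inner_vertices S"
  have gs: "green k a b = green k b a" if "a \<in> ?I" "b \<in> ?I" for a b
    using that inner_subset green_sym[OF k_not_eigenvalue] by blast
  have "(\<Sum>s\<in>?I. green k a s * B_matrix S k s b) = (if a = b then 1 else 0)" if "a \<in> ?I" "b \<in> ?I" for a b
  proof -
    have "(\<Sum>s\<in>?I. green k a s * B_matrix S k s b) = (\<Sum>s\<in>?I. B_matrix S k b s * green k s a)"
      using that gs B_sym by (intro sum.cong refl) (simp add: mult.commute)
    then show ?thesis using B_green[OF that(2,1)] by auto
  qed
  then have "is_inverse_matrix_on ?I (B_matrix S k) (green k)"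
    unfolding is_inverse_matrix_on_def using B_green by blast
  then have "is_inverse_matrix_on ?I (B_matrix S k) (G_matrix S k)"
    unfolding G_matrix_def by (rule someI[where P = "is_inverse_matrix_on ?I (B_matrix S k)"])
  then have left: "\<And>s. s \<in> ?I \<Longrightarrow> (\<Sum>t\<in>?I. G_matrix S k p t * B_matrix S k t s) = (if p = s then 1 else 0)"
    unfolding is_inverse_matrix_on_def using p by blast
  have "G_matrix S k p q = (\<Sum>t\<in>?I. if t = q then G_matrix S k p t else 0)" using finite_inner q by simp
  also have "\<dots> = (\<Sum>t\<in>?I. G_matrix S k p t * (\<Sum>s\<in>?I. B_matrix S k t s * green k s q))"
    using B_green[OF _ q] by (intro sum.cong) auto
  also have "\<dots> = (\<Sum>s\<in>?I. (\<Sum>t\<in>?I. G_matrix S k p t * B_matrix S k t s) * green k s q)"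
    unfolding sum_distrib_left sum_distrib_right by (subst sum.swap) (simp add: mult.assoc)
  also have "\<dots> = (\<Sum>s\<in>?I. if s = p then green k s q else 0)"
    using left by (intro sum.cong) auto
  also have "\<dots> = green k p q" using finite_inner p by simp
  finally show ?thesis .
qed

text \<open>The sum over \<open>p\<close> collapses: expanding \<open>psi S k p x\<close> in Green
  functions produces \<open>B\<close> times its inverse and leaves
  \<open>green k q x\<close>.\<close>

lemma Psi_eq:
  assumes x: "x \<in> X"
  shows "Psi S k x y = (\<Sum>q\<in>inner_vertices S. green k q x * psi S k q y)"
proof -
  let ?I = "inner_vertices S"
  have col: "(\<Sum>p\<in>?I. G_matrix S k p q * psi S k p x) = green k q x" if q: "q \<in> ?I" for q
  proof -
    have "(\<Sum>p\<in>?I. G_matrix S k p q * psi S k p x) =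
        (\<Sum>p\<in>?I. green k p q * (\<Sum>s\<in>?I. B_matrix S k p s * green k s x))"
      using G_matrix_eq_green[OF _ q] psi_eq_green[OF _ x] by simp
    also have "\<dots> = (\<Sum>s\<in>?I. (\<Sum>p\<in>?I. B_matrix S k s p * green k p q) * green k s x)"
      unfolding sum_distrib_left sum_distrib_right
      by (subst sum.swap) (intro sum.cong refl, simp add: B_sym mult_ac)
    also have "\<dots> = (\<Sum>s\<in>?I. if s = q then green k s x else 0)"
      using B_green[OF _ q] by (intro sum.cong) auto
    also have "\<dots> = green k q x" using finite_inner q by simp
    finally show ?thesis .
  qed
  have "Psi S k x y = (\<Sum>q\<in>?I. (\<Sum>p\<in>?I. G_matrix S k p q * psi S k p x) * psi S k q y)"
    unfolding Psi_def by (subst sum.swap) (simp add: sum_distrib_right)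
  then show ?thesis using col by simp
qed

text \<open>
  In the variable \<open>y\<close>, both sides have the same values on the vertices of level 1 and satisfy the
  same equation on every 1-cell.
\<close>

lemma green_decomposition:
  assumes x: "x \<in> X" and y: "y \<in> X"
  shows "green k x y = Psi S k x y +
    (\<Sum>j\<in>I. if x \<in> F j ` X \<and> y \<in> F j ` X then of_real (r j) * green (child_lam k j) (inv (F j) x) (inv (F j) y) else 0)"
proof -
  note gZ = green_Z[OF k_not_eigenvalue] green_Z[OF child_lam_not_eigenvalue]
  obtain j b where jb: "j \<in> I" "b \<in> X" "y = F j b" using X_cases[OF y] by blast
  \<comment> \<open>The summand of \<open>j\<close> in the local coordinate \<open>b\<close> on a
    cell that contains \<open>y\<close>; it is 0 if \<open>x\<close> lies outside that cell.\<close>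
  define c where "c = (\<lambda>b. if x \<in> F j ` X then of_real (r j) * green (child_lam k j) (inv (F j) x) b else 0)"
  have inv_x: "inv (F j) x \<in> X" if "x \<in> F j ` X" using that inv_F[OF jb(1)] by auto
  have cZ: "c \<in> Z 0"
    unfolding c_def using gZ(2)[OF jb(1) inv_x] Zm.scale Zm.zero by (cases "x \<in> F j ` X") auto
  define u where "u = green k x \<circ> F j"
  have u: "u \<in> DC" unfolding u_def by (rule DC_F[OF Z_DC[OF gZ(1)[OF x]] jb(1)])
  define h where "h = (\<lambda>b. \<Sum>q\<in>inner_vertices S. green k q x * (psi S k q \<circ> F j) b)"
  have h: "h \<in> DC" unfolding h_def using finite_inner psi_F_DC[OF jb(1)] by (intro DC_sum DC_scale)
  have "(\<lambda>b. u b - c b) b - h b = 0"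
  proof (rule not_eigenvalue_zero[OF child_lam_not_eigenvalue[OF jb(1)] _ _ jb(2)])
    show "(\<lambda>b. (u b - c b) - h b) \<in> Z 0"
    proof (rule Z_0I)
      show "(\<lambda>b. (u b - c b) - h b) \<in> DC" using u h Z_DC[OF cZ] by (intro DC_diff)
      fix q assume q: "q \<in> V0"
      have Fq: "F j q \<in> level_vertices S 1" using q jb(1) unfolding level_vertices_1 by blast
      then have FqX: "F j q \<in> X" using level_vertices_subset by blast
      have "h q = (\<Sum>s\<in>inner_vertices S. if s = F j q then green k s x else 0)"
        unfolding h_def o_def psi_vertex[OF Fq] by (intro sum.cong) auto
      also have "\<dots> = green k x (F j q)"
        using finite_inner Fq green_sym[OF k_not_eigenvalue x FqX] green_boundary_right[OF k_not_eigenvalue x]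
        by (auto simp: inner_vertices_def)
      finally show "(u q - c q) - h q = 0" using Z_V0[OF cZ q] by (simp add: u_def)
    qed
    fix v assume v: "v \<in> Z 0"
    have vc: "v \<in> DC" using v by (rule Z_DC)
    \<comment> \<open>The test function \<open>v\<close> on the cell is extended by 0, so that the
      equation of \<open>green k x\<close> on \<open>X\<close> can be used. Its right-hand side
      \<open>w x\<close> is then \<open>v\<close> at the local coordinate of \<open>x\<close>, or
      0.\<close>
    obtain w where w: "w \<in> DC" "\<And>a. a \<in> X \<Longrightarrow> w (F j a) = v a"
      "\<And>i a. i \<in> I \<Longrightarrow> i \<noteq> j \<Longrightarrow> a \<in> X \<Longrightarrow> w (F i a) = 0"
      using zero_extension[OF vc jb(1)] Z_V0[OF v] by blast
    have w0: "w \<in> Z 0"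
    proof (rule Z_0I[OF w(1)])
      fix q assume q: "q \<in> V0"
      obtain i where i: "i \<in> I" "F i q = q" using V0_fixed[OF q] by blast
      show "w q = 0" using w(2)[of q] w(3)[OF i(1), of q] i(2) q V0_subset Z_V0[OF v q] by (cases "i = j") auto
    qed
    have gc: "green k x \<in> DC" by (rule Z_DC[OF gZ(1)[OF x]])
    have "energy S (green k x) w = of_real (inverse (r j)) * energy S u v"
      unfolding u_def using gc w(1) jb(1) w(2,3) by (rule energy_zero_extension)
    moreover have "(\<integral>a. green k x a * w a \<partial>M) = of_real (mwt S j) * (\<integral>a. green k x (F j a) * v a \<partial>M)"
      using DC_continuous[OF gc] w(1) jb(1) w(2,3) by (rule integral_zero_extension)
    ultimately have "A k (green k x) w = of_real (inverse (r j)) * A (child_lam k j) u v"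
      unfolding A_def using r_pos[OF jb(1)] by (simp add: u_def child_lam_def field_simps)
    then have "A (child_lam k j) u v = of_real (r j) * w x"
      using green_eq[OF k_not_eigenvalue x w0] r_pos[OF jb(1)] by (simp add: field_simps)
    also have "\<dots> = A (child_lam k j) c v"
    proof (cases "x \<in> F j ` X")
      case True
      then obtain a where a: "a \<in> X" "x = F j a" by blast
      have "c = (\<lambda>b. of_real (r j) * green (child_lam k j) a b)" using True a inv_F[OF jb(1)] by (simp add: c_def)
      then show ?thesis
        using A_scale[OF Z_DC[OF gZ(2)[OF jb(1) a(1)]] vc, of "child_lam k j" "of_real (r j)"]
          green_eq[OF child_lam_not_eigenvalue[OF jb(1)] a(1) v] w(2)[OF a(1)] a by simp
    next
      case False
      obtain i a where "i \<in> I" "a \<in> X" "x = F i a" using X_cases[OF x] by blast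
      then have "w x = 0" using w(3) False by (cases "i = j") auto
      then show ?thesis using False A_zero[OF vc] by (simp add: c_def)
    qed
    finally have uc: "A (child_lam k j) (\<lambda>b. u b - c b) v = 0"
      using A_diff[OF u Z_DC[OF cZ] vc] by simp
    have "A (child_lam k j) h v = (\<Sum>q\<in>inner_vertices S. A (child_lam k j) (\<lambda>b. green k q x * (psi S k q \<circ> F j) b) v)"
      unfolding h_def using finite_inner psi_F_DC[OF jb(1)] vc by (intro A_sum DC_scale)
    also have "\<dots> = 0"
      using psi_A[OF jb(1) v] A_scale[OF psi_F_DC[OF jb(1)] vc] by (intro sum.neutral ballI) simp
    finally show "A (child_lam k j) (\<lambda>b. (u b - c b) - h b) v = 0"
      using A_diff[OF DC_diff[OF u Z_DC[OF cZ]] h vc] uc by simp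
  qed
  then have "green k x y = Psi S k x y + c b"
    unfolding Psi_eq[OF x] using jb by (simp add: u_def h_def algebra_simps)
  also have "c b = (\<Sum>i\<in>I. if i = j then c b else 0)" using jb(1) by simp
  also have "\<dots> = (\<Sum>i\<in>I. if x \<in> F i ` X \<and> y \<in> F i ` X then of_real (r i) * green (child_lam k i) (inv (F i) x) (inv (F i) y) else 0)"
  proof (intro sum.cong refl)
    fix i assume i: "i \<in> I"
    show "(if i = j then c b else 0) =
        (if x \<in> F i ` X \<and> y \<in> F i ` X then of_real (r i) * green (child_lam k i) (inv (F i) x) (inv (F i) y) else 0)"
    proof (cases "i = j")
      case True
      then show ?thesis using jb inv_F[OF jb(1)] by (auto simp: c_def)
    next
      case False
      \<comment> \<open>If \<open>y\<close> lies in a second cell as well, it is a boundary point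
        there and that summand vanishes, so only \<open>j\<close> counts.\<close>
      have "green (child_lam k i) (inv (F i) x) (inv (F i) y) = 0" if xy: "x \<in> F i ` X" "y \<in> F i ` X"
      proof -
        obtain a b' where ab: "a \<in> X" "b' \<in> X" "x = F i a" "y = F i b'" using xy by blast
        have "b' \<in> V0" using F_overlap(1)[OF i jb(1) False ab(2) jb(2)] ab jb by simp
        then show ?thesis using green_boundary_right[OF child_lam_not_eigenvalue[OF i] ab(1)] inv_F[OF i] ab by simp
      qed
      then show ?thesis using False by simp
    qed
  qed
  finally show ?thesis .
qed

end

section \<open>The resolvent kernel\<close>

context
  fixes lam :: complex
  assumes lam: "admissible lam"
begin

definition word_lam :: "nat list \<Rightarrow> complex" where
  "word_lam w = of_real (word_r S w * word_mu S w) * lam"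

lemma word_lam_Nil: "word_lam [] = lam"
  by (simp add: word_lam_def word_r_Nil word_mu_Nil)

lemma word_lam_snoc: "word_lam (w @ [j]) = child_lam (word_lam w) j"
  by (simp add: word_lam_def child_lam_def word_r_snoc word_mu_snoc mult_ac)

lemma word_lam_admissible: "w \<in> words S \<Longrightarrow> admissible (word_lam w)"
proof (induction w rule: rev_induct)
  case Nil
  then show ?case using lam by (simp add: word_lam_Nil)
next
  case (snoc j w)
  then have "w \<in> words S" "j \<in> I" by (auto simp: words_def)
  then show ?case using snoc.IH admissible_child_lam by (simp add: word_lam_snoc)
qed

lemma word_lam_not_eigenvalue: "w \<in> words S \<Longrightarrow> \<not> dirichlet_eigenvalue S (word_lam w)"
  using word_lam_admissible admissible_not_eigenvalue by blast

definition green_term :: "'a \<Rightarrow> 'a \<Rightarrow> nat list \<Rightarrow> complex" where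
  "green_term x y w = (if x \<in> cell S w \<and> y \<in> cell S w
     then of_real (word_r S w) * green (word_lam w) (inv (word_map S w) x) (inv (word_map S w) y) else 0)"

text \<open>This is \<open>green_decomposition\<close> with parameter \<open>word_lam w\<close>,
  read in the local coordinates of the cell of \<open>w\<close>. The subcells of that cell belong to
  the words \<open>w @ [j]\<close>, so letters are appended at the end.\<close>

lemma kernel_term_telescopes:
  assumes w: "w \<in> words S"
  shows "kernel_term S lam x y w = green_term x y w - (\<Sum>j\<in>I. green_term x y (w @ [j]))"
proof (cases "x \<in> cell S w \<and> y \<in> cell S w")
  case True
  then obtain a b where ab: "a \<in> X" "b \<in> X" "x = word_map S w a" "y = word_map S w b"
    by (auto simp: cell_def)
  have inv_w: "inv (word_map S w) x = a" "inv (word_map S w) y = b"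
    using word_map_inv[OF w] ab by simp_all
  have child: "green_term x y (w @ [j]) = of_real (word_r S w) *
      (if a \<in> F j ` X \<and> b \<in> F j ` X then of_real (r j) * green (child_lam (word_lam w) j) (inv (F j) a) (inv (F j) b) else 0)"
    if j: "j \<in> I" for j
  proof -
    have wj: "w @ [j] \<in> words S" using w j by (auto simp: words_def)
    have mem: "word_map S w c \<in> cell S (w @ [j]) \<longleftrightarrow> c \<in> F j ` X" for c
      using word_map_inj[OF w] by (auto simp: cell_def word_map_append)
    have inv_wj: "inv (word_map S (w @ [j])) (word_map S w c) = inv (F j) c" if c: "c \<in> F j ` X" for c
    proof -
      obtain d where "c = F j d" using c by blast
      then show ?thesis using word_map_inv[OF wj, of d] inv_F[OF j] by (simp add: word_map_append)
    qed
    show ?thesis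
      unfolding green_term_def ab(3,4) mem using inv_wj by (simp add: word_lam_snoc word_r_snoc mult.assoc)
  qed
  have "kernel_term S lam x y w = of_real (word_r S w) * Psi S (word_lam w) a b"
    using True inv_w by (simp add: kernel_term_def word_lam_def)
  also have "\<dots> = of_real (word_r S w) * (green (word_lam w) a b - (\<Sum>j\<in>I.
      if a \<in> F j ` X \<and> b \<in> F j ` X then of_real (r j) * green (child_lam (word_lam w) j) (inv (F j) a) (inv (F j) b) else 0))"
    unfolding green_decomposition[OF word_lam_admissible[OF w] ab(1,2)] by simp
  also have "\<dots> = green_term x y w - (\<Sum>j\<in>I. green_term x y (w @ [j]))"
    using True inv_w child by (simp add: green_term_def right_diff_distrib sum_distrib_left)
  finally show ?thesis .
next
  case False
  have "cell S (w @ [j]) \<subseteq> cell S w" if "j \<in> I" for j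
    using F_in_X[OF that] by (auto simp: cell_def word_map_append)
  then have "green_term x y (w @ [j]) = 0" if "j \<in> I" for j
    using False that by (auto simp: green_term_def)
  moreover have "green_term x y w = 0" "kernel_term S lam x y w = 0"
    using False by (auto simp: kernel_term_def green_term_def)
  ultimately show ?thesis by simp
qed

lemma green_term_norm:
  assumes w: "w \<in> words S" and C: "0 \<le> C" "\<And>a b. a \<in> X \<Longrightarrow> b \<in> X \<Longrightarrow> cmod (green (word_lam w) a b) \<le> C"
  shows "cmod (green_term x y w) \<le> word_r S w * C"
proof (cases "x \<in> cell S w \<and> y \<in> cell S w")
  case True
  then obtain a b where "a \<in> X" "b \<in> X" "x = word_map S w a" "y = word_map S w b"
    by (auto simp: cell_def)
  then show ?thesis
    using True C(2)[of a b] word_r_pos[OF w] word_map_inv[OF w]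
    by (simp add: green_term_def norm_mult)
next
  case False
  then show ?thesis using C(1) word_r_pos[OF w] by (auto simp: green_term_def)
qed

text \<open>A point of two cells of the same level is a vertex of both, where the Green function vanishes.\<close>

lemma green_term_unique:
  assumes w: "w \<in> W m" "w' \<in> W m" "w \<noteq> w'" and nz: "green_term x y w \<noteq> 0"
  shows "green_term x y w' = 0"
proof (rule ccontr)
  assume nz': "green_term x y w' \<noteq> 0"
  have ww: "w \<in> words S" using w(1) by (rule words_of_length_imp_word)
  obtain a c b where abc: "a \<in> X" "c \<in> X" "b \<in> X" "x = word_map S w a" "x = word_map S w' c" "y = word_map S w b"
    using nz nz' by (auto simp: green_term_def cell_def split: if_splits)
  have "a \<in> V0" using word_overlap(1)[OF w abc(1,2)] abc by simp
  then have "green (word_lam w) a b = 0" using green_boundary_left[OF word_lam_not_eigenvalue[OF ww]] abc(3) by blast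
  then show False using nz word_map_inv[OF ww] abc by (simp add: green_term_def split: if_splits)
qed

text \<open>By \<open>green_term_unique\<close> at most one summand is nonzero, so the number of
  words of length \<open>m\<close> does not enter the estimates.\<close>

lemma sum_green_term:
  "\<exists>w\<in>W m. (\<Sum>w\<in>W m. cmod (green_term x y w)) = cmod (green_term x y w)"
proof (cases "\<exists>w\<in>W m. green_term x y w \<noteq> 0")
  case True
  then obtain w where w: "w \<in> W m" "green_term x y w \<noteq> 0" by blast
  have "(\<Sum>v\<in>W m. cmod (green_term x y v)) = (\<Sum>v\<in>W m. if v = w then cmod (green_term x y w) else 0)"
    using green_term_unique[OF w(1) _ _ w(2)] by (intro sum.cong) auto
  then show ?thesis using w finite_words_of_length by auto
next
  case False
  obtain x0 where "x0 \<in> X" using X_nonempty by blast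
  then obtain w where "w \<in> W m" using cells_cover by blast
  then show ?thesis using False by (intro bexI[of _ w]) auto
qed

text \<open>From level \<open>m0\<close> on, the parameters satisfy
  \<open>cmod (word_lam w) * res \<le> 1 / 2\<close>, and \<open>green_small\<close> bounds all
  Green functions involved by \<open>2 * res\<close>; the prefactor \<open>word_r S w\<close>
  supplies the decay.\<close>

lemma level_sum_bound:
  obtains m0 where "\<And>m x y. m \<ge> m0 \<Longrightarrow> (\<Sum>w\<in>W m. cmod (green_term x y w)) \<le> rmax ^ m * (2 * res)"
proof -
  have "(\<lambda>m. rmax ^ m * (cmod lam * res)) \<longlonglongrightarrow> 0"
    using rmax_pos rmax_less_1 by (intro tendsto_mult_left_zero LIMSEQ_power_zero) auto
  then have "\<forall>\<^sub>F m in sequentially. rmax ^ m * (cmod lam * res) < 1 / 2"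
    by (rule order_tendstoD(2)) simp
  then obtain m0 where m0: "\<And>m. m \<ge> m0 \<Longrightarrow> rmax ^ m * (cmod lam * res) < 1 / 2"
    by (auto simp: eventually_sequentially)
  show thesis
  proof (rule that)
    fix m x y assume m: "m \<ge> m0"
    obtain w where w: "w \<in> W m" "(\<Sum>w\<in>W m. cmod (green_term x y w)) = cmod (green_term x y w)"
      using sum_green_term by blast
    have ww: "w \<in> words S" using w(1) by (rule words_of_length_imp_word)
    have "cmod (word_lam w) \<le> rmax ^ m * cmod lam"
    proof -
      have "word_r S w * word_mu S w \<le> rmax ^ m * 1"
        using word_r_le[OF w(1)] word_mu_le_1[OF ww] word_r_pos[OF ww] word_mu_pos[OF ww] rmax_pos
        by (intro mult_mono) auto
      then show ?thesis
        using word_r_pos[OF ww] word_mu_pos[OF ww]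
        by (simp add: word_lam_def norm_mult mult_right_mono del: of_real_mult)
    qed
    then have "cmod (word_lam w) * res \<le> rmax ^ m * cmod lam * res"
      using res_pos by (intro mult_right_mono) auto
    then have "cmod (word_lam w) * res \<le> 1 / 2" using m0[OF m] by (simp add: mult.assoc)
    then have "cmod (green_term x y w) \<le> word_r S w * (2 * res)"
      using green_small[OF word_lam_not_eigenvalue[OF ww]] res_pos by (intro green_term_norm ww) auto
    also have "\<dots> \<le> rmax ^ m * (2 * res)" using word_r_le[OF w(1)] res_pos by (intro mult_right_mono) auto
    finally show "(\<Sum>w\<in>W m. cmod (green_term x y w)) \<le> rmax ^ m * (2 * res)" unfolding w(2) .
  qed
qed

lemma partial_kernel_sum:
  assumes "x \<in> X" "y \<in> X"
  shows "(\<Sum>k<m. \<Sum>w\<in>W k. kernel_term S lam x y w) = green lam x y - (\<Sum>w\<in>W m. green_term x y w)"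
proof (induction m)
  case 0
  have "inv (word_map S []) z = z" for z by simp
  then show ?case using assms by (simp add: words_of_length_0 green_term_def cell_Nil word_lam_Nil word_r_Nil)
next
  case (Suc m)
  have "(\<Sum>w\<in>W m. kernel_term S lam x y w) = (\<Sum>w\<in>W m. green_term x y w) - (\<Sum>w\<in>W (Suc m). green_term x y w)"
    unfolding sum_words_Suc_snoc sum_subtractf[symmetric]
    by (intro sum.cong[OF refl] kernel_term_telescopes words_of_length_imp_word)
  then show ?case using Suc by simp
qed

lemma words_Union: "words S = (\<Union>m. W m)"
  by (auto simp: words_of_length_def)

text \<open>The infinite sum over words is unconditional, so absolute summability is established: by
  telescoping, the terms of level \<open>m\<close> add up to at most \<open>t m + t (Suc m)\<close>,
  where \<open>t\<close> is eventually below a geometric sequence. The value is then found along the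
  exhaustion of the words by their lengths.\<close>

lemma
  assumes x: "x \<in> X" and y: "y \<in> X"
  shows kernel_summable: "kernel_term S lam x y summable_on words S"
    and resolvent_kernel_eq: "resolvent_kernel S lam x y = green lam x y"
proof -
  obtain m0 where m0: "\<And>m x y. m \<ge> m0 \<Longrightarrow> (\<Sum>w\<in>W m. cmod (green_term x y w)) \<le> rmax ^ m * (2 * res)"
    using level_sum_bound by blast
  define t where "t m = (\<Sum>w\<in>W m. cmod (green_term x y w))" for m
  have t0: "0 \<le> t m" for m unfolding t_def by (intro sum_nonneg) auto
  have geo: "summable (\<lambda>m. rmax ^ m * (2 * res))"
    using rmax_pos rmax_less_1 by (intro summable_mult2 summable_geometric) auto
  have t_summable: "summable t"
    using m0 t0 by (intro summable_comparison_test'[OF geo, of m0]) (auto simp: t_def)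
  have level: "(\<Sum>w\<in>W m. cmod (kernel_term S lam x y w)) \<le> t m + t (Suc m)" for m
  proof -
    have "cmod (kernel_term S lam x y w) \<le> cmod (green_term x y w) + (\<Sum>j\<in>I. cmod (green_term x y (w @ [j])))"
      if "w \<in> W m" for w
      unfolding kernel_term_telescopes[OF words_of_length_imp_word[OF that]]
      by (rule order_trans[OF norm_triangle_ineq4 add_left_mono[OF norm_sum]])
    then have "(\<Sum>w\<in>W m. cmod (kernel_term S lam x y w)) \<le>
        (\<Sum>w\<in>W m. cmod (green_term x y w) + (\<Sum>j\<in>I. cmod (green_term x y (w @ [j]))))"
      by (rule sum_mono)
    then show ?thesis by (simp add: t_def sum.distrib sum_words_Suc_snoc)
  qed
  have disj: "W i \<inter> W j = {}" if "i \<noteq> j" for i j using that by (auto simp: words_of_length_def)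
  have tt: "summable (\<lambda>m. t m + t (Suc m))"
    using t_summable by (intro summable_add) (simp_all add: summable_Suc_iff)
  have abs: "(\<lambda>w. norm (kernel_term S lam x y w)) summable_on words S"
  proof (rule nonneg_bdd_above_summable_on)
    show "bdd_above (sum (\<lambda>w. norm (kernel_term S lam x y w)) ` {B. B \<subseteq> words S \<and> finite B})"
    proof (rule bdd_aboveI2)
      fix B assume "B \<in> {B. B \<subseteq> words S \<and> finite B}"
      then have B: "B \<subseteq> words S" "finite B" by auto
      obtain n where n: "\<And>w. w \<in> B \<Longrightarrow> length w < n"
      proof -
        have "finite (length ` B)" using B(2) by simp
        then obtain n where "\<forall>k\<in>length ` B. k < n" using finite_nat_set_iff_bounded by blast
        then show thesis using that by blast
      qed
      have "B \<subseteq> (\<Union>m<n. W m)" using B(1) n by (auto simp: words_of_length_def)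
      then have "(\<Sum>w\<in>B. norm (kernel_term S lam x y w)) \<le> (\<Sum>w\<in>(\<Union>m<n. W m). norm (kernel_term S lam x y w))"
        by (intro sum_mono2) (auto simp: finite_words_of_length)
      also have "\<dots> = (\<Sum>m<n. \<Sum>w\<in>W m. norm (kernel_term S lam x y w))"
        using disj by (intro sum.UNION_disjoint) (auto simp: finite_words_of_length)
      also have "\<dots> \<le> (\<Sum>m<n. t m + t (Suc m))" using level by (intro sum_mono)
      also have "\<dots> \<le> (\<Sum>m. t m + t (Suc m))" using t0 tt by (intro sum_le_suminf) auto
      finally show "(\<Sum>w\<in>B. norm (kernel_term S lam x y w)) \<le> (\<Sum>m. t m + t (Suc m))" .
    qed
  qed auto
  show summable: "kernel_term S lam x y summable_on words S"
    using abs by (rule abs_summable_summable)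
  have "(sum (kernel_term S lam x y) \<longlongrightarrow> resolvent_kernel S lam x y) (finite_subsets_at_top (words S))"
    using has_sum_infsum[OF summable] by (simp add: has_sum_def resolvent_kernel_def)
  moreover have "filterlim (\<lambda>n. \<Union>m<n. W m) (finite_subsets_at_top (words S)) sequentially"
    unfolding filterlim_finite_subsets_at_top
  proof (intro allI impI)
    fix B assume B: "finite B \<and> B \<subseteq> words S"
    then have "finite (length ` B)" by simp
    then obtain n where n: "\<forall>k\<in>length ` B. k < n" using finite_nat_set_iff_bounded by blast
    show "\<forall>\<^sub>F n in sequentially. finite (\<Union>m<n. W m) \<and> B \<subseteq> (\<Union>m<n. W m) \<and> (\<Union>m<n. W m) \<subseteq> words S"
      unfolding eventually_sequentially
    proof (intro exI[of _ n] allI impI conjI)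
      fix k assume "n \<le> k"
      show "finite (\<Union>m<k. W m)" using finite_words_of_length by blast
      show "B \<subseteq> (\<Union>m<k. W m)"
      proof
        fix w assume w: "w \<in> B"
        then have "w \<in> W (length w)" "length w < k"
          using B n \<open>n \<le> k\<close> words_iff by auto
        then show "w \<in> (\<Union>m<k. W m)" by blast
      qed
      show "(\<Union>m<k. W m) \<subseteq> words S" using words_Union by blast
    qed
  qed
  ultimately have "(\<lambda>n. \<Sum>w\<in>(\<Union>m<n. W m). kernel_term S lam x y w) \<longlonglongrightarrow> resolvent_kernel S lam x y"
    by (rule filterlim_compose)
  moreover have "(\<Sum>w\<in>(\<Union>m<n. W m). kernel_term S lam x y w) = green lam x y - (\<Sum>w\<in>W n. green_term x y w)" for n
    unfolding partial_kernel_sum[OF x y, symmetric]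
    using disj by (intro sum.UNION_disjoint) (auto simp: finite_words_of_length)
  ultimately have lim: "(\<lambda>n. green lam x y - (\<Sum>w\<in>W n. green_term x y w)) \<longlonglongrightarrow> resolvent_kernel S lam x y" by simp
  have "(\<lambda>n. \<Sum>w\<in>W n. green_term x y w) \<longlonglongrightarrow> 0"
    using summable_LIMSEQ_zero[OF t_summable]
    by (rule Lim_null_comparison[rotated]) (auto simp: t_def intro!: always_eventually norm_sum)
  then have "(\<lambda>n. green lam x y - (\<Sum>w\<in>W n. green_term x y w)) \<longlonglongrightarrow> green lam x y - 0"
    by (intro tendsto_diff tendsto_const)
  then show "resolvent_kernel S lam x y = green lam x y" using LIMSEQ_unique[OF lim] by simp
qed

section \<open>The equations with a Dirac mass and with a square-integrable function\<close>

lemma L2_integrable: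
  assumes f: "f \<in> L2_functions S" shows "integrable M (f :: 'a \<Rightarrow> complex)"
proof (rule Bochner_Integration.integrable_bound)
  show "integrable M (\<lambda>x. 1 + (norm (f x))\<^sup>2)" using f by (simp add: L2_functions_def)
  show "f \<in> borel_measurable M" using f by (simp add: L2_functions_def)
  have "t \<le> 1 + t\<^sup>2" for t :: real
  proof -
    have "0 \<le> (t - 1)\<^sup>2 + t\<^sup>2 + 1" by simp
    then show ?thesis by (simp add: power2_eq_square algebra_simps)
  qed
  then show "AE x in M. norm (f x) \<le> norm (1 + (norm (f x))\<^sup>2)"
    by (intro AE_I2) (simp add: abs_of_nonneg add_nonneg_nonneg)
qed

lemma integrable_times_continuous:
  assumes f: "integrable M f" and v: "continuous_on X v"
  shows "integrable M (\<lambda>x. f x * v x :: complex)"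
proof -
  obtain b where b: "b > 0" "\<And>x. x \<in> X \<Longrightarrow> cmod (v x) \<le> b" using continuous_bounded[OF v] by blast
  show ?thesis
  proof (rule Bochner_Integration.integrable_bound)
    show "integrable M (\<lambda>x. norm (f x) * b)" using f by simp
    show "(\<lambda>x. f x * v x) \<in> borel_measurable M"
      using borel_measurable_integrable[OF f] continuous_measurable[OF v] by (rule borel_measurable_times)
    show "AE x in M. norm (f x * v x) \<le> norm (norm (f x) * b)"
      using b by (intro AE_I2) (simp add: norm_mult space_M mult_left_mono)
  qed
qed

lemma green_continuous_right: "x \<in> X \<Longrightarrow> continuous_on X (green lam x)"
  using green_Z[OF admissible_not_eigenvalue[OF lam]] Z_DC DC_continuous by blast

text \<open>On \<open>X\<close> the kernel is \<open>green lam x\<close>, and the identity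
  \<open>A lam (green lam x) v = v x\<close> is already the equation with the Dirac mass at
  \<open>x\<close>; what remains is to evaluate the integral of \<open>v\<close> against the complex
  measure.\<close>

lemma kernel_measure_laplacian:
  assumes x: "x \<in> X"
  shows "has_measure_laplacian S (resolvent_kernel S lam x)
    (\<lambda>B. lam * function_measure S (resolvent_kernel S lam x) B - dirac_measure x B)"
proof -
  define g where "g = resolvent_kernel S lam x"
  have g: "g y = green lam x y" if "y \<in> X" for y unfolding g_def by (rule resolvent_kernel_eq[OF x that])
  have gc: "continuous_on X g"
    by (rule continuous_on_eq[OF green_continuous_right[OF x]]) (simp add: g)
  obtain b where b: "\<And>y. y \<in> X \<Longrightarrow> cmod (g y) \<le> b" using continuous_bounded[OF gc] by blast
  note gZ = green_Z[OF admissible_not_eigenvalue[OF lam] x]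
  have gb: "\<And>y. y \<in> space M \<Longrightarrow> cmod (g y) \<le> b" using b by (simp add: space_M)
  have xM: "x \<in> space M" using x by (simp add: space_M)
  have eq: "energy S g v = - complex_measure_integral M (\<lambda>B. lam * (LINT y:B|M. g y) - dirac_measure x B) v"
    if v: "v \<in> Z 0" for v
  proof -
    obtain c where c: "\<And>y. y \<in> X \<Longrightarrow> cmod (v y) \<le> c" using continuous_bounded[OF DC_continuous[OF Z_DC[OF v]]] by blast
    have "complex_measure_integral M (\<lambda>B. lam * (LINT y:B|M. g y) - dirac_measure x B) v =
        lam * (\<integral>y. g y * v y \<partial>M) - v x"
      using c continuous_measurable[OF DC_continuous[OF Z_DC[OF v]]]
      by (intro function_minus_dirac_integral[OF prob_space_M xM continuous_measurable[OF gc] gb, of _ c])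
        (auto simp: space_M)
    moreover have "A lam g v = v x"
      using green_eq[OF admissible_not_eigenvalue[OF lam] x v] A_cong[of g "green lam x" v v lam] g by simp
    then have "energy S g v = v x - lam * (\<integral>y. g y * v y \<partial>M)"
      unfolding A_def by (simp only: eq_diff_eq)
    ultimately show ?thesis by simp
  qed
  have "complex_measure M (\<lambda>B. lam * (LINT y:B|M. g y) - dirac_measure x B)"
    by (rule function_minus_dirac_complex_measure[OF prob_space_M xM continuous_measurable[OF gc] gb])
  moreover have "g \<in> DC" by (rule DC_cong[OF Z_DC[OF gZ]]) (simp add: g)
  ultimately show ?thesis
    unfolding has_measure_laplacian_def function_measure_def g_def[symmetric] dom0_eq using eq by blast
qed

text \<open>\<open>Fredholm\<close> provides a solution \<open>u\<close>, and testing its equation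
  with \<open>green lam x\<close> gives \<open>u x = \<integral>f g\<close> with
  \<open>g = green lam x\<close>, by symmetry of the form. This takes the place of applying the
  operator under the integral sign.\<close>

lemma resolvent_kernel_solves:
  assumes f: "f \<in> L2_functions S"
  shows "is_dirichlet_resolvent S lam f (\<lambda>x. \<integral>y. resolvent_kernel S lam x y * f y \<partial>M)"
proof -
  define U where "U x = (\<integral>y. resolvent_kernel S lam x y * f y \<partial>M)" for x
  note nev = admissible_not_eigenvalue[OF lam]
  have fint: "integrable M f" using f by (rule L2_integrable)
  have fv: "integrable M (\<lambda>x. f x * v x)" if "v \<in> DC" for v
    using fint DC_continuous[OF that] by (rule integrable_times_continuous)
  define C where "C = (\<integral>x. norm (f x) \<partial>M) * sqrt res"
  have C: "0 \<le> C" using res_pos by (auto simp: C_def intro!: mult_nonneg_nonneg integral_nonneg)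
  have l: "Zm.functional 0 (\<lambda>v. \<integral>x. f x * v x \<partial>M) C"
    unfolding Zm.functional_def
  proof (intro conjI ballI allI)
    fix u v assume "u \<in> Z 0" "v \<in> Z 0"
    then show "(\<integral>x. f x * (u x + v x) \<partial>M) = (\<integral>x. f x * u x \<partial>M) + (\<integral>x. f x * v x \<partial>M)"
      using fv[OF Z_DC] by (simp add: distrib_left)
  next
    fix c u
    show "(\<integral>x. f x * (c * u x) \<partial>M) = c * (\<integral>x. f x * u x \<partial>M)" by (simp add: mult.left_commute)
  next
    fix u assume u: "u \<in> Z 0"
    have "cmod (\<integral>x. f x * u x \<partial>M) \<le> (\<integral>x. cmod (f x * u x) \<partial>M)" by (rule integral_norm_bound)
    also have "\<dots> \<le> (\<integral>x. norm (f x) * (sqrt res * nrm u) \<partial>M)"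
    proof (rule integral_mono)
      show "integrable M (\<lambda>x. cmod (f x * u x))" using fv[OF Z_DC[OF u]] by (rule integrable_norm)
      show "integrable M (\<lambda>x. norm (f x) * (sqrt res * nrm u))" using fint by simp
      show "cmod (f x * u x) \<le> norm (f x) * (sqrt res * nrm u)" if "x \<in> space M" for x
        using Z0_bound[OF u] that by (simp add: norm_mult space_M mult_left_mono)
    qed
    finally show "cmod (\<integral>x. f x * u x \<partial>M) \<le> C * nrm u" by (simp add: C_def mult.assoc)
  qed
  obtain K where K: "\<forall>l C. 0 \<le> C \<longrightarrow> Zm.functional 0 l C \<longrightarrow>
      (\<exists>u\<in>Z 0. nrm u \<le> K * C \<and> (\<forall>v\<in>Z 0. A lam u v = l v))" using Fredholm[OF nev] by blast
  have "\<exists>u\<in>Z 0. nrm u \<le> K * C \<and> (\<forall>v\<in>Z 0. A lam u v = (\<integral>x. f x * v x \<partial>M))"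
    using spec[OF spec[OF K, of "\<lambda>v. \<integral>x. f x * v x \<partial>M"], of C] C l by simp
  then obtain u where u: "u \<in> Z 0" "\<And>v. v \<in> Z 0 \<Longrightarrow> A lam u v = (\<integral>x. f x * v x \<partial>M)" by blast
  have U: "U x = u x" if x: "x \<in> X" for x
  proof -
    have "U x = (\<integral>y. f y * green lam x y \<partial>M)"
      unfolding U_def using resolvent_kernel_eq[OF x]
      by (intro Bochner_Integration.integral_cong) (auto simp: space_M mult.commute)
    also have "\<dots> = u x"
      using u(2)[OF green_Z[OF nev x]] green_eq[OF nev x u(1)] by (simp add: A_sym)
    finally show ?thesis .
  qed
  \<comment> \<open>The resolvent equation is rewritten in terms of \<open>A lam\<close>, including
    the square-integrability of \<open>lam * u' - f\<close>, so that \<open>unique_solution\<close>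
    applies to it.\<close>
  have solves: "dirichlet_resolvent_solution S lam f u' \<longleftrightarrow>
      u' \<in> Z 0 \<and> (\<forall>v\<in>Z 0. A lam u' v = (\<integral>x. f x * v x \<partial>M))" for u'
  proof (cases "u' \<in> Z 0")
    case True
    note uc = DC_continuous[OF Z_DC[OF True]]
    have um: "u' \<in> borel_measurable M" using uc by (rule continuous_measurable)
    have fm: "f \<in> borel_measurable M" using f by (simp add: L2_functions_def)
    have "(\<lambda>x. lam * u' x - f x) \<in> L2_functions S"
      unfolding L2_functions_def
    proof (intro CollectI conjI)
      show meas: "(\<lambda>x. lam * u' x - f x) \<in> borel_measurable M" using um fm by measurable
      show "integrable M (\<lambda>x. (norm (lam * u' x - f x))\<^sup>2)"
      proof (rule Bochner_Integration.integrable_bound)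
        have "integrable M (\<lambda>x. (norm (lam * u' x))\<^sup>2)" using uc by (intro continuous_integrable continuous_intros)
        then show "integrable M (\<lambda>x. 2 * (norm (lam * u' x))\<^sup>2 + 2 * (norm (f x))\<^sup>2)"
          using f by (simp add: L2_functions_def)
        show "(\<lambda>x. (norm (lam * u' x - f x))\<^sup>2) \<in> borel_measurable M" using meas by measurable
        have "(norm (a - b))\<^sup>2 \<le> 2 * (norm a)\<^sup>2 + 2 * (norm b)\<^sup>2" for a b :: complex
        proof -
          have "(norm (a - b))\<^sup>2 \<le> (norm a + norm b)\<^sup>2" by (intro power_mono norm_triangle_ineq4) simp
          moreover have "0 \<le> (norm a - norm b)\<^sup>2" by simp
          ultimately show ?thesis by (simp add: power2_eq_square algebra_simps)
        qed
        then show "AE x in M. norm ((norm (lam * u' x - f x))\<^sup>2) \<le> norm (2 * (norm (lam * u' x))\<^sup>2 + 2 * (norm (f x))\<^sup>2)"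
          by (intro AE_I2) (simp add: abs_of_nonneg add_nonneg_nonneg)
      qed
    qed
    moreover have "energy S u' v = - (\<integral>x. (lam * u' x - f x) * v x \<partial>M) \<longleftrightarrow>
        A lam u' v = (\<integral>x. f x * v x \<partial>M)" if v: "v \<in> Z 0" for v
    proof -
      have eq: "(\<integral>x. (lam * u' x - f x) * v x \<partial>M) = lam * (\<integral>x. u' x * v x \<partial>M) - (\<integral>x. f x * v x \<partial>M)"
        using DC_integrable[OF Z_DC[OF True] Z_DC[OF v]] fv[OF Z_DC[OF v]]
        by (simp add: left_diff_distrib mult.assoc)
      show ?thesis unfolding A_def eq by (simp only: minus_diff_eq eq_diff_eq)
    qed
    ultimately show ?thesis
      using True Z_DC[OF True] Z_V0[OF True]
      unfolding dirichlet_resolvent_solution_def has_L2_laplacian_def weak_laplacian_def dom0_eq by blast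
  next
    case False
    then show ?thesis
      using Z_0I[of u']
      unfolding dirichlet_resolvent_solution_def has_L2_laplacian_def weak_laplacian_def by blast
  qed
  have UZ: "U \<in> Z 0"
  proof (rule Z_0I)
    show "U \<in> DC" by (rule DC_cong[OF Z_DC[OF u(1)]]) (simp add: U)
    show "U q = 0" if "q \<in> V0" for q using U[OF subsetD[OF V0_subset that]] Z_V0[OF u(1) that] by simp
  qed
  have "A lam U v = A lam u v" for v by (rule A_cong) (simp_all add: U)
  then have UA: "\<forall>v\<in>Z 0. A lam U v = (\<integral>x. f x * v x \<partial>M)" using u(2) by simp
  have "u' x = U x" if sol: "dirichlet_resolvent_solution S lam f u'" and x: "x \<in> X" for u' x
  proof -
    have "u' \<in> Z 0" "\<forall>v\<in>Z 0. A lam u' v = (\<integral>x. f x * v x \<partial>M)" using sol solves by blast+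
    then show ?thesis using unique_solution[of lam u' U x] nev UZ UA x by simp
  qed
  then show ?thesis
    unfolding is_dirichlet_resolvent_def U_def[symmetric] using solves UZ UA by blast
qed

lemma resolvent_kernel_properties:
  "(\<forall>x\<in>X. \<forall>y\<in>X. kernel_term S lam x y summable_on words S) \<and>
    (\<forall>x\<in>X. \<forall>y\<in>X. resolvent_kernel S lam x y = resolvent_kernel S lam y x) \<and>
    continuous_on (X \<times> X) (\<lambda>(x, y). resolvent_kernel S lam x y) \<and>
    (\<forall>x\<in>X. has_measure_laplacian S (resolvent_kernel S lam x)
       (\<lambda>B. lam * function_measure S (resolvent_kernel S lam x) B - dirac_measure x B)) \<and>
    (\<forall>x\<in>X. \<forall>y\<in>V0. resolvent_kernel S lam x y = 0) \<and>
    (\<forall>f\<in>L2_functions S. is_dirichlet_resolvent S lam f (\<lambda>x. \<integral>y. resolvent_kernel S lam x y * f y \<partial>M))"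
proof (intro conjI ballI)
  note nev = admissible_not_eigenvalue[OF lam]
  show "kernel_term S lam x y summable_on words S" if "x \<in> X" "y \<in> X" for x y
    using that by (rule kernel_summable)
  show "resolvent_kernel S lam x y = resolvent_kernel S lam y x" if "x \<in> X" "y \<in> X" for x y
    using that green_sym[OF nev] by (simp add: resolvent_kernel_eq)
  show "continuous_on (X \<times> X) (\<lambda>(x, y). resolvent_kernel S lam x y)"
    by (rule continuous_on_eq[OF green_continuous[OF nev]]) (auto simp: resolvent_kernel_eq)
  show "resolvent_kernel S lam x y = 0" if "x \<in> X" "y \<in> V0" for x y
    using that V0_subset green_boundary_right[OF nev] by (auto simp: resolvent_kernel_eq subset_iff)
qed (fact kernel_measure_laplacian resolvent_kernel_solves)+

end

end

theorem theorem3p12: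
  fixes S :: "'a::euclidean_space pcf" and lam :: complex
  assumes "self_similar_set S"
    and "post_critically_finite S"
    and "self_similar_energy S"
    and "self_similar_measure S"
    and "\<forall>w\<in>words S. \<not> dirichlet_eigenvalue S (of_real (word_r S w * word_mu S w) * lam)"
  shows "(\<forall>x\<in>attr S. \<forall>y\<in>attr S. kernel_term S lam x y summable_on words S) \<and>
    (\<forall>x\<in>attr S. \<forall>y\<in>attr S. resolvent_kernel S lam x y = resolvent_kernel S lam y x) \<and>
    continuous_on (attr S \<times> attr S) (\<lambda>(x, y). resolvent_kernel S lam x y) \<and>
    (\<forall>x\<in>attr S. has_measure_laplacian S (resolvent_kernel S lam x)
       (\<lambda>A. lam * function_measure S (resolvent_kernel S lam x) A - dirac_measure x A)) \<and>
    (\<forall>x\<in>attr S. \<forall>y\<in>bdry S. resolvent_kernel S lam x y = 0) \<and>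
    (\<forall>f\<in>L2_functions S.
       is_dirichlet_resolvent S lam f
         (\<lambda>x. \<integral>y. resolvent_kernel S lam x y * f y \<partial>meas S))"
proof -
  interpret pcf_energy S by unfold_locales (use assms in auto)
  show ?thesis by (rule resolvent_kernel_properties) (use assms(5) in \<open>simp add: admissible_def\<close>)
qed

end
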